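(* Let $q$ be a power of a prime $p$ and $K$ an algebraic closure of $\mathbb{F}_q$, with $\mathrm{PGL}(3,q)$ acting on $\mathrm{PG}(2,K)$. Then $d(\mathrm{PGL}(3,q))=q^3-q^2$, $\varepsilon(\mathrm{PGL}(3,q))=q^2-q$, and the DGZ curve is the only $\mathrm{PGL}(3,q)$-invariant irreducible plane curve of degree $q^3-q^2$.
   Context: Plane curves are over $K$; irreducible means irreducible over $K$; $G$-invariant means mapped onto itself by every element of $G$. $d(G)$ is the smallest degree of a $G$-invariant irreducible plane curve other than a line; $\varepsilon(G)=d'(G)-d(G)$ where $d'(G)$ is the smallest degree larger than $d(G)$ of a $G$-invariant irreducible plane curve. The DGZ curve has affine equation $\frac{(X^{q^3}-X)(Y^{q}-Y)-(Y^{q^3}-Y)(X^{q}-X)}{(X^{q^2}-X)(Y^q-Y)-(Y^{q^2}-Y)(X^q-X)}=0$ (exact polynomial quotient). *)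

theory Defs
  imports "HOL-Analysis.Analysis" "HOL-Computational_Algebra.Polynomial_Factorial"
begin

text \<open>Homogeneous polynomials in K[X,Y,Z] are represented as nested univariate
polynomials: the outer variable is X, then Y, the innermost is Z.\<close>

type_synonym 'k poly3 = "'k poly poly poly"

definition coeff3 :: "'k::zero poly3 \<Rightarrow> nat \<Rightarrow> nat \<Rightarrow> nat \<Rightarrow> 'k" where
  "coeff3 F i j k = coeff (coeff (coeff F i) j) k"

definition eval3 :: "'k::comm_semiring_0 poly3 \<Rightarrow> 'k \<Rightarrow> 'k \<Rightarrow> 'k \<Rightarrow> 'k" where
  "eval3 F x y z = poly (poly (poly F [:[:x:]:]) [:y:]) z"

definition const3 :: "'k::zero \<Rightarrow> 'k poly3" where
  "const3 c = [:[:[:c:]:]:]"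

text \<open>A plane curve of degree d is given by a nonzero homogeneous polynomial of degree d \<ge> 1
(up to a nonzero scalar factor).\<close>
definition plane_curve_deg :: "'k::zero poly3 \<Rightarrow> nat \<Rightarrow> bool" where
  "plane_curve_deg F d \<longleftrightarrow> d \<ge> 1 \<and> F \<noteq> 0 \<and>
     (\<forall>i j k. coeff3 F i j k \<noteq> 0 \<longrightarrow> i + j + k = d)"

definition Fq :: "nat \<Rightarrow> 'k::field set" where
  "Fq q = {x. x ^ q = x}"

definition PGL3 :: "nat \<Rightarrow> ('k::field ^ 3 ^ 3) set" where
  "PGL3 q = {A. (\<forall>i j. A $ i $ j \<in> Fq q) \<and> det A \<noteq> 0}"

definition invariant_curve :: "('k::field ^ 3 ^ 3) set \<Rightarrow> 'k poly3 \<Rightarrow> bool" where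
  "invariant_curve G F \<longleftrightarrow> (\<forall>A\<in>G. \<exists>c. c \<noteq> 0 \<and>
     (\<forall>v::'k ^ 3. eval3 F ((A *v v) $ 1) ((A *v v) $ 2) ((A *v v) $ 3)
                  = c * eval3 F (v $ 1) (v $ 2) (v $ 3)))"

definition inv_irr_curve :: "('k::field ^ 3 ^ 3) set \<Rightarrow> 'k poly3 \<Rightarrow> nat \<Rightarrow> bool" where
  "inv_irr_curve G F d \<longleftrightarrow> plane_curve_deg F d \<and> irreducible F \<and> invariant_curve G F"

definition dG :: "('k::field ^ 3 ^ 3) set \<Rightarrow> nat" where
  "dG G = (LEAST d. d \<ge> 2 \<and> (\<exists>F. inv_irr_curve G F d))"

definition d'G :: "('k::field ^ 3 ^ 3) set \<Rightarrow> nat" where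
  "d'G G = (LEAST d. d > dG G \<and> (\<exists>F. inv_irr_curve G F d))"

definition epsG :: "('k::field ^ 3 ^ 3) set \<Rightarrow> nat" where
  "epsG G = d'G G - dG G"

definition Xa :: "'k::comm_ring_1 poly poly" where "Xa = monom 1 1"
definition Ya :: "'k::comm_ring_1 poly poly" where "Ya = [:monom 1 1:]"

definition dgz_aff :: "nat \<Rightarrow> 'k::field poly poly" where
  "dgz_aff q =
     ((Xa ^ (q^3) - Xa) * (Ya ^ q - Ya) - (Ya ^ (q^3) - Ya) * (Xa ^ q - Xa)) div
     ((Xa ^ (q^2) - Xa) * (Ya ^ q - Ya) - (Ya ^ (q^2) - Ya) * (Xa ^ q - Xa))"

definition tdeg :: "'k::zero poly poly \<Rightarrow> nat" where
  "tdeg f = Max {i + j | i j. coeff (coeff f i) j \<noteq> 0}"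

definition homogenize :: "'k::comm_ring_1 poly poly \<Rightarrow> 'k poly3" where
  "homogenize f = (\<Sum>i\<le>degree f. \<Sum>j\<le>degree (coeff f i).
      monom (monom (monom (coeff (coeff f i) j) (tdeg f - i - j)) j) i)"

definition dgz_curve :: "nat \<Rightarrow> 'k::field poly3" where
  "dgz_curve q = homogenize (dgz_aff q)"

end

(*
  Let F be a form of degree d >= 1, not divisible by X or Z, that is mapped to a multiple of itself by
  the perspectivities with a rational axis. The torus makes every exponent of Z a multiple of q - 1,
  and together with the invariance under X -> X + Z this makes F(X, Y, 0) a q-th power h ^ q. The
  zeros of h on the projective line form orbits of PGL(2,q): the q + 1 rational points (with
  multiplicity a multiple of q - 1), the q^2 - q points over F_{q^2}, or larger orbits. Hence
  d >= q^3 - q, or d = q^3 - q^2 and F(X, Y, 0) is determined up to a scalar. Two invariant forms of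
  degree q^3 - q^2 therefore have a combination that vanishes on every rational line, with
  multiplicity at least q - 1, and this exceeds the degree unless the combination is zero.

  The two degrees are attained by the Dickson invariants det(v, v^q, v^(q^3)) / det(v, v^q, v^(q^2))
  (the DGZ curve) and det(v, v^(q^2), v^(q^3)) / det(v, v^q, v^(q^2)). The first one meets a rational
  line only at points over F_{q^2}, where it is unibranch, so two different components cannot meet on
  a rational line. A perspectivity with rational axis fixes the points of that axis, hence fixes each
  component; by the degree bound there is only one. The map v -> v x v^q pulls the second invariant
  back to the first one times a power of det(v, v^q, v^(q^2)), and this transports irreducibility.
*)
theory Submission
  imports Defs "Berlekamp_Zassenhaus.Unique_Factorization_Poly"
begin

section \<open>Forms in three variables and substitutions\<close>

no_notation Matrix.vec_index (infixl "$" 100)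
hide_const (open) Coset.order Determinant.det Matrix.mat

text \<open>The dichotomy rests on two counts. Rational zeros cost at least (q + 1)(q - 1) = q^2 -
  1, and two disjoint affine orbits of points outside \<open>F1\<close> cost 2 (q^2 - q) >= q^2 - 1.
  Below that bound there is a single affine orbit, and stability under x -> 1/x turns its points
  into roots of a quadratic over \<open>F1\<close>. This replaces the orbit classification of
  PGL(2,q).

  The obstacle in the irreducibility proof is that the group could permute the components, so the
  degree bound cannot presuppose invariance under the whole group; it is proved for perspectivities
  alone. Disjointness of the components on rational lines is read off from lowest-order terms.

  Uniqueness is tight: the q^2 rational lines that avoid (0 : 0 : 1) use up exactly the degree q^2
  (q - 1), and one further zero at (0 : 0 : 1) decides.

  The Dickson invariants are given by formulas free of division, so that every substitution passes
  through them; the quotients of Moore determinants are recovered in any domain of characteristic p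
  where they make sense.\<close>

lemma ev_hom:
  assumes "comm_ring_hom (\<iota> :: 'a::comm_ring_1 \<Rightarrow> 'b::comm_ring_1)"
  shows "comm_ring_hom (\<lambda>p. poly (map_poly \<iota> p) c)"
proof -
  interpret map_poly_comm_ring_hom \<iota> by (rule map_poly_comm_ring_hom.intro[OF assms])
  show ?thesis by unfold_locales (simp_all add: hom_distribs)
qed

text \<open>The coefficient map and the target ring are left free, so that composition of forms,
  restriction to a parametrised curve, grading, local expansion at a point and the passage to Z = 1
  are all instances and share one homomorphism law.\<close>

definition sub3 :: "('k::comm_ring_1 \<Rightarrow> 'r::comm_ring_1) \<Rightarrow> 'r \<Rightarrow> 'r \<Rightarrow> 'r \<Rightarrow> 'k poly3 \<Rightarrow> 'r" where
  "sub3 \<iota> a b c F =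
     poly (map_poly (\<lambda>g. poly (map_poly (\<lambda>h. poly (map_poly \<iota> h) c) g) b) F) a"

lemma map_poly_const_poly: "f 0 = 0 \<Longrightarrow> map_poly f [:c:] = [:f c:]"
  by (intro poly_eqI) (auto simp: coeff_map_poly coeff_pCons split: nat.split)

definition varX :: "'k::comm_ring_1 poly3" where "varX = [:0, 1:]"
definition varY :: "'k::comm_ring_1 poly3" where "varY = [:[:0, 1:]:]"
definition varZ :: "'k::comm_ring_1 poly3" where "varZ = [:[:[:0, 1:]:]:]"
definition mono3 :: "'k::zero \<Rightarrow> nat \<Rightarrow> nat \<Rightarrow> nat \<Rightarrow> 'k poly3" where
  "mono3 c i j k = monom (monom (monom c k) j) i"

lemma comm_ring_hom_sub3:
  assumes "comm_ring_hom \<iota>"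
  shows "comm_ring_hom (sub3 \<iota> a b c)"
  unfolding sub3_def[abs_def] by (intro ev_hom assms)

lemma sub3_const3 [simp]:
  assumes "comm_ring_hom \<iota>"
  shows "sub3 \<iota> a b c (const3 k) = \<iota> k"
proof -
  interpret comm_ring_hom \<iota> by fact
  show ?thesis by (simp add: sub3_def const3_def map_poly_const_poly)
qed

lemma sub3_var:
  assumes "comm_ring_hom \<iota>"
  shows "sub3 \<iota> a b c varX = a" "sub3 \<iota> a b c varY = b" "sub3 \<iota> a b c varZ = c"
proof -
  interpret comm_ring_hom \<iota> by fact
  show "sub3 \<iota> a b c varX = a" "sub3 \<iota> a b c varY = b" "sub3 \<iota> a b c varZ = c"
    by (simp_all add: sub3_def varX_def varY_def varZ_def map_poly_pCons)
qed

lemma mono3_altdef: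
  fixes c :: "'k::comm_ring_1"
  shows "mono3 c i j k = const3 c * varX ^ i * varY ^ j * varZ ^ k"
proof -
  have Z: "varZ ^ k = ([:[:monom 1 k:]:] :: 'k poly3)"
    by (induction k) (simp_all add: varZ_def monom_Suc)
  have Y: "varY ^ j = ([:monom 1 j:] :: 'k poly3)"
    by (induction j) (simp_all add: varY_def monom_Suc)
  have X: "varX ^ i = (monom 1 i :: 'k poly3)"
    by (induction i) (simp_all add: varX_def monom_Suc)
  show ?thesis unfolding X Y Z const3_def mono3_def monom_0 [symmetric]
    by (simp add: mult_monom)
qed

lemma coeff3_add [simp]: "coeff3 (F + G) i j k = coeff3 F i j k + coeff3 (G :: 'k::comm_ring_1 poly3) i j k"
  by (simp add: coeff3_def)

lemma coeff3_diff [simp]: "coeff3 (F - G) i j k = coeff3 F i j k - coeff3 (G :: 'k::comm_ring_1 poly3) i j k"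
  by (simp add: coeff3_def)

lemma coeff3_0 [simp]: "coeff3 0 i j k = 0"
  by (simp add: coeff3_def)

lemma coeff3_const3_mult [simp]: "coeff3 (const3 c * F) i j k = c * coeff3 (F :: 'k::comm_ring_1 poly3) i j k"
  by (simp add: coeff3_def const3_def)

lemma coeff3_mono3: "coeff3 (mono3 c i j k) i' j' k' = (if i = i' \<and> j = j' \<and> k = k' then c else 0)"
  by (simp add: coeff3_def mono3_def)

lemma poly3_eqI: "(\<And>i j k. coeff3 F i j k = coeff3 G i j k) \<Longrightarrow> F = G"
  by (simp add: coeff3_def poly_eq_iff)

lemma poly_monom_induct:
  fixes p :: "'a::comm_ring_1 poly"
  assumes "P 0" "\<And>c i. P (monom c i)" "\<And>p q. P p \<Longrightarrow> P q \<Longrightarrow> P (p + q)"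
  shows "P p"
proof -
  have "P (\<Sum>i\<in>A. monom (coeff p i) i)" if "finite A" for A
    using that by (induction A) (auto intro: assms)
  from this[of "{..degree p}"] show ?thesis by (simp add: poly_as_sum_of_monoms)
qed

lemma poly3_mono_induct [case_names zero mono add]:
  fixes F :: "'k::comm_ring_1 poly3"
  assumes "P 0" "\<And>c i j k. P (mono3 c i j k)" "\<And>F G. P F \<Longrightarrow> P G \<Longrightarrow> P (F + G)"
  shows "P F"
proof (rule poly_monom_induct)
  fix g :: "'k poly poly" and i
  show "P (monom g i)"
  proof (induction g rule: poly_monom_induct)
    case (2 h j)
    show ?case
    proof (induction h rule: poly_monom_induct)
      case (2 c k)
      show ?case using assms(2)[of c i j k] by (simp add: mono3_def)
    qed (use assms in \<open>auto simp: add_monom [symmetric]\<close>)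
  qed (use assms in \<open>auto simp: add_monom [symmetric]\<close>)
qed (use assms in auto)

lemma poly3_induct [case_names const X Y Z add mult]:
  fixes F :: "'k::comm_ring_1 poly3"
  assumes "\<And>c. P (const3 c)" "P varX" "P varY" "P varZ"
    "\<And>F G. P F \<Longrightarrow> P G \<Longrightarrow> P (F + G)" "\<And>F G. P F \<Longrightarrow> P G \<Longrightarrow> P (F * G)"
  shows "P F"
proof -
  have 1: "P 1" using assms(1)[of 1] by (simp add: const3_def pCons_one)
  have pow: "P (G ^ n)" if "P G" for G n
    by (induction n) (use that 1 assms(6) in auto)
  show ?thesis
  proof (induction F rule: poly3_mono_induct)
    case zero show ?case using assms(1)[of 0] by (simp add: const3_def)
  next
    case (mono c i j k)
    show ?case unfolding mono3_altdef by (intro assms pow)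
  qed (use assms in auto)
qed

lemma comm_ring_hom_eval3: "comm_ring_hom (\<lambda>F :: 'k::comm_ring_1 poly3. eval3 F x y z)"
  by unfold_locales (auto simp: eval3_def)

lemma eval3_simps [simp]:
  fixes F G :: "'k::comm_ring_1 poly3"
  shows "eval3 (F + G) x y z = eval3 F x y z + eval3 G x y z"
    "eval3 (F - G) x y z = eval3 F x y z - eval3 G x y z"
    "eval3 (- F) x y z = - eval3 F x y z"
    "eval3 (F * G) x y z = eval3 F x y z * eval3 G x y z"
    "eval3 (F ^ n) x y z = eval3 F x y z ^ n"
    "eval3 0 x y z = (0::'k)" "eval3 1 x y z = (1::'k)"
    "eval3 (const3 c) x y z = c"
    "eval3 varX x y z = x" "eval3 varY x y z = y" "eval3 varZ x y z = z"
    "eval3 (sum H A) x y z = (\<Sum>i\<in>A. eval3 (H i) x y z)"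
  by (simp_all add: eval3_def poly_power const3_def varX_def varY_def varZ_def poly_sum)

text \<open>Both sides are ring homomorphisms in \<open>F\<close> that agree on constants and on the
  three variables. This reduces every substitution to a pointwise evaluation.\<close>

lemma hom_eq_eval3:
  fixes F :: "'k::comm_ring_1 poly3"
  assumes "comm_ring_hom \<iota>" "comm_ring_hom (\<phi> :: 'r::comm_ring_1 \<Rightarrow> 'k)" "\<And>k. \<phi> (\<iota> k) = k"
  shows "\<phi> (sub3 \<iota> a b c F) = eval3 F (\<phi> a) (\<phi> b) (\<phi> c)"
proof -
  interpret \<phi>: comm_ring_hom \<phi> by fact
  interpret s: comm_ring_hom "sub3 \<iota> a b c" by (rule comm_ring_hom_sub3) fact
  show ?thesis
    by (induction F rule: poly3_induct)
      (simp_all add: assms sub3_var \<phi>.hom_add \<phi>.hom_mult s.hom_add s.hom_mult)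
qed

lemma comm_ring_hom_const3: "comm_ring_hom (const3 :: 'k::comm_ring_1 \<Rightarrow> _)"
  by unfold_locales (auto simp: const3_def pCons_one)

lemma comm_ring_hom_const1: "comm_ring_hom (\<lambda>k::'k::comm_ring_1. [:k:])"
  by unfold_locales (auto simp: pCons_one)

abbreviation comp3 :: "'k::comm_ring_1 poly3 \<Rightarrow> 'k poly3 \<Rightarrow> 'k poly3 \<Rightarrow> 'k poly3 \<Rightarrow> 'k poly3" where
  "comp3 F A B C \<equiv> sub3 const3 A B C F"

abbreviation curve3 :: "'k::comm_ring_1 poly3 \<Rightarrow> 'k poly \<Rightarrow> 'k poly \<Rightarrow> 'k poly \<Rightarrow> 'k poly" where
  "curve3 F a b c \<equiv> sub3 (\<lambda>k. [:k:]) a b c F"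

lemma eval3_comp3 [simp]:
  "eval3 (comp3 F A B C) x y z = eval3 F (eval3 A x y z) (eval3 B x y z) (eval3 C x y z)"
  by (rule hom_eq_eval3[OF comm_ring_hom_const3 comm_ring_hom_eval3]) simp

lemma poly_curve3 [simp]:
  fixes F :: "'k::comm_ring_1 poly3"
  shows "poly (curve3 F a b c) t = eval3 F (poly a t) (poly b t) (poly c t)"
proof (rule hom_eq_eval3[OF comm_ring_hom_const1])
  show "comm_ring_hom (\<lambda>p. poly p t)" by unfold_locales auto
qed simp

lemma poly_eq_0_if_infinite_zeros:
  fixes p :: "'a::idom poly" and f :: "'k \<Rightarrow> 'a"
  assumes "infinite (UNIV :: 'k set)" "inj f" "\<And>x. poly p (f x) = 0"
  shows "p = 0"
proof (rule ccontr)
  assume "p \<noteq> 0"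
  hence "finite {x. poly p x = 0}" by (rule poly_roots_finite)
  moreover have "range f \<subseteq> {x. poly p x = 0}" using assms(3) by auto
  ultimately show False using assms(1,2) by (meson finite_imageD finite_subset)
qed

text \<open>One variable is specialised at a time, each time because a nonzero polynomial over a
  domain has only finitely many roots. From here on identities between forms are checked at
  points.\<close>

lemma poly3_eq_0I:
  fixes F :: "'k::field poly3"
  assumes inf: "infinite (UNIV :: 'k set)" and ev: "\<And>x y z. eval3 F x y z = 0"
  shows "F = 0"
proof -
  show ?thesis
  proof (rule poly_eq_0_if_infinite_zeros[where f = "\<lambda>x. [:[:x:]:]", OF inf])
    fix x
    show "poly F [:[:x:]:] = 0"
    proof (rule poly_eq_0_if_infinite_zeros[where f = "\<lambda>x. [:x:]", OF inf])
      fix y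
      show "poly (poly F [:[:x:]:]) [:y:] = 0"
        by (rule poly_eq_0_if_infinite_zeros[where f = "\<lambda>x. x", OF inf]) (use ev in \<open>auto simp: eval3_def\<close>)
    qed (auto simp: inj_def)
  qed (auto simp: inj_def)
qed
lemma poly3_eqI_eval:
  fixes F :: "'k::field poly3"
  assumes inf: "infinite (UNIV :: 'k set)" and ev: "\<And>x y z. eval3 F x y z = eval3 G x y z"
  shows "F = G"
  using poly3_eq_0I[OF inf, of "F - G"] ev by simp

section \<open>Homogeneity through a grading variable\<close>

definition hom3 :: "'k::zero poly3 \<Rightarrow> nat \<Rightarrow> bool" where
  "hom3 F d \<longleftrightarrow> (\<forall>i j k. coeff3 F i j k \<noteq> 0 \<longrightarrow> i + j + k = d)"

text \<open>This is F(TX, TY, TZ) as a polynomial in a new variable T; its coefficients are the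
  homogeneous components of F. Being a ring homomorphism, it turns questions about homogeneous
  products and factors into questions about monomials in T.\<close>

definition grade3 :: "'k::comm_ring_1 poly3 \<Rightarrow> 'k poly3 poly" where
  "grade3 = sub3 (\<lambda>k. [:const3 k:]) (monom varX 1) (monom varY 1) (monom varZ 1)"

lemma comm_ring_hom_const3': "comm_ring_hom (\<lambda>k::'k::comm_ring_1. [:const3 k:])"
  by unfold_locales (auto simp: pCons_one const3_def)

lemma comm_ring_hom_grade3: "comm_ring_hom grade3"
  unfolding grade3_def by (rule comm_ring_hom_sub3[OF comm_ring_hom_const3'])

lemma grade3_mono3: "grade3 (mono3 c i j k) = monom (mono3 c i j k) (i + j + k)"
proof -
  interpret comm_ring_hom grade3 by (rule comm_ring_hom_grade3)
  have "grade3 (mono3 c i j k) = [:const3 c:] * monom varX 1 ^ i * monom varY 1 ^ j * monom varZ 1 ^ k"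
    unfolding mono3_altdef hom_mult hom_power
    by (simp add: grade3_def sub3_var[OF comm_ring_hom_const3'] comm_ring_hom_const3')
  also have "\<dots> = monom (mono3 c i j k) (i + j + k)"
    by (simp add: monom_power mono3_altdef mult_monom smult_monom algebra_simps)
  finally show ?thesis .
qed

lemma coeff3_grade3: "coeff3 (coeff (grade3 F) n) i j k = (if i + j + k = n then coeff3 F i j k else 0)"
proof -
  interpret comm_ring_hom grade3 by (rule comm_ring_hom_grade3)
  show ?thesis
    by (induction F rule: poly3_mono_induct)
       (auto simp: hom_add grade3_mono3 coeff3_mono3)
qed

lemma hom3_iff_grade3: "hom3 F d \<longleftrightarrow> grade3 F = monom F d"
proof
  assume "hom3 F d"
  thus "grade3 F = monom F d"
    by (intro poly_eqI poly3_eqI) (auto simp: coeff3_grade3 hom3_def)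
next
  assume "grade3 F = monom F d"
  hence "coeff3 (coeff (monom F d) n) i j k = (if i + j + k = n then coeff3 F i j k else 0)" for n i j k
    by (metis coeff3_grade3)
  thus "hom3 F d" unfolding hom3_def by (metis coeff3_0 coeff_monom)
qed

lemma poly_grade3_1: "poly (grade3 F) 1 = F"
proof -
  interpret comm_ring_hom grade3 by (rule comm_ring_hom_grade3)
  show ?thesis
    by (induction F rule: poly3_mono_induct) (auto simp: hom_add grade3_mono3 poly_monom)
qed

lemma mult_eq_monomD:
  fixes p q :: "'a::idom poly"
  assumes "p * q = monom c n" "c \<noteq> 0"
  shows "\<exists>a i. p = monom a i"
  using assms
proof (induction n arbitrary: p q)
  case 0
  hence "p \<noteq> 0" "q \<noteq> 0" by auto
  hence "degree p = 0" using degree_mult_eq[of p q] 0 by (simp add: degree_monom_eq)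
  then obtain a where "p = [:a:]" by (rule degree_eq_zeroE)
  thus ?case by (metis monom_0)
next
  case (Suc n)
  have "poly (p * q) 0 = 0" unfolding Suc(2) by (simp add: poly_monom)
  hence "poly p 0 = 0 \<or> poly q 0 = 0" by simp
  thus ?case
  proof
    assume "poly p 0 = 0"
    then obtain p' where p: "p = [:0, 1:] * p'" by (metis dvdE poly_eq_0_iff_dvd minus_zero)
    have "[:0,1:] * (p' * q) = [:0, 1:] * monom c n" using Suc(2) p by (simp add: monom_Suc)
    hence "p' * q = monom c n" by simp
    from Suc.IH[OF this Suc(3)] obtain a i where "p' = monom a i" by auto
    thus ?thesis unfolding p by (intro exI[of _ a] exI[of _ "Suc i"]) (simp add: monom_Suc)
  next
    assume "poly q 0 = 0"
    then obtain q' where q: "q = [:0, 1:] * q'" by (metis dvdE poly_eq_0_iff_dvd minus_zero)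
    have "[:0,1:] * (p * q') = [:0, 1:] * monom c n" using Suc(2) q by (simp add: monom_Suc)
    hence "p * q' = monom c n" by simp
    from Suc.IH[OF this Suc(3)] show ?thesis .
  qed
qed

lemma hom3_mult: "hom3 F a \<Longrightarrow> hom3 G b \<Longrightarrow> hom3 (F * G) (a + b :: nat)"
  for F G :: "'k::comm_ring_1 poly3"
proof -
  interpret comm_ring_hom "grade3 :: 'k poly3 \<Rightarrow> _" by (rule comm_ring_hom_grade3)
  assume "hom3 F a" "hom3 G b"
  thus ?thesis unfolding hom3_iff_grade3 by (simp add: hom_mult mult_monom)
qed

lemma hom3_unique: "hom3 F a \<Longrightarrow> hom3 F b \<Longrightarrow> F \<noteq> 0 \<Longrightarrow> a = b"
  unfolding hom3_def by (metis poly3_eqI coeff3_0)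

text \<open>A divisor of a monomial in T is again a monomial; this is applied to the grading of
  \<open>F\<close>. Since the zero form is homogeneous of every degree, the degrees add up only
  because \<open>F\<close> is nonzero.\<close>

lemma hom3_factor:
  fixes F G H :: "'k::field poly3"
  assumes "hom3 F d" "F \<noteq> 0" "F = G * H"
  obtains a b where "hom3 G a" "hom3 H b" "a + b = d"
proof -
  interpret comm_ring_hom "grade3 :: 'k poly3 \<Rightarrow> _" by (rule comm_ring_hom_grade3)
  have hom: "\<exists>a. hom3 G a" if "F = G * H" for G H
  proof -
    have "grade3 G * grade3 H = monom F d"
      using assms that by (simp add: hom3_iff_grade3 hom_mult [symmetric])
    then obtain g a where g: "grade3 G = monom g a" using mult_eq_monomD \<open>F \<noteq> 0\<close>
      by blast
    hence "g = G" using poly_grade3_1[of G] by (simp add: poly_monom)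
    with g show ?thesis by (auto simp: hom3_iff_grade3)
  qed
  obtain a where a: "hom3 G a" using hom assms by blast
  obtain b where b: "hom3 H b" using hom[of H G] assms by (auto simp: mult.commute)
  have "a + b = d" using hom3_mult[OF a b] assms hom3_unique by metis
  with a b that show thesis by blast
qed

lemma eval3_scale:
  fixes F :: "'k::comm_ring_1 poly3"
  assumes "hom3 F d"
  shows "eval3 F (t * x) (t * y) (t * z) = t ^ d * eval3 F x y z"
proof -
  let ?\<phi> = "\<lambda>P. poly (map_poly (\<lambda>G. eval3 G x y z) P) t"
  have "comm_ring_hom ?\<phi>" by (intro ev_hom comm_ring_hom_eval3)
  hence "?\<phi> (grade3 F) = eval3 F (?\<phi> (monom varX 1)) (?\<phi> (monom varY 1)) (?\<phi> (monom varZ 1))"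
    unfolding grade3_def
    by (rule hom_eq_eval3[OF comm_ring_hom_const3']) (simp add: map_poly_const_poly)
  moreover have "?\<phi> (grade3 F) = t ^ d * eval3 F x y z"
    using assms by (simp add: hom3_iff_grade3 map_poly_monom poly_monom)
  ultimately show ?thesis by (simp add: map_poly_monom poly_monom mult.commute)
qed

section \<open>Moore determinants and Dickson invariants\<close>

definition det3 :: "'a::comm_ring_1 \<Rightarrow> 'a \<Rightarrow> 'a \<Rightarrow> 'a \<Rightarrow> 'a \<Rightarrow> 'a \<Rightarrow> 'a \<Rightarrow> 'a \<Rightarrow> 'a \<Rightarrow> 'a" where
  "det3 a b c d e f g h i = a * (e * i - f * h) - b * (d * i - f * g) + c * (d * h - e * g)"

text \<open>The monic polynomial in T with the roots $a x + b y$, $a, b \<in> F_q$, is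
  $f(T) = T^{q^2} - dA \cdot T^q + dL2^{q-1} T$. With $dN = f(z)$, the one with the roots
  $a x + b y + c z$ is $f^q - dN^{q-1} f$; up to sign its coefficients of $T^{q^2}$ and $T^q$
  are the two Dickson invariants below.\<close>

definition dL2 :: "nat \<Rightarrow> 'a::comm_ring_1 \<Rightarrow> 'a \<Rightarrow> 'a" where
  "dL2 q x y = x * y ^ q - x ^ q * y"

definition dA :: "nat \<Rightarrow> 'a::comm_ring_1 \<Rightarrow> 'a \<Rightarrow> 'a" where
  "dA q x y = (\<Sum>i<Suc q. (x ^ (q - 1)) ^ i * (y ^ (q - 1)) ^ (q - i))"

definition dN :: "nat \<Rightarrow> 'a::comm_ring_1 \<Rightarrow> 'a \<Rightarrow> 'a \<Rightarrow> 'a" where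
  "dN q x y z = (z ^ q) ^ q - dA q x y * z ^ q + dL2 q x y ^ (q - 1) * z"

definition dick1 :: "nat \<Rightarrow> 'a::comm_ring_1 \<Rightarrow> 'a \<Rightarrow> 'a \<Rightarrow> 'a" where
  "dick1 q x y z = dA q x y ^ q + dN q x y z ^ (q - 1)"

definition dick2 :: "nat \<Rightarrow> 'a::comm_ring_1 \<Rightarrow> 'a \<Rightarrow> 'a \<Rightarrow> 'a" where
  "dick2 q x y z = (dL2 q x y ^ (q - 1)) ^ q + dA q x y * dN q x y z ^ (q - 1)"

text \<open>The determinants with rows v, v^q, v^(q^2), v^(q^3), where the digits select the rows.
  The powers are nested rather than written with exponent q^2 or q^3, so that additivity of the
  Frobenius map rewrites them one level at a time.\<close>

definition moore012 :: "nat \<Rightarrow> 'a::comm_ring_1 \<Rightarrow> 'a \<Rightarrow> 'a \<Rightarrow> 'a" where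
  "moore012 q x y z = det3 x y z (x ^ q) (y ^ q) (z ^ q) ((x ^ q) ^ q) ((y ^ q) ^ q) ((z ^ q) ^ q)"

definition moore013 :: "nat \<Rightarrow> 'a::comm_ring_1 \<Rightarrow> 'a \<Rightarrow> 'a \<Rightarrow> 'a" where
  "moore013 q x y z = det3 x y z (x ^ q) (y ^ q) (z ^ q)
     (((x ^ q) ^ q) ^ q) (((y ^ q) ^ q) ^ q) (((z ^ q) ^ q) ^ q)"

definition moore023 :: "nat \<Rightarrow> 'a::comm_ring_1 \<Rightarrow> 'a \<Rightarrow> 'a \<Rightarrow> 'a" where
  "moore023 q x y z = det3 x y z ((x ^ q) ^ q) ((y ^ q) ^ q) ((z ^ q) ^ q)
     (((x ^ q) ^ q) ^ q) (((y ^ q) ^ q) ^ q) (((z ^ q) ^ q) ^ q)"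

context comm_ring_hom
begin

lemma hom_dL2: "hom (dL2 q x y) = dL2 q (hom x) (hom y)"
  by (simp add: dL2_def hom_distribs)

lemma hom_dA: "hom (dA q x y) = dA q (hom x) (hom y)"
  by (simp only: dA_def hom_sum hom_mult hom_power)

lemma hom_dN: "hom (dN q x y z) = dN q (hom x) (hom y) (hom z)"
  by (simp add: dN_def hom_distribs hom_dA hom_dL2)

lemma hom_dick1: "hom (dick1 q x y z) = dick1 q (hom x) (hom y) (hom z)"
  by (simp add: dick1_def hom_distribs hom_dA hom_dN)

lemma hom_dick2: "hom (dick2 q x y z) = dick2 q (hom x) (hom y) (hom z)"
  by (simp add: dick2_def hom_distribs hom_dA hom_dN hom_dL2)

end

lemma frob_add:
  fixes x y :: "'a::comm_ring_1"
  assumes "prime p" "CHAR('a) = p" "q = p ^ n"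
  shows "(x + y) ^ q = x ^ q + y ^ q"
  using freshmans_dream'[of "q" n x y] assms by simp

lemma frob_diff:
  fixes x y :: "'a::comm_ring_1"
  assumes "prime p" "CHAR('a) = p" "q = p ^ n"
  shows "(x - y) ^ q = x ^ q - y ^ q"
  using frob_add[OF assms, of "x - y" y] by simp

text \<open>With a = x^(q-1) and b = y^(q-1), \<open>dA\<close> is the geometric sum for (a^(q+1) -
  b^(q+1)) / (a - b), and \<open>dL2\<close> is -xy(a - b). So \<open>dA\<close> is the quotient of
  the 2-by-2 minors with rows 0, 2 and rows 0, 1.\<close>

lemma dA_dL2:
  fixes x y :: "'a::comm_ring_1"
  assumes "q \<ge> 1"
  shows "dA q x y * dL2 q x y = x * (y ^ q) ^ q - (x ^ q) ^ q * y"
proof -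
  obtain r where q: "q = Suc r" using assms by (cases q) auto
  have w: "w * (w ^ r) ^ Suc q = (w ^ q) ^ q" for w :: 'a
    by (simp only: power_mult [symmetric] power_Suc [symmetric] q) (simp add: algebra_simps)
  have "((x ^ r) ^ Suc q - (y ^ r) ^ Suc q) = (x ^ r - y ^ r) * dA q x y"
    unfolding dA_def by (subst diff_power_eq_sum) (simp add: q)
  moreover have "dL2 q x y = - (x * y * (x ^ r - y ^ r))"
    by (simp add: dL2_def q algebra_simps)
  ultimately have "dA q x y * dL2 q x y = - (x * y * ((x ^ r) ^ Suc q - (y ^ r) ^ Suc q))"
    by (simp add: mult_ac)
  also have "\<dots> = x * (y * (y ^ r) ^ Suc q) - (x * (x ^ r) ^ Suc q) * y"
    by (simp add: algebra_simps)
  finally show ?thesis unfolding w .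
qed

text \<open>Interpreted for the field and for its polynomial rings in one, two and three variables,
  so that one proof of the Moore identities serves points, local parameters and the variables
  themselves.\<close>

locale frob_idom =
  fixes p n q :: nat and R :: "'a::idom itself"
  assumes prime: "prime p" and n: "n \<ge> 1" and q: "q = p ^ n" and char: "CHAR('a) = p"
begin

lemma q_ge2: "q \<ge> 2"
proof -
  have "p \<ge> 2" using prime by (simp add: prime_ge_2_nat)
  also have "p \<le> p ^ n" using n self_le_power[of p n] \<open>p \<ge> 2\<close> by simp
  finally show ?thesis by (simp add: q)
qed

lemma q_ge1: "q \<ge> 1"
  using q_ge2 by simp

lemma add_q [simp]: "(x + y) ^ q = x ^ q + (y :: 'a) ^ q"
  by (rule frob_add[OF prime char q])

lemma diff_q [simp]: "(x - y) ^ q = x ^ q - (y :: 'a) ^ q"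
  by (rule frob_diff[OF prime char q])

lemma uminus_q [simp]: "(- x) ^ q = - (x ^ q :: 'a)"
  using diff_q[of 0 x] q_ge2 by (simp add: power_0_left)

lemma q_eq_iff [simp]: "x ^ q = y ^ q \<longleftrightarrow> x = (y :: 'a)"
proof
  assume "x ^ q = y ^ q"
  hence "(x - y) ^ q = 0" unfolding diff_q by simp
  hence "x - y = 0" using power_eq_0_iff by blast
  thus "x = y" by simp
qed simp

lemma power_q_m1: "x ^ (q - 1) * x = (x :: 'a) ^ q" 
  using q_ge2 by (metis mult.commute power_minus_mult zero_less_numeral order_less_le_trans)

lemma moore012_eq: "moore012 q x y z = dL2 q x y * dN q x y (z :: 'a)"
proof -
  let ?L = "dL2 q x y" and ?A = "dA q x y"
  have A: "?A * ?L = x * (y ^ q) ^ q - (x ^ q) ^ q * y" by (rule dA_dL2[OF q_ge1])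
  have B: "?L ^ (q - 1) * ?L = ?L ^ q" by (rule power_q_m1)
  have L: "?L ^ q = x ^ q * (y ^ q) ^ q - (x ^ q) ^ q * y ^ q"
    by (simp add: dL2_def power_mult_distrib)
  have "?L * dN q x y z = ?L * (z ^ q) ^ q - (?A * ?L) * z ^ q + (?L ^ (q - 1) * ?L) * z"
    by (simp add: dN_def algebra_simps)
  thus ?thesis unfolding A B L moore012_def det3_def by (simp add: dL2_def algebra_simps)
qed

text \<open>The Pluecker relation $(02)(13) - (01)(23) = (03)(12)$ for the 2-by-2 minors of the
  matrix with rows $x^{q^i}$, $y^{q^i}$, $0 \<le> i \<le> 3$.\<close>

lemma dA_power_dL2:
  assumes "dL2 q x y \<noteq> (0 :: 'a)"
  shows "dA q x y ^ q * (dA q x y * dL2 q x y) - (dL2 q x y ^ (q - 1)) ^ q * dL2 q x y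
     = x * ((y ^ q) ^ q) ^ q - ((x ^ q) ^ q) ^ q * y"
proof -
  let ?L = "dL2 q x y" and ?A = "dA q x y"
  have A: "?A * ?L = x * (y ^ q) ^ q - (x ^ q) ^ q * y" by (rule dA_dL2[OF q_ge1])
  have A': "?A ^ q * ?L ^ q = (x * (y ^ q) ^ q - (x ^ q) ^ q * y) ^ q"
    by (simp add: A [symmetric] power_mult_distrib)
  have B: "(?L ^ (q - 1)) ^ q * ?L ^ q = (?L ^ q) ^ q"
    using power_q_m1[of ?L] by (simp add: power_mult_distrib [symmetric])
  have L: "?L ^ q = x ^ q * (y ^ q) ^ q - (x ^ q) ^ q * y ^ q"
    by (simp add: dL2_def power_mult_distrib)
  have "?L ^ q * (?A ^ q * (?A * ?L) - (?L ^ (q - 1)) ^ q * ?L)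
     = (?A ^ q * ?L ^ q) * (?A * ?L) - ((?L ^ (q - 1)) ^ q * ?L ^ q) * ?L"
    by (simp add: algebra_simps)
  also have "\<dots> = ?L ^ q * (x * ((y ^ q) ^ q) ^ q - ((x ^ q) ^ q) ^ q * y)"
    unfolding A' unfolding A B unfolding L
    by (simp add: power_mult_distrib dL2_def algebra_simps)
  finally show ?thesis using assms by simp
qed

text \<open>Because dN^(q-1) dN = dN^q, the right side is a combination of z, z^q, z^(q^2) and
  z^(q^3). The coefficient of z^(q^2) cancels, and the others are the minors in the expansion of the
  determinant along its z-column. In \<open>moore023_eq\<close> it is the coefficient of z^q that
  cancels.\<close>

lemma moore013_eq:
  assumes "dL2 q x y \<noteq> (0 :: 'a)"
  shows "moore013 q x y z = moore012 q x y z * dick1 q x y z"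
proof -
  let ?L = "dL2 q x y" and ?A = "dA q x y" and ?N = "dN q x y z"
  have A: "?A * ?L = x * (y ^ q) ^ q - (x ^ q) ^ q * y" by (rule dA_dL2[OF q_ge1])
  have A': "?A ^ q * ?L ^ q = x ^ q * ((y ^ q) ^ q) ^ q - ((x ^ q) ^ q) ^ q * y ^ q"
    using arg_cong[OF A, of "\<lambda>t. t ^ q"] by (simp add: power_mult_distrib)
  have S: "?A ^ q * (?A * ?L) - (?L ^ (q - 1)) ^ q * ?L
     = x * ((y ^ q) ^ q) ^ q - ((x ^ q) ^ q) ^ q * y" using dA_power_dL2[OF assms] .
  have B: "?L ^ (q - 1) * ?L = ?L ^ q" by (rule power_q_m1)
  have N: "?N ^ q = ((z ^ q) ^ q) ^ q - ?A ^ q * (z ^ q) ^ q + (?L ^ (q - 1)) ^ q * z ^ q"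
    by (simp add: dN_def power_mult_distrib)
  have "moore012 q x y z * dick1 q x y z = ?L * (?N * ?A ^ q + ?N ^ (q - 1) * ?N)"
    unfolding moore012_eq dick1_def by (simp add: algebra_simps)
  also have "\<dots> = ?L * (?N * ?A ^ q + ?N ^ q)" by (simp only: power_q_m1)
  also have "\<dots> = ?L * ((z ^ q) ^ q) ^ q + (?A ^ q * (?L ^ (q - 1) * ?L)) * z
       - (?A ^ q * (?A * ?L) - (?L ^ (q - 1)) ^ q * ?L) * z ^ q"
    unfolding N by (simp add: dN_def algebra_simps)
  also have "\<dots> = moore013 q x y z"
    unfolding S unfolding B unfolding A' moore013_def det3_def by (simp add: dL2_def algebra_simps)
  finally show ?thesis by simp
qed

lemma moore023_eq:
  assumes "dL2 q x y \<noteq> (0 :: 'a)"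
  shows "moore023 q x y z = moore012 q x y z * dick2 q x y z"
proof -
  let ?L = "dL2 q x y" and ?A = "dA q x y" and ?N = "dN q x y z"
  have A: "?A * ?L = x * (y ^ q) ^ q - (x ^ q) ^ q * y" by (rule dA_dL2[OF q_ge1])
  have S: "?A ^ q * (?A * ?L) - (?L ^ (q - 1)) ^ q * ?L
     = x * ((y ^ q) ^ q) ^ q - ((x ^ q) ^ q) ^ q * y" using dA_power_dL2[OF assms] .
  have B: "(?L ^ (q - 1)) ^ q * (?L ^ (q - 1) * ?L) = (?L ^ q) ^ q"
    using power_q_m1[of ?L] by (simp add: power_mult_distrib [symmetric])
  have L: "?L ^ q = x ^ q * (y ^ q) ^ q - (x ^ q) ^ q * y ^ q"
    by (simp add: dL2_def power_mult_distrib)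
  have N: "?N ^ q = ((z ^ q) ^ q) ^ q - ?A ^ q * (z ^ q) ^ q + (?L ^ (q - 1)) ^ q * z ^ q"
    by (simp add: dN_def power_mult_distrib)
  have "moore012 q x y z * dick2 q x y z
      = ?L * ?N * (?L ^ (q - 1)) ^ q + ?L * ?A * (?N ^ (q - 1) * ?N)"
    unfolding moore012_eq dick2_def by (simp add: algebra_simps)
  also have "\<dots> = ?L * ?N * (?L ^ (q - 1)) ^ q + ?L * ?A * ?N ^ q" by (simp only: power_q_m1)
  also have "\<dots> = (?A * ?L) * ((z ^ q) ^ q) ^ q + ((?L ^ (q - 1)) ^ q * (?L ^ (q - 1) * ?L)) * z
       - (?A ^ q * (?A * ?L) - (?L ^ (q - 1)) ^ q * ?L) * (z ^ q) ^ q"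
    unfolding N by (simp add: dN_def algebra_simps)
  also have "\<dots> = moore023 q x y z"
    unfolding S unfolding B unfolding A L moore023_def det3_def
    by (simp add: power_mult_distrib algebra_simps)
  finally show ?thesis by simp
qed

section \<open>The invariants under linear maps and under duality\<close>

lemma det3_mult:
  "det3 (a1*x1+a2*y1+a3*z1) (b1*x1+b2*y1+b3*z1) (c1*x1+c2*y1+c3*z1)
        (a1*x2+a2*y2+a3*z2) (b1*x2+b2*y2+b3*z2) (c1*x2+c2*y2+c3*z2)
        (a1*x3+a2*y3+a3*z3) (b1*x3+b2*y3+b3*z3) (c1*x3+c2*y3+c3*(z3::'a))
   = det3 a1 a2 a3 b1 b2 b3 c1 c2 c3 * det3 x1 y1 z1 x2 y2 z2 x3 y3 z3"
  unfolding det3_def by (simp add: algebra_simps)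

text \<open>The rows are the cross products a x b, c x d, d x e. Here (c x d) x (d x e) = det(c, d,
  e) d and (a x b) . d = det(a, b, d). For consecutive Frobenius powers of one vector this gives the
  Moore determinants of the line joining a point to its Frobenius image.\<close>

lemma det3_cross:
  "det3 (a2*b3 - a3*b2) (a3*b1 - a1*b3) (a1*b2 - a2*b1)
        (c2*d3 - c3*d2) (c3*d1 - c1*d3) (c1*d2 - c2*d1)
        (d2*e3 - d3*e2) (d3*e1 - d1*e3) (d1*e2 - d2*(e1::'a))
   = det3 c1 c2 c3 d1 d2 d3 e1 e2 e3 * det3 a1 a2 a3 b1 b2 b3 d1 d2 d3"
  unfolding det3_def by (simp add: algebra_simps)

text \<open>A matrix over the fixed field of the Frobenius map commutes with it, so all three Moore
  determinants acquire the same factor, which drops out of the quotients.\<close>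

lemma dick_linear:
  assumes "a1 ^ q = a1" "a2 ^ q = a2" "a3 ^ q = a3" "b1 ^ q = b1" "b2 ^ q = b2" "b3 ^ q = b3"
    "c1 ^ q = c1" "c2 ^ q = c2" "c3 ^ q = (c3 :: 'a)"
    and "det3 a1 a2 a3 b1 b2 b3 c1 c2 c3 \<noteq> 0" "moore012 q x y z \<noteq> 0"
  shows "dick1 q (a1*x+a2*y+a3*z) (b1*x+b2*y+b3*z) (c1*x+c2*y+c3*z) = dick1 q x y z"
    and "dick2 q (a1*x+a2*y+a3*z) (b1*x+b2*y+b3*z) (c1*x+c2*y+c3*z) = dick2 q x y z"
proof -
  let ?x = "a1*x+a2*y+a3*z" and ?y = "b1*x+b2*y+b3*z" and ?z = "c1*x+c2*y+c3*z"
    and ?d = "det3 a1 a2 a3 b1 b2 b3 c1 c2 c3"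
  have m: "moore012 q ?x ?y ?z = ?d * moore012 q x y z"
     "moore013 q ?x ?y ?z = ?d * moore013 q x y z"
     "moore023 q ?x ?y ?z = ?d * moore023 q x y z"
    unfolding moore012_def moore013_def moore023_def
    by (simp_all add: power_mult_distrib assms det3_mult)
  have L: "dL2 q ?x ?y \<noteq> 0" "dL2 q x y \<noteq> 0"
    using m(1) assms(10,11) unfolding moore012_eq by auto
  show "dick1 q ?x ?y ?z = dick1 q x y z" "dick2 q ?x ?y ?z = dick2 q x y z"
    using m moore013_eq[OF L(1), of ?z] moore013_eq[OF L(2), of z] 
      moore023_eq[OF L(1), of ?z] moore023_eq[OF L(2), of z] assms(10,11) by auto
qed

text \<open>The map sending a point $x$ to the line joining $x$ and $x^q$ pulls the second Dickson
  invariant back to the first one.\<close>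

lemma dick2_dual:
  fixes x y z :: 'a
  defines "u \<equiv> y * z ^ q - z * y ^ q" and "v \<equiv> z * x ^ q - x * z ^ q" and "w \<equiv> x * y ^ q - y * x ^ q"
  assumes "moore012 q x y z \<noteq> 0"
  shows "moore012 q u v w = moore012 q x y z ^ (q + 1)"
    and "dick2 q u v w = moore012 q x y z ^ (q\<^sup>2 - q) * dick1 q x y z"
proof -
  let ?L = "moore012 q x y z"
  have Lq: "?L ^ q = det3 (x ^ q) (y ^ q) (z ^ q) ((x ^ q) ^ q) ((y ^ q) ^ q) ((z ^ q) ^ q)
         (((x ^ q) ^ q) ^ q) (((y ^ q) ^ q) ^ q) (((z ^ q) ^ q) ^ q)"
    by (simp add: moore012_def det3_def power_mult_distrib)
  have Lqq: "(?L ^ q) ^ q = det3 ((x ^ q) ^ q) ((y ^ q) ^ q) ((z ^ q) ^ q)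
         (((x ^ q) ^ q) ^ q) (((y ^ q) ^ q) ^ q) (((z ^ q) ^ q) ^ q)
         ((((x ^ q) ^ q) ^ q) ^ q) ((((y ^ q) ^ q) ^ q) ^ q) ((((z ^ q) ^ q) ^ q) ^ q)"
    unfolding Lq by (simp add: det3_def power_mult_distrib)
  have m: "moore012 q u v w = ?L ^ q * ?L"
    unfolding Lq unfolding moore012_def u_def v_def w_def
    by (simp add: power_mult_distrib det3_cross)
  thus "moore012 q u v w = ?L ^ (q + 1)" by simp
  have m2: "moore023 q u v w = (?L ^ q) ^ q * moore013 q x y z"
    unfolding Lqq unfolding moore023_def moore013_def u_def v_def w_def
    by (simp add: power_mult_distrib det3_cross)
  have L: "dL2 q u v \<noteq> 0" "dL2 q x y \<noteq> 0" using m assms(4) unfolding moore012_eq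
    by auto
  have "(?L ^ q * ?L) * dick2 q u v w = (?L ^ q) ^ q * (?L * dick1 q x y z)"
    by (simp only: m [symmetric] moore023_eq[OF L(1), of w, symmetric]
        moore013_eq[OF L(2), of z, symmetric] m2)
  moreover have "(?L ^ q) ^ q = ?L ^ q * ?L ^ (q\<^sup>2 - q)"
    by (simp only: power_mult [symmetric] power_add [symmetric]) (use q_ge2 in \<open>simp add: power2_eq_square\<close>)
  ultimately have "(?L ^ q * ?L) * dick2 q u v w = (?L ^ q * ?L) * (?L ^ (q\<^sup>2 - q) * dick1 q x y z)"
    by (simp add: algebra_simps)
  thus "dick2 q u v w = ?L ^ (q\<^sup>2 - q) * dick1 q x y z" using assms(4) by simp
qed

end

section \<open>Algebraically closed fields of positive characteristic\<close>

lemma monom_dvd_powerD: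
  fixes h :: "'a::idom poly"
  assumes "monom 1 (m * k) dvd h ^ m" "m > 0"
  shows "monom 1 k dvd h"
proof (cases "h = 0")
  case False
  have "Polynomial.order 0 (h ^ m) = m * Polynomial.order 0 h"
    using False by (simp flip: count_proots add: proots_power del: count_proots)
  thus ?thesis using assms False by (simp add: monom_1_dvd_iff)
qed simp

lemma pcompose_power: "pcompose (f ^ m) g = pcompose (f :: 'a::comm_semiring_1 poly) g ^ m"
  by (induction m) (simp_all add: pcompose_mult pcompose_1)

locale dgz_field = frob_idom p n q R for p n q :: nat and R :: "'k::field itself" +
  assumes alg_closed: "\<And>f :: 'k poly. degree f > 0 \<Longrightarrow> \<exists>x. poly f x = 0"
begin

sublocale P1: frob_idom p n q "TYPE('k poly)"
  by (rule frob_idom.intro[OF prime n q]) (simp only: semiring_char_poly char)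
sublocale P2: frob_idom p n q "TYPE('k poly poly)"
  by (rule frob_idom.intro[OF prime n q]) (simp only: semiring_char_poly char)
sublocale P3: frob_idom p n q "TYPE('k poly poly poly)"
  by (rule frob_idom.intro[OF prime n q]) (simp only: semiring_char_poly char)

lemma q_pos: "0 < q" using q_ge2 by simp

lemma poly_factorization:
  fixes f :: "'k poly"
  assumes "f \<noteq> 0"
  shows "size (proots f) = degree f" "f = smult (lead_coeff f) (\<Prod>x\<in>#proots f. [:-x, 1:])"
  using assms
proof (induction "degree f" arbitrary: f)
  case 0
  { case 1 thus ?case using 0 size_proots_le[of f] by simp }
  { case 2 
    from 0 obtain a where "f = [:a:]" by (metis degree_eq_zeroE)
    thus ?case by simp }
next
  case (Suc d)
  { fix f :: "'k poly" assume d: "Suc d = degree f" and "f \<noteq> 0"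
    obtain x where "poly f x = 0" using alg_closed[of f] d by auto
    then obtain g where g: "f = [:-x, 1:] * g" by (metis dvdE poly_eq_0_iff_dvd)
    have "g \<noteq> 0" using \<open>f \<noteq> 0\<close> g by auto
    hence deg: "degree f = Suc (degree g)" unfolding g by (subst degree_mult_eq) auto
    have pr: "proots f = add_mset x (proots g)"
    proof -
      have "proots [:-x, 1:] = {#x#}" by (simp only: proots_linear_factor minus_minus)
      thus ?thesis unfolding g by (subst proots_mult) (use \<open>g \<noteq> 0\<close> in auto)
    qed
    have lc: "lead_coeff f = lead_coeff g" unfolding g
      by (simp add: lead_coeff_mult del: mult_pCons_left)
    have "d = degree g" using d deg by simp
    note IH = Suc(1)[OF this \<open>g \<noteq> 0\<close>] Suc(2)[OF this \<open>g \<noteq> 0\<close>]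
    have "size (proots f) = degree f" using IH(1) deg pr by simp
    moreover have "f = smult (lead_coeff f) (\<Prod>x\<in>#proots f. [:-x, 1:])"
    proof -
      have "f = [:-x, 1:] * smult (lead_coeff g) (\<Prod>x\<in>#proots g. [:-x, 1:])"
        using g IH(2) by simp
      also have "\<dots> = smult (lead_coeff f) (\<Prod>x\<in>#proots f. [:-x, 1:])"
        unfolding lc pr by (simp only: mult_smult_right image_mset_add_mset prod_mset.add_mset)
      finally show ?thesis .
    qed
    ultimately have "size (proots f) = degree f" "f = smult (lead_coeff f) (\<Prod>x\<in>#proots f. [:-x, 1:])" . }
  note * = this
  { case 1 show ?case using *(1) Suc(3) 1 by blast }
  { case 2 show ?case using *(2) Suc(3) 2 by blast }
qed

text \<open>In a finite field, the product of all T - a, increased by 1, would have positive degree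
  and no root.\<close>

lemma infinite_UNIV: "infinite (UNIV :: 'k set)"
proof
  assume fin: "finite (UNIV :: 'k set)"
  let ?f = "(\<Prod>a\<in>UNIV. [:-a, 1:]) + 1 :: 'k poly"
  have "degree (\<Prod>a\<in>(UNIV::'k set). [:-a, 1:]) = card (UNIV :: 'k set)"
    by (subst degree_prod_eq_sum_degree) auto
  moreover have "card (UNIV :: 'k set) > 0" using fin by (simp add: card_gt_0_iff)
  ultimately have "degree ?f > 0" by (subst degree_add_eq_left) auto
  then obtain x where "poly ?f x = 0" using alg_closed by blast
  moreover have "(\<Prod>a\<in>UNIV. poly [:-a, 1:] x) = 0" using fin by (subst prod_zero_iff) auto
  ultimately show False by (simp add: poly_prod)
qed

lemma root_exists:
  assumes "m > 0"
  shows "\<exists>x :: 'k. x ^ m = y"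
proof -
  let ?f = "monom 1 m + [:- y:] :: 'k poly"
  have "degree ?f = m" using assms by (subst degree_add_eq_left) (auto simp: degree_monom_eq)
  thus ?thesis using alg_closed[of ?f] assms by (auto simp: poly_monom)
qed

lemma card_simple_roots:
  fixes f :: "'k poly"
  assumes "f \<noteq> 0" and simple: "\<And>x. poly f x = 0 \<Longrightarrow> poly (pderiv f) x \<noteq> 0"
  shows "card {x. poly f x = 0} = degree f"
proof -
  have cnt: "count (proots f) x \<le> 1" for x
  proof (rule ccontr)
    assume "\<not> count (proots f) x \<le> 1"
    hence "2 \<le> Polynomial.order x f" using \<open>f \<noteq> 0\<close> by simp
    hence "[:-x, 1:] ^ 2 dvd f" by (meson dvd_trans le_imp_power_dvd order_1)
    then obtain g where "f = [:-x, 1:] ^ 2 * g" by (rule dvdE)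
    hence g: "f = [:-x, 1:] * ([:-x, 1:] * g)" by (simp only: power2_eq_square mult.assoc)
    have "poly f x = 0" "poly (pderiv f) x = 0"
      unfolding g by (simp_all add: pderiv_mult del: mult_pCons_left mult_pCons_right)
    thus False using simple by blast
  qed
  have "proots f = mset_set (set_mset (proots f))"
  proof (rule multiset_eqI)
    fix x show "count (proots f) x = count (mset_set (set_mset (proots f))) x"
      using cnt[of x]
        by (cases "count (proots f) x") (auto simp: count_mset_set' simp flip: count_greater_zero_iff)
  qed
  hence "size (proots f) = card (set_mset (proots f))" by (metis size_mset_set)
  thus ?thesis using poly_factorization(1)[OF assms(1)] assms(1) by simp
qed

text \<open>The derivative of T^N - T with N = p^m is -1 in characteristic p, so all N roots are
  simple.\<close>

lemma card_power_fixed: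
  assumes "m > 0"
  shows "card {x :: 'k. x ^ (p ^ m) = x} = p ^ m" "finite {x :: 'k. x ^ (p ^ m) = x}"
proof -
  define N where "N = p ^ m"
  have p2: "p \<ge> 2" using prime by (rule prime_ge_2_nat)
  hence N: "N \<ge> 2" using self_le_power[of p m] assms unfolding N_def by linarith
  define f where "f = monom 1 N + [:0, - 1 :: 'k:]"
  have deg: "degree f = N" unfolding f_def using N
    by (subst degree_add_eq_left) (auto simp: degree_monom_eq)
  hence f0: "f \<noteq> 0" using N by auto
  have N0: "of_nat N = (0 :: 'k)"
    unfolding of_nat_eq_0_iff_char_dvd char N_def using assms by simp
  hence pd: "pderiv f = [:- 1:]" unfolding f_def by (simp add: pderiv_add pderiv_monom pderiv_pCons)
  have r: "poly f x = 0 \<longleftrightarrow> x ^ N = x" for x by (simp add: f_def poly_monom)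
  have "card {x. poly f x = 0} = degree f" by (rule card_simple_roots[OF f0]) (simp add: pd)
  thus "card {x :: 'k. x ^ (p ^ m) = x} = p ^ m" unfolding deg r N_def .
  show "finite {x :: 'k. x ^ (p ^ m) = x}" using poly_roots_finite[OF f0] unfolding r N_def .
qed

section \<open>The subfields with q and q^2 elements\<close>

abbreviation "F1 \<equiv> Fq q :: 'k set"
abbreviation "F2 \<equiv> Fq (q\<^sup>2) :: 'k set"

lemma card_F1: "card F1 = q" "finite F1"
  using card_power_fixed[of n] n by (simp_all add: Fq_def q)

lemma card_F2: "card F2 = q\<^sup>2" "finite F2"
  using card_power_fixed[of "n * 2"] n by (simp_all add: Fq_def q power_mult)

lemma F1_iff: "x \<in> F1 \<longleftrightarrow> x ^ q = x" by (simp add: Fq_def)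
lemma F2_iff: "x \<in> F2 \<longleftrightarrow> (x ^ q) ^ q = x"
  by (simp add: Fq_def power2_eq_square power_mult)

lemma F1_closed [intro, simp]:
  "0 \<in> F1" "1 \<in> F1" "x \<in> F1 \<Longrightarrow> y \<in> F1 \<Longrightarrow> x + y \<in> F1" "x \<in> F1 \<Longrightarrow> y \<in> F1 \<Longrightarrow> x - y \<in> F1"
  "x \<in> F1 \<Longrightarrow> y \<in> F1 \<Longrightarrow> x * y \<in> F1" "x \<in> F1 \<Longrightarrow> - x \<in> F1" 
  "x \<in> F1 \<Longrightarrow> y \<in> F1 \<Longrightarrow> x / y \<in> F1" "x \<in> F1 \<Longrightarrow> inverse x \<in> F1"
  using q_pos by (simp_all add: F1_iff power_mult_distrib power_divide power_inverse)

lemma F1_F2: "x \<in> F1 \<Longrightarrow> x \<in> F2"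
  by (simp add: F1_iff F2_iff)

text \<open>The Frobenius map sends roots to roots, and there are at most two of them. So w^(q^2) is
  w^q or w, and in the first case injectivity of the Frobenius map gives w^q = w.\<close>

lemma quadratic_in_F2:
  assumes "a \<in> F1" "b \<in> F1" "c \<in> F1" "a \<noteq> 0" "a * w\<^sup>2 + b * w + c = 0"
  shows "w \<in> F2"
proof -
  have step: "a * (x ^ q)\<^sup>2 + b * x ^ q + c = 0" if "a * x\<^sup>2 + b * x + c = 0" for x
  proof -
    have "(a * x\<^sup>2 + b * x + c) ^ q = a ^ q * (x\<^sup>2) ^ q + b ^ q * x ^ q + c ^ q"
      by (simp add: power_mult_distrib)
    also have "\<dots> = a * (x ^ q)\<^sup>2 + b * x ^ q + c"
      using assms(1-3) by (simp only: F1_iff power2_eq_square power_mult_distrib)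
    finally show ?thesis using that q_pos by (simp add: zero_power)
  qed
  have two: "x = y \<or> a * (x + y) + b = 0" if "a * x\<^sup>2 + b * x + c = 0" "a * y\<^sup>2 + b * y + c = 0" for x y
  proof -
    have "(x - y) * (a * (x + y) + b) = (a * x\<^sup>2 + b * x + c) - (a * y\<^sup>2 + b * y + c)"
      by (simp add: power2_eq_square algebra_simps)
    hence "(x - y) * (a * (x + y) + b) = 0" using that by simp
    thus ?thesis by auto
  qed
  let ?u = "w ^ q" let ?v = "?u ^ q"
  have u: "a * ?u\<^sup>2 + b * ?u + c = 0" using step assms(5) by blast
  have v: "a * ?v\<^sup>2 + b * ?v + c = 0" using step u by blast
  have "?v = ?u \<or> ?v = w"
  proof (rule ccontr)
    assume *: "\<not> ?thesis"
    hence "?u \<noteq> w" by auto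
    with * two[OF u v] two[OF assms(5) u] have "a * (?u + ?v) = a * (w + ?u)"
      by (metis add_right_cancel)
    with * assms(4) show False by (simp add: add.commute)
  qed
  thus ?thesis unfolding F2_iff by auto
qed

lemma inj_on_affine:
  assumes "x \<notin> F1"
  shows "inj_on (\<lambda>(a, b). a * x + b) (F1 \<times> F1)"
proof (rule inj_onI)
  fix u v assume "u \<in> F1 \<times> F1" "v \<in> F1 \<times> F1"
    "(case u of (a, b) \<Rightarrow> a * x + b) = (case v of (a, b) \<Rightarrow> a * x + b)"
  then obtain a b a' b'
    where *: "a \<in> F1" "b \<in> F1" "a' \<in> F1" "b' \<in> F1" "a * x + b = a' * x + b'"
    and uv: "u = (a, b)" "v = (a', b')" by (cases u, cases v) auto
  have "a = a'"
  proof (rule ccontr)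
    assume "a \<noteq> a'"
    have "(a - a') * x = b' - b" using *(5) by (simp add: algebra_simps)
    hence "x = (b' - b) / (a - a')" using \<open>a \<noteq> a'\<close> by (simp add: field_simps)
    moreover have "(b' - b) / (a - a') \<in> F1" by (intro F1_closed *)
    ultimately show False using assms by simp
  qed
  thus "u = v" using *(5) uv by simp
qed

section \<open>Polynomials that are p-power powers\<close>

lemma pderiv_zero_imp_power:
  fixes f :: "'k poly"
  assumes "pderiv f = 0"
  shows "\<exists>g. f = g ^ p"
proof -
  have p2: "p \<ge> 2" using prime by (rule prime_ge_2_nat)
  \<comment> \<open>A choice of p-th roots of the coefficients; they exist because the field is
    algebraically closed.\<close>
  define r where "r = (\<lambda>y :: 'k. SOME x. x ^ p = y)"
  have r: "r y ^ p = y" for y unfolding r_def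
    by (rule someI_ex) (use root_exists[of p y] p2 in auto)
  have c: "coeff f i = 0" if "\<not> p dvd i" for i
  proof -
    have "i \<noteq> 0" using that by (metis dvd_0_right)
    then obtain j where i: "i = Suc j" by (cases i) auto
    have "coeff (pderiv f) j = 0" using assms by simp
    hence "of_nat i * coeff f i = 0" unfolding coeff_pderiv i .
    moreover have "of_nat i \<noteq> (0 :: 'k)" unfolding of_nat_eq_0_iff_char_dvd char by fact
    ultimately show ?thesis by simp
  qed
  have "\<exists>g. (\<Sum>i\<in>A. monom (coeff f i) i) = g ^ p" if "finite A" for A
    using that
  proof induction
    case empty thus ?case using p2 by (intro exI[of _ 0]) simp
  next
    case (insert i A)
    then obtain g where g: "(\<Sum>i\<in>A. monom (coeff f i) i) = g ^ p" by auto
    have "\<exists>h. monom (coeff f i) i = h ^ p"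
    proof (cases "p dvd i")
      case True
      then obtain j where "i = p * j" by auto
      thus ?thesis
        by (intro exI[of _ "monom (r (coeff f i)) j"]) (simp add: monom_power r mult.commute)
    next
      case False thus ?thesis using c p2 by (intro exI[of _ 0]) (simp add: power_0_left)
    qed
    then obtain h where "monom (coeff f i) i = h ^ p" by auto
    moreover have "(h + g) ^ p = h ^ p + g ^ p"
      by (rule frob_add[OF prime P1.char power_one_right [symmetric]])
    moreover have "(\<Sum>i\<in>insert i A. monom (coeff f i) i) = monom (coeff f i) i + (\<Sum>i\<in>A. monom (coeff f i) i)"
      using insert by simp
    ultimately show ?case using g by (intro exI[of _ "h + g"]) simp
  qed
  from this[of "{..degree f}"] show ?thesis by (simp add: poly_as_sum_of_monoms)
qed

text \<open>Locally constant modulo $z^{p^m}$ at every point: all Hasse derivatives of orders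
  $1, \<dots>, p^m - 1$ vanish.\<close>

lemma locally_constant_imp_power:
  fixes f :: "'k poly"
  assumes "\<And>x. monom 1 (p ^ m) dvd pcompose f [:x, 1:] - [:poly f x:]"
  shows "\<exists>g. f = g ^ (p ^ m)"
  using assms
proof (induction m arbitrary: f)
  case 0 thus ?case by (intro exI[of _ f]) simp
next
  case (Suc m)
  have p2: "p \<ge> 2" using prime by (rule prime_ge_2_nat)
  \<comment> \<open>The derivative at x is the linear coefficient of f(x + T), and this vanishes
    because p^(m+1) >= 2.\<close>
  have "poly (pderiv f) x = 0" for x
  proof -
    have "p ^ m \<ge> 1" using p2 by simp
    hence "p ^ Suc m \<ge> 2" using mult_le_mono[OF p2, of 1 "p ^ m"] by simp
    then obtain d where d: "p ^ Suc m = 2 + d" using le_Suc_ex by blast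
    have m2: "monom 1 (p ^ Suc m) = monom 1 2 * (monom 1 d :: 'k poly)"
      by (simp only: d mult_monom mult_1)
    obtain k where "pcompose f [:x, 1:] - [:poly f x:] = monom 1 (p ^ Suc m) * k"
      using Suc.prems[of x] by (rule dvdE)
    hence k: "pcompose f [:x, 1:] = monom 1 2 * (monom 1 d * k) + [:poly f x:]"
      unfolding m2 by (simp only: diff_eq_eq mult.assoc)
    have "poly (pderiv f) x = poly (pderiv (pcompose f [:x, 1:])) 0"
      by (simp add: pderiv_pcompose pderiv_pCons poly_pcompose)
    also have "\<dots> = poly (pderiv (monom 1 2 * (monom 1 d * k) + [:poly f x:])) 0"
      by (simp only: k)
    also have "\<dots> = 0"
      unfolding pderiv_add pderiv_mult[of "monom 1 2"]
      by (simp only: poly_add poly_mult pderiv_monom pderiv_pCons poly_monom) simp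
    finally show ?thesis .
  qed
  hence "pderiv f = 0"
    by (intro poly_eq_0_if_infinite_zeros[OF infinite_UNIV, of "\<lambda>x. x"]) auto
  then obtain g where g: "f = g ^ p" using pderiv_zero_imp_power by blast
  have "monom 1 (p ^ m) dvd pcompose g [:x, 1:] - [:poly g x:]" for x
  proof -
    define h where "h = pcompose g [:x, 1:] - [:poly g x:]"
    have fr: "(u - v) ^ p = u ^ p - v ^ p" for u v :: "'k poly"
      by (rule frob_diff[OF prime P1.char, of _ 1]) simp
    \<comment> \<open>Additivity of the p-th power: the p-th power of g(x + T) - g(x) is f(x + T) -
      f(x). Order p^(m+1) for f therefore becomes order p^m for g.\<close>
    have "h ^ p = pcompose f [:x, 1:] - [:poly f x:]"
      unfolding h_def fr by (simp add: g pcompose_power poly_power poly_const_pow)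
    hence "monom 1 (p * p ^ m) dvd h ^ p" using Suc.prems[of x] by simp
    hence "monom 1 (p ^ m) dvd h" by (rule monom_dvd_powerD) (use p2 in simp)
    thus ?thesis unfolding h_def .
  qed
  then obtain h where "g = h ^ (p ^ m)" using Suc.IH by blast
  thus ?case unfolding g by (intro exI[of _ h]) (simp add: power_mult [symmetric] mult.commute)
qed

end

section \<open>Degrees of semi-invariant forms\<close>

lemma sum_order_le_degree:
  fixes g :: "'a::idom poly"
  assumes "g \<noteq> 0" "finite S"
  shows "(\<Sum>x\<in>S. Polynomial.order x g) \<le> degree g"
proof -
  have "(\<Sum>x\<in>S. Polynomial.order x g) = (\<Sum>x\<in>S. count (proots g) x)"
    using assms by simp
  also have "\<dots> \<le> (\<Sum>x\<in>S \<union> set_mset (proots g). count (proots g) x)"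
    using assms by (intro sum_mono2) (auto simp: poly_roots_finite)
  also have "\<dots> = (\<Sum>x\<in>set_mset (proots g). count (proots g) x)"
    using assms by (intro sum.mono_neutral_right) (auto simp: poly_roots_finite not_in_iff order_0I)
  also have "\<dots> \<le> degree g" using size_proots_le[of g]
    by (simp add: size_multiset_overloaded_eq)
  finally show ?thesis .
qed

lemma order_pcompose_linear:
  fixes h :: "'a::field poly"
  assumes "h \<noteq> 0" "a \<noteq> 0"
  shows "Polynomial.order x (pcompose h [:b, a:]) = Polynomial.order (a * x + b) h"
proof -
  let ?y = "a * x + b"
  obtain r where r: "h = [:- ?y, 1:] ^ Polynomial.order ?y h * r" "\<not> [:- ?y, 1:] dvd r"
    using order_decomp[OF assms(1)] by blast
  let ?k = "Polynomial.order ?y h"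
  have lin: "pcompose [:- ?y, 1:] [:b, a:] = smult a [:- x, 1:]"
    by (simp add: pcompose_pCons algebra_simps)
  have "pcompose h [:b, a:] = pcompose ([:- ?y, 1:] ^ ?k * r) [:b, a:]" using r(1) by simp
  also have "\<dots> = smult (a ^ ?k) ([:- x, 1:] ^ ?k * pcompose r [:b, a:])"
    unfolding pcompose_mult pcompose_power lin by (simp only: smult_power mult_smult_left)
  finally have h: "pcompose h [:b, a:] = smult (a ^ ?k) ([:- x, 1:] ^ ?k * pcompose r [:b, a:])" .
  have "poly (pcompose r [:b, a:]) x \<noteq> 0"
    using r(2) by (simp add: poly_pcompose poly_eq_0_iff_dvd add.commute mult.commute)
  moreover from this have "pcompose r [:b, a:] \<noteq> 0" by auto
  ultimately show ?thesis unfolding h using assms(2)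
    by (simp add: order_smult order_mult order_0I order_power_n_n del: mult_pCons_left diff_minus_eq_add
        pCons_one minus_pCons)
qed

lemma coeff_order_0_neq_0:
  fixes h :: "'a::idom poly"
  assumes "h \<noteq> 0"
  shows "coeff h (Polynomial.order 0 h) \<noteq> 0"
proof
  assume *: "coeff h (Polynomial.order 0 h) = 0"
  have "monom 1 (Polynomial.order 0 h) dvd h" using monom_1_dvd_iff[OF assms] by blast
  hence "\<forall>k < Suc (Polynomial.order 0 h). coeff h k = 0" 
    using * by (auto simp: monom_1_dvd_iff' less_Suc_eq)
  hence "monom 1 (Suc (Polynomial.order 0 h)) dvd h" by (simp only: monom_1_dvd_iff')
  thus False using monom_1_dvd_iff[OF assms] by simp
qed

lemma varZ_power: "varZ ^ k = ([:[:monom 1 k:]:] :: 'k::comm_ring_1 poly3)"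
  by (induction k) (simp_all add: varZ_def monom_Suc)

lemma varZ_power_dvd:
  fixes F :: "'k::field poly3"
  assumes "\<And>i j k. k < m \<Longrightarrow> coeff3 F i j k = 0"
  shows "varZ ^ m dvd F"
  unfolding varZ_power const_poly_dvd_iff monom_1_dvd_iff' using assms by (simp add: coeff3_def)

lemma coeff3_scale_Z:
  fixes F :: "'k::comm_ring_1 poly3"
  shows "coeff3 (comp3 F varX varY (const3 c * varZ)) i j k = c ^ k * coeff3 F i j k"
proof (induction F rule: poly3_mono_induct)
  case zero
  interpret comm_ring_hom "sub3 const3 varX varY (const3 c * varZ) :: 'k poly3 \<Rightarrow> _"
    by (rule comm_ring_hom_sub3[OF comm_ring_hom_const3])
  show ?case by (simp only: hom_zero coeff3_0 mult_zero_right)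
next
  case (mono a i' j' k')
  interpret comm_ring_hom "sub3 const3 varX varY (const3 c * varZ) :: 'k poly3 \<Rightarrow> _"
    by (rule comm_ring_hom_sub3[OF comm_ring_hom_const3])
  interpret C: comm_ring_hom "const3 :: 'k \<Rightarrow> _" by (rule comm_ring_hom_const3)
  have "comp3 (mono3 a i' j' k') varX varY (const3 c * varZ) = const3 a * varX ^ i' * varY ^ j' * (const3 c * varZ) ^ k'"
    unfolding mono3_altdef hom_mult hom_power by (simp add: sub3_var comm_ring_hom_const3)
  also have "\<dots> = mono3 (c ^ k' * a) i' j' k'"
    unfolding mono3_altdef power_mult_distrib by (simp add: C.hom_mult C.hom_power mult_ac)
  finally show ?case by (simp add: coeff3_mono3)
next
  case (add F G)
  interpret comm_ring_hom "sub3 const3 varX varY (const3 c * varZ) :: 'k poly3 \<Rightarrow> _"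
    by (rule comm_ring_hom_sub3[OF comm_ring_hom_const3])
  show ?case by (simp only: hom_add coeff3_add add distrib_left)
qed

context dgz_field
begin

text \<open>If k had a nonzero remainder r modulo q - 1, then T^r - 1 would have the q - 1 > r
  nonzero elements of \<open>F1\<close> as roots.\<close>

lemma F1_power_eq_1_imp_dvd:
  assumes "\<And>c. c \<in> F1 \<Longrightarrow> c \<noteq> 0 \<Longrightarrow> c ^ k = 1"
  shows "(q - 1) dvd k"
proof (rule ccontr)
  assume nd: "\<not> ?thesis"
  define r where "r = k mod (q - 1)"
  have r: "0 < r" "r < q - 1" using nd q_ge2 by (auto simp: r_def dvd_eq_mod_eq_0)
  have 1: "c ^ r = 1" if "c \<in> F1" "c \<noteq> 0" for c
  proof -
    have "c ^ (q - 1) * c = c" using power_q_m1[of c] that by (simp add: F1_iff)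
    hence "c ^ (q - 1) = 1" using that by simp
    hence "c ^ ((q - 1) * (k div (q - 1)) + r) = c ^ r"
      by (simp only: power_add power_mult power_one mult_1)
    hence "c ^ k = c ^ r" unfolding r_def by (simp only: mult_div_mod_eq)
    thus ?thesis using assms that by simp
  qed
  let ?f = "monom 1 r + [:- 1 :: 'k:]"
  have deg: "degree ?f = r" using r by (subst degree_add_eq_left) (auto simp: degree_monom_eq)
  hence "?f \<noteq> 0" using r by auto
  hence "card {x. poly ?f x = 0} \<le> r" "finite {x. poly ?f x = 0}"
    using card_poly_roots_bound[of ?f] poly_roots_finite[of ?f] deg by auto
  moreover have "F1 - {0} \<subseteq> {x. poly ?f x = 0}" using 1 by (auto simp: poly_monom)
  moreover have "card (F1 - {0}) = q - 1" using card_F1 by simp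
  ultimately have "q - 1 \<le> r" using card_mono[of "{x. poly ?f x = 0}" "F1 - {0}"] by simp
  thus False using r by simp
qed

text \<open>\<open>g\<close> is the affine part of a binary form of degree \<open>d1\<close>. Its
  order at infinity is \<open>d1 - degree g\<close>, so the hypothesis on the degree says that the
  orders at 0 and at infinity agree. The bound q^2 - 1 leaves no room for a rational zero, for two
  affine orbits of zeros, or for a double zero.\<close>

lemma binary_form_core:
  fixes g :: "'k poly"
  assumes g: "g \<noteq> 0" and d1: "1 \<le> d1" "d1 < q\<^sup>2 - 1" and deg: "degree g + Polynomial.order 0 g = d1"
    and dv: "(q - 1) dvd Polynomial.order 0 g"
    and aff: "\<And>a b x. a \<in> F1 \<Longrightarrow> b \<in> F1 \<Longrightarrow> a \<noteq> 0 \<Longrightarrow> Polynomial.order (a * x + b) g = Polynomial.order x g"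
    and inv: "\<And>x. x \<noteq> 0 \<Longrightarrow> poly g x = 0 \<Longrightarrow> poly g (1 / x) = 0"
  shows "d1 = q\<^sup>2 - q" "degree g = q\<^sup>2 - q" "proots g = mset_set (F2 - F1)"
proof -
  let ?o = "\<lambda>x. Polynomial.order x g"
  have b: "?o b = ?o 0" if "b \<in> F1" for b using aff[of 1 b 0] that by simp
  obtain r where qr: "q = Suc r" "r \<ge> 1" using q_ge2 by (cases q) auto
  have sq: "q\<^sup>2 - q = r * q" "q\<^sup>2 - 1 = (q + 1) * r" "r * q + r = q\<^sup>2 - 1" 
    by (simp_all add: qr power2_eq_square algebra_simps)
  have d1': "d1 < r * q + r" using d1(2) unfolding sq(3) .
  have "r \<le> r * q" using qr by simp
  hence two: "\<not> 2 * (r * q) \<le> d1" using d1' by linarith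
  \<comment> \<open>A zero at 0 would spread to all q + 1 rational points, infinity included, each
    of order at least q - 1.\<close>
  have o0: "?o 0 = 0"
  proof (rule ccontr)
    assume "?o 0 \<noteq> 0"
    hence m: "?o 0 \<ge> r" using dv qr by (simp add: dvd_imp_le)
    have "(\<Sum>x\<in>F1. ?o x) = (\<Sum>x\<in>F1. ?o 0)" by (intro sum.cong refl b)
    also have "\<dots> = q * ?o 0" using card_F1 by simp
    finally have "(\<Sum>x\<in>F1. ?o x) = q * ?o 0" .
    hence "q * ?o 0 \<le> degree g" using sum_order_le_degree[OF g card_F1(2)] by simp
    hence "(q + 1) * ?o 0 \<le> d1" using deg by simp
    moreover have "(q + 1) * r \<le> (q + 1) * ?o 0" using m by (rule mult_le_mono2)
    ultimately have "q\<^sup>2 - 1 \<le> d1" unfolding sq(2) by (rule order_trans[rotated])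
    thus False using d1(2) by simp
  qed
  hence dg: "degree g = d1" using deg by simp
  have nF1: "x \<notin> F1" if "poly g x = 0" for x
    using b[of x] o0 that g order_root[of g x] by auto
  define S where "S = (\<lambda>x :: 'k. (\<lambda>(a, b). a * x + b) ` ((F1 - {0}) \<times> F1))"
  have finS: "finite (S x)" for x unfolding S_def using card_F1 by auto
  have cardS: "card (S x) = r * q" if "x \<notin> F1" for x
  proof -
    have "inj_on (\<lambda>(a, b). a * x + b) ((F1 - {0}) \<times> F1)"
      by (rule inj_on_subset[OF inj_on_affine[OF that]]) auto
    hence "card (S x) = card ((F1 - {0}) \<times> F1)" unfolding S_def by (rule card_image)
    moreover have "card (F1 - {0}) = q - 1" using card_F1 by simp
    hence "card (F1 - {0}) = r" unfolding qr(1) by simp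
    ultimately show ?thesis using card_F1(1) by (simp add: card_cartesian_product)
  qed
  have oS: "?o y = ?o x" if "y \<in> S x" for x y
    using that aff unfolding S_def by auto
  have sumS: "(\<Sum>y\<in>S x. ?o y) = r * q * ?o x" if "x \<notin> F1" for x
  proof -
    have "(\<Sum>y\<in>S x. ?o y) = (\<Sum>y\<in>S x. ?o x)" by (intro sum.cong refl oS)
    thus ?thesis using cardS[OF that] by simp
  qed
  have SF2: "S x = F2 - F1" if x: "poly g x = 0" for x
  proof -
    have xn: "x \<notin> F1" using nF1 x by blast
    hence x0: "x \<noteq> 0" by auto
    have x': "poly g (1 / x) = 0" using inv x x0 by blast
    hence xn': "1 / x \<notin> F1" using nF1 by blast
    have ox: "?o x \<ge> 1" "?o (1 / x) \<ge> 1" using x x' g order_root[of g]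
      by (auto simp: Suc_le_eq)
    \<comment> \<open>Otherwise the affine orbits of x and 1/x are disjoint and account for 2 (q^2 -
      q) zeros, more than \<open>d1\<close>.\<close>
    have in_S: "1 / x \<in> S x"
    proof (rule ccontr)
      assume n: "1 / x \<notin> S x"
      have "S x \<inter> S (1 / x) = {}"
      proof (rule ccontr)
        assume "S x \<inter> S (1 / x) \<noteq> {}"
        then obtain a b a' b'
          where *: "a \<in> F1" "b \<in> F1" "a' \<in> F1" "b' \<in> F1" "a \<noteq> 0" "a' \<noteq> 0"
          "a * x + b = a' * (1 / x) + b'" unfolding S_def by auto
        have "a' * (1 / x) = a * x + (b - b')" using *(7) by (simp add: algebra_simps)
        hence "1 / x = (a * x + (b - b')) / a'" using *(6) by (metis nonzero_mult_div_cancel_left)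
        hence "1 / x = (a / a') * x + (b - b') / a'" by (simp add: add_divide_distrib)
        moreover have "a / a' \<in> F1 - {0}" "(b - b') / a' \<in> F1" using * by auto
        ultimately have "1 / x \<in> S x" unfolding S_def
          by (auto intro!: image_eqI[of _ _ "(a / a', (b - b') / a')"])
        thus False using n by simp
      qed
      hence "(\<Sum>y\<in>S x \<union> S (1 / x). ?o y) = r * q * ?o x + r * q * ?o (1 / x)"
        using finS sumS[OF xn] sumS[OF xn'] by (subst sum.union_disjoint) auto
      hence "r * q * ?o x + r * q * ?o (1 / x) \<le> d1"
        using sum_order_le_degree[OF g, of "S x \<union> S (1 / x)"] finS dg by simp
      moreover have "r * q * 1 \<le> r * q * ?o x" "r * q * 1 \<le> r * q * ?o (1 / x)"
        using ox by (intro mult_le_mono2; simp)+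
      ultimately show False using two by linarith
    qed
    then obtain a b where ab: "a \<in> F1" "b \<in> F1" "a \<noteq> 0" "1 / x = a * x + b"
      unfolding S_def by auto
    \<comment> \<open>The coincidence 1/x = ax + b is a quadratic equation for x over
      \<open>F1\<close>.\<close>
    hence "a * x\<^sup>2 + b * x + (- 1) = 0" using x0 by (simp add: field_simps power2_eq_square)
    hence xF2: "x \<in> F2" by (intro quadratic_in_F2[of a b "- 1"]) (use ab in auto)
    have "S x \<subseteq> F2 - F1"
    proof
      fix y assume y: "y \<in> S x"
      then obtain a b where ab: "a \<in> F1" "b \<in> F1" "a \<noteq> 0" "y = a * x + b"
        unfolding S_def by auto
      have "y \<in> F2" using ab xF2 by (simp add: F1_iff F2_iff power_mult_distrib)
      moreover have "y \<notin> F1"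
      proof
        assume "y \<in> F1"
        hence "(y - b) / a \<in> F1" using ab by (intro F1_closed)
        moreover have "x = (y - b) / a" using ab by (simp add: field_simps)
        ultimately show False using xn by simp
      qed
      ultimately show "y \<in> F2 - F1" by simp
    qed
    moreover have "card (F2 - F1) = r * q"
      using card_F1 card_F2 F1_F2 sq(1) by (subst card_Diff_subset) auto
    ultimately show ?thesis using cardS[OF xn] card_F2 by (intro card_subset_eq) auto
  qed
  have "degree g > 0" using dg d1 by simp
  then obtain w where w: "poly g w = 0" using alg_closed by blast
  have wn: "w \<notin> F1" using nF1 w by blast
  have ow: "?o w \<ge> 1" using w g order_root[of g] by (auto simp: Suc_le_eq)
  have "r * q * ?o w \<le> d1" using sumS[OF wn] sum_order_le_degree[OF g finS[of w]] dg by simp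
  moreover have "r * q * 2 \<le> r * q * ?o w" if "2 \<le> ?o w" using that by (rule mult_le_mono2)
  ultimately have "?o w < 2" using two by (metis le_trans mult.commute not_le)
  hence o1: "?o w = 1" using ow by simp
  show pr: "proots g = mset_set (F2 - F1)"
  proof (rule multiset_eqI)
    fix x
    show "count (proots g) x = count (mset_set (F2 - F1)) x"
    proof (cases "x \<in> F2 - F1")
      case True
      hence "?o x = 1" using oS[of x w] SF2[OF w] o1 by auto
      thus ?thesis using True card_F2 g by simp
    next
      case False
      have "1 * x + 0 \<in> S x" unfolding S_def by (rule image_eqI[of _ _ "(1, 0)"]) auto
      hence "poly g x \<noteq> 0" using False SF2[of x] by auto
      thus ?thesis using False g by (simp add: order_0I)
    qed
  qed
  have "card (F2 - F1) = r * q"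
    using card_F1 card_F2 F1_F2 sq(1) by (subst card_Diff_subset) auto
  hence "degree g = r * q" using poly_factorization(1)[OF g] pr by simp
  thus "degree g = q\<^sup>2 - q" "d1 = q\<^sup>2 - q" using dg sq by auto
qed

text \<open>A monomial with Z^k survives only if c^k = 1 for all nonzero c in \<open>F1\<close>,
  hence only if q - 1 divides k. So no exponent lies strictly between 0 and q - 1.\<close>

lemma torus_imp_varZ_dvd:
  fixes F :: "'k poly3"
  assumes "\<And>c x y z. c \<in> F1 \<Longrightarrow> c \<noteq> 0 \<Longrightarrow> eval3 F x y (c * z) = eval3 F x y z"
  shows "varZ ^ (q - 1) dvd F - comp3 F varX varY 0"
proof (rule varZ_power_dvd)
  fix i j k assume k: "k < q - 1"
  have 0: "const3 0 = (0 :: 'k poly3)" by (simp add: const3_def)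
  have F0: "coeff3 (comp3 F varX varY 0) i j k = 0 ^ k * coeff3 F i j k"
    using coeff3_scale_Z[of 0 F i j k] by (simp add: 0)
  show "coeff3 (F - comp3 F varX varY 0) i j k = 0"
  proof (cases "k = 0 \<or> coeff3 F i j k = 0")
    case False
    have "c ^ k = 1" if "c \<in> F1" "c \<noteq> 0" for c
    proof -
      have "comp3 F varX varY (const3 c * varZ) = F"
        by (rule poly3_eqI_eval[OF infinite_UNIV]) (use assms that in simp)
      hence "c ^ k * coeff3 F i j k = coeff3 F i j k" using coeff3_scale_Z[of c F i j k] by simp
      thus ?thesis using False by simp
    qed
    hence "(q - 1) dvd k" by (rule F1_power_eq_1_imp_dvd)
    thus ?thesis using False k by (auto dest: dvd_imp_le)
  qed (auto simp: F0)
qed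


text \<open>On Z = 0 the form becomes h = g^q, and g falls under \<open>binary_form_core\<close>.
  The thresholds q^3 - q and q^3 - q^2 are q times the numbers q^2 - 1 and q^2 - q found
  there.\<close>

lemma semi_invariant_degree:
  fixes F :: "'k poly3"
  assumes hom: "hom3 F d" and d: "d \<ge> 1"
    and nz: "\<exists>x y. eval3 F x y 0 \<noteq> 0" and nz': "\<exists>y z. eval3 F 0 y z \<noteq> 0"
    and i1: "\<And>c. c \<in> F1 \<Longrightarrow> c \<noteq> 0 \<Longrightarrow> \<exists>\<kappa>. \<forall>x y z. eval3 F x y (c * z) = \<kappa> * eval3 F x y z"
    and i2: "\<And>c. c \<in> F1 \<Longrightarrow> c \<noteq> 0 \<Longrightarrow> \<exists>\<kappa>. \<forall>x y z. eval3 F (c * x) y z = \<kappa> * eval3 F x y z"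
    and i3: "\<exists>\<kappa>. \<forall>x y z. eval3 F (x + z) y z = \<kappa> * eval3 F x y z"
    and i4: "\<And>b. b \<in> F1 \<Longrightarrow> \<exists>\<kappa>. \<kappa> \<noteq> 0 \<and> (\<forall>x y z. eval3 F (x + b * y) y z = \<kappa> * eval3 F x y z)"
    and i5: "\<exists>\<kappa>. \<kappa> \<noteq> 0 \<and> (\<forall>x y z. eval3 F y x z = \<kappa> * eval3 F x y z)"
  shows "q ^ 3 - q \<le> d \<or> d = q ^ 3 - q\<^sup>2 \<and> 
    (\<exists>c. c \<noteq> 0 \<and> (\<forall>x. eval3 F x 1 0 = c * (\<Prod>w\<in>F2 - F1. x - w) ^ q))"
proof -
  \<comment> \<open>A point that is fixed by the map and lies off the curve forces the scalar to be
    1. Such a point is found on Z = 0 here and in \<open>e3\<close>, on X = 0 in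
    \<open>e2\<close>.\<close>
  have e1: "eval3 F x y (c * z) = eval3 F x y z" if c: "c \<in> F1" "c \<noteq> 0" for c x y z
  proof -
    obtain \<kappa> where k: "\<And>x y z. eval3 F x y (c * z) = \<kappa> * eval3 F x y z"
      using i1[OF c] by blast
    obtain x' y' where "eval3 F x' y' 0 \<noteq> 0" using nz by blast
    moreover have "eval3 F x' y' 0 = \<kappa> * eval3 F x' y' 0" using k[of x' y' 0] by simp
    ultimately have "\<kappa> = 1" by simp
    thus ?thesis using k by simp
  qed
  have e2: "eval3 F (c * x) y z = eval3 F x y z" if c: "c \<in> F1" "c \<noteq> 0" for c x y z
  proof -
    obtain \<kappa> where k: "\<And>x y z. eval3 F (c * x) y z = \<kappa> * eval3 F x y z"
      using i2[OF c] by blast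
    obtain x' y' where "eval3 F 0 x' y' \<noteq> 0" using nz' by blast
    moreover have "eval3 F 0 x' y' = \<kappa> * eval3 F 0 x' y'" using k[of 0 x' y'] by simp
    ultimately have "\<kappa> = 1" by simp
    thus ?thesis using k by simp
  qed
  have e3: "eval3 F (x + z) y z = eval3 F x y z" for x y z
  proof -
    obtain \<kappa> where k: "\<And>x y z. eval3 F (x + z) y z = \<kappa> * eval3 F x y z" using i3
      by blast
    obtain x' y' where "eval3 F x' y' 0 \<noteq> 0" using nz by blast
    moreover have "eval3 F x' y' 0 = \<kappa> * eval3 F x' y' 0" using k[of x' 0 y'] by simp
    ultimately have "\<kappa> = 1" by simp
    thus ?thesis using k by simp
  qed
  obtain s where s: "s \<noteq> 0" "\<And>x y z. eval3 F y x z = s * eval3 F x y z" using i5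
    by blast
  define h where "h = curve3 F [:0, 1:] 1 0"
  have h: "poly h x = eval3 F x 1 0" for x by (simp add: h_def)
  have h0: "h \<noteq> 0"
  proof -
    obtain x y where xy: "eval3 F x y 0 \<noteq> 0" using nz by blast
    have "\<exists>t. poly h t \<noteq> 0"
    proof (cases "y = 0")
      case False
      have "eval3 F x y 0 = y ^ d * eval3 F (x / y) 1 0" 
        using eval3_scale[OF hom, of y "x / y" 1 0] False by simp
      thus ?thesis using xy by (intro exI[of _ "x / y"]) (auto simp: h)
    next
      case True
      have "eval3 F x 0 0 = x ^ d * eval3 F 1 0 0" using eval3_scale[OF hom, of x 1 0 0] by simp
      hence "eval3 F 1 0 0 \<noteq> 0" using xy True by auto
      thus ?thesis using s(2)[of 1 0 0] by (intro exI[of _ 0]) (auto simp: h)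
    qed
    thus ?thesis by auto
  qed
  have inv: "poly h x = s * x ^ d * poly h (1 / x)" if "x \<noteq> 0" for x
  proof -
    have "eval3 F 1 x 0 = x ^ d * eval3 F (1 / x) 1 0"
      using eval3_scale[OF hom, of x "1 / x" 1 0] that by simp
    thus ?thesis unfolding h s(2)[of x 1 0] by (simp only: mult.assoc)
  qed
  have degh: "degree h + Polynomial.order 0 h = d"
  proof -
    have "poly (h * monom 1 (degree h)) x = poly (smult s (monom 1 d * reflect_poly h)) x" if "x \<noteq> 0" for x
      using inv[OF that] that by (simp add: poly_monom poly_reflect_poly_nz field_simps)
    \<comment> \<open>The extra factor T makes the identity hold at x = 0 too, where the relation
      between h(x) and h(1/x) says nothing.\<close>
    hence "poly ((h * monom 1 (degree h) - smult s (monom 1 d * reflect_poly h)) * [:0, 1:]) x = 0" for x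
      by (cases "x = 0") simp_all
    hence "(h * monom 1 (degree h) - smult s (monom 1 d * reflect_poly h)) * [:0, 1:] = 0"
      by (rule poly_eq_0_if_infinite_zeros[OF infinite_UNIV inj_on_id2])
    hence eq: "h * monom 1 (degree h) = smult s (monom 1 d * reflect_poly h)" by simp
    have "Polynomial.order 0 (h * monom 1 (degree h)) = Polynomial.order 0 h + degree h"
      using h0 by (subst order_mult) auto
    moreover have "Polynomial.order 0 (smult s (monom 1 d * reflect_poly h)) = d"
      using h0 s(1) by (simp add: order_smult order_mult order_0I)
    ultimately show ?thesis using eq by simp
  qed
  have "\<exists>g. h = g ^ (p ^ n)"
  proof (rule locally_constant_imp_power)
    fix x
    obtain G where G: "F - comp3 F varX varY 0 = varZ ^ (q - 1) * G"
      by (rule dvdE[OF torus_imp_varZ_dvd[OF e1]])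
    have Fe: "eval3 F x y z = eval3 F x y 0 + z ^ (q - 1) * eval3 G x y z" for x y z
    proof -
      have "eval3 (F - comp3 F varX varY 0) x y z = eval3 (varZ ^ (q - 1) * G) x y z"
        by (simp only: G)
      thus ?thesis by (simp add: diff_eq_eq add.commute)
    qed
    \<comment> \<open>Invariance under x -> x + z gives h(x + t) - h(x) = t^(q-1) (G(x, 1, t) - G(x
      + t, 1, t)). The difference on the right vanishes at t = 0, which raises the order from q - 1
      to the required q.\<close>
    let ?g = "curve3 G [:x:] 1 [:0, 1:] - curve3 G [:x, 1:] 1 [:0, 1:]"
    have "poly ?g 0 = 0" by simp
    then obtain k where k: "?g = [:0, 1:] * k" by (metis dvdE poly_eq_0_iff_dvd minus_zero)
    have "poly (pcompose h [:x, 1:] - [:poly h x:]) t = poly (monom 1 q * k) t" for t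
    proof -
      have "poly (pcompose h [:x, 1:] - [:poly h x:]) t = t ^ (q - 1) * poly ?g t"
        using e3[of x t 1] Fe[of "x + t" 1 t] Fe[of x 1 t] 
        by (simp add: poly_pcompose h algebra_simps)
      also have "\<dots> = (t ^ (q - 1) * t) * poly k t" unfolding k by (simp add: algebra_simps)
      also have "\<dots> = poly (monom 1 q * k) t" by (simp only: power_q_m1) (simp add: poly_monom)
      finally show ?thesis .
    qed
    hence "poly (pcompose h [:x, 1:] - [:poly h x:] - monom 1 q * k) t = 0" for t
      by (simp only: poly_diff right_minus_eq)
    hence "pcompose h [:x, 1:] - [:poly h x:] - monom 1 q * k = 0"
      by (rule poly_eq_0_if_infinite_zeros[OF infinite_UNIV inj_on_id2])
    hence "pcompose h [:x, 1:] - [:poly h x:] = monom 1 q * k" by (simp only: right_minus_eq)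
    thus "monom 1 (p ^ n) dvd pcompose h [:x, 1:] - [:poly h x:]" unfolding q [symmetric] by simp
  qed
  then obtain g where g: "h = g ^ q" unfolding q by blast
  have g0: "g \<noteq> 0" using h0 g q_pos by (auto simp: zero_power)
  have og: "Polynomial.order x h = q * Polynomial.order x g" for x
    using g0 unfolding g by (simp flip: count_proots add: proots_power del: count_proots)
  have dg: "degree h = q * degree g" using g0 by (simp add: g degree_power_eq)
  define d1 where "d1 = degree g + Polynomial.order 0 g"
  have d1: "d = q * d1" using degh og dg by (simp add: d1_def algebra_simps)
  have q3: "q ^ 3 - q = q * (q\<^sup>2 - 1)" "q ^ 3 - q\<^sup>2 = q * (q\<^sup>2 - q)"
    by (simp_all add: power2_eq_square power3_eq_cube algebra_simps)
  show ?thesis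
  proof (cases "q ^ 3 - q \<le> d")
    case False
    hence lt: "d1 < q\<^sup>2 - 1" unfolding q3 d1 by simp
    have d1_ge: "d1 \<ge> 1" using d d1 by (cases d1) auto
    have hc: "coeff h k = c ^ k * coeff h k" if "c \<in> F1" "c \<noteq> 0" for c k
    proof -
      have "poly (pcompose h [:0, c:] - h) x = 0" for x
      proof -
        have "poly (pcompose h [:0, c:]) x = eval3 F (c * x) 1 0"
          by (simp add: poly_pcompose h mult.commute)
        thus ?thesis by (simp add: h e2[OF that])
      qed
      hence "pcompose h [:0, c:] - h = 0"
        by (rule poly_eq_0_if_infinite_zeros[OF infinite_UNIV inj_on_id2])
      hence "pcompose h [:0, c:] = h" by simp
      moreover have "coeff (pcompose h [:0, c:]) k = c ^ k * coeff h k"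
        by (simp add: coeff_pcompose_linear)
      ultimately show ?thesis by simp
    qed
    \<comment> \<open>The lowest exponent of h is q times the order of g; scalings of x fix h, so q
      - 1 divides it, and q - 1 is coprime to q.\<close>
    have "(q - 1) dvd q * Polynomial.order 0 g"
    proof (rule F1_power_eq_1_imp_dvd)
      fix c :: 'k assume "c \<in> F1" "c \<noteq> 0"
      thus "c ^ (q * Polynomial.order 0 g) = 1"
        using hc[of c "Polynomial.order 0 h"] coeff_order_0_neq_0[OF h0] og by simp
    qed
    moreover have "algebraic_semidom_class.coprime (q - 1) q" using q_pos
      by (rule coprime_diff_one_left_nat)
    ultimately have dv: "(q - 1) dvd Polynomial.order 0 g" by (simp add: coprime_dvd_mult_right_iff)
    have aff: "Polynomial.order (a * x + b) g = Polynomial.order x g" if ab: "a \<in> F1" "b \<in> F1" "a \<noteq> 0" for a b x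
    proof -
      obtain \<kappa>
        where "\<kappa> \<noteq> 0 \<and> (\<forall>x y z. eval3 F (x + b * y) y z = \<kappa> * eval3 F x y z)"
        using i4[OF ab(2)] ..
      hence k: "\<kappa> \<noteq> 0" "eval3 F (x + b * y) y z = \<kappa> * eval3 F x y z" for x y z
        by simp_all
      have "poly (pcompose h [:b, a:] - smult \<kappa> h) x = 0" for x
      proof -
        have "poly (pcompose h [:b, a:]) x = eval3 F (a * x + b * 1) 1 0"
          by (simp add: poly_pcompose h algebra_simps)
        also have "\<dots> = \<kappa> * poly h x" unfolding k(2) h e2[OF ab(1,3)] ..
        finally show ?thesis by simp
      qed
      hence "pcompose h [:b, a:] - smult \<kappa> h = 0"
        by (rule poly_eq_0_if_infinite_zeros[OF infinite_UNIV inj_on_id2])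
      hence "pcompose h [:b, a:] = smult \<kappa> h" by simp
      hence "Polynomial.order x (pcompose h [:b, a:]) = Polynomial.order x h" using k(1)
        by (simp add: order_smult)
      hence "Polynomial.order (a * x + b) h = Polynomial.order x h"
        using order_pcompose_linear[OF h0 ab(3)] by simp
      thus ?thesis unfolding og using q_pos by simp
    qed
    have inv': "poly g (1 / x) = 0" if "x \<noteq> 0" "poly g x = 0" for x
    proof -
      have "poly h x = 0" using that q_pos by (simp add: g zero_power poly_power)
      hence "poly h (1 / x) = 0" using inv[OF that(1)] that(1) s(1) by simp
      thus ?thesis by (simp add: g poly_power)
    qed
    have core: "d1 = q\<^sup>2 - q" "proots g = mset_set (F2 - F1)"
      using binary_form_core(1,3)[OF g0 d1_ge lt d1_def [symmetric] dv] aff inv' by simp_all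
    have "d = q ^ 3 - q\<^sup>2" unfolding d1 q3 core(1) ..
    moreover have "eval3 F x 1 0 = lead_coeff g ^ q * (\<Prod>w\<in>F2 - F1. x - w) ^ q" for x
    proof -
      have "poly g x = lead_coeff g * poly (\<Prod>x\<in>#proots g. [:-x, 1:]) x"
        using poly_factorization(2)[OF g0] by (metis poly_smult)
      also have "poly (\<Prod>x\<in>#proots g. [:-x, 1:]) x = (\<Prod>w\<in>F2 - F1. x - w)"
        unfolding core(2) prod_unfold_prod_mset [symmetric] poly_prod by simp
      finally show ?thesis by (simp add: h [symmetric] g poly_power power_mult_distrib)
    qed
    ultimately show ?thesis using g0 by (intro disjI2 conjI exI[of _ "lead_coeff g ^ q"]) auto
  qed auto
qed

end

section \<open>Linear substitutions and perspectivities\<close>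

definition row3 :: "'k::comm_ring_1 ^ 3 ^ 3 \<Rightarrow> 3 \<Rightarrow> 'k poly3" where
  "row3 A i = const3 (A $ i $ 1) * varX + const3 (A $ i $ 2) * varY + const3 (A $ i $ 3) * varZ"

definition lin3 :: "'k::comm_ring_1 ^ 3 ^ 3 \<Rightarrow> 'k poly3 \<Rightarrow> 'k poly3" where
  "lin3 A = sub3 const3 (row3 A 1) (row3 A 2) (row3 A 3)"

abbreviation evalv :: "'k::comm_ring_1 poly3 \<Rightarrow> 'k ^ 3 \<Rightarrow> 'k" where
  "evalv F v \<equiv> eval3 F (v $ 1) (v $ 2) (v $ 3)"

definition semi_invariant :: "'k::comm_ring_1 ^ 3 ^ 3 \<Rightarrow> 'k poly3 \<Rightarrow> bool" where
  "semi_invariant A F \<longleftrightarrow> (\<exists>c. c \<noteq> 0 \<and> (\<forall>v. evalv F (A *v v) = c * evalv F v))"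

definition mat3 :: "'k::comm_ring_1 \<Rightarrow> 'k \<Rightarrow> 'k \<Rightarrow> 'k \<Rightarrow> 'k \<Rightarrow> 'k \<Rightarrow> 'k \<Rightarrow> 'k \<Rightarrow> 'k \<Rightarrow> 'k ^ 3 ^ 3" where
  "mat3 a b c d e f g h i = vector [vector [a, b, c], vector [d, e, f], vector [g, h, i]]"

lemma mat3_mult_vec [simp]:
  "(mat3 a b c d e f g h i *v v) $ 1 = a * v $ 1 + b * v $ 2 + c * v $ 3"
  "(mat3 a b c d e f g h i *v v) $ 2 = d * v $ 1 + e * v $ 2 + f * v $ 3"
  "(mat3 a b c d e f g h i *v v) $ 3 = g * v $ 1 + h * v $ 2 + i * v $ 3"
  by (simp_all add: mat3_def matrix_vector_mult_def sum_3)

lemma det_mat3 [simp]: "Determinants.det (mat3 a b c d e f g h i) = det3 a b c d e f g h i"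
  by (simp add: mat3_def Determinants.det_3 det3_def algebra_simps)

lemma evalv_lin3 [simp]: "evalv (lin3 A F) v = evalv F (A *v v)"
  by (simp add: lin3_def row3_def matrix_vector_mult_def sum_3 mult.commute)

lemma vec3_eq_iff: "(v :: 'a ^ 3) = w \<longleftrightarrow> v $ 1 = w $ 1 \<and> v $ 2 = w $ 2 \<and> v $ 3 = w $ 3"
  by (simp add: Finite_Cartesian_Product.vec_eq_iff forall_3)

lemma invariant_curve_iff: "invariant_curve G F \<longleftrightarrow> (\<forall>A\<in>G. semi_invariant A F)"
  by (simp add: invariant_curve_def semi_invariant_def)

lemma semi_invariant_mat3:
  "semi_invariant (mat3 a b c d e f g h i) F \<longleftrightarrow> (\<exists>s. s \<noteq> 0 \<and> (\<forall>x y z.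
     eval3 F (a * x + b * y + c * z) (d * x + e * y + f * z) (g * x + h * y + i * z) = s * eval3 F x y z))"
proof -
  have "(\<forall>v :: 'a ^ 3. P (v $ 1) (v $ 2) (v $ 3)) \<longleftrightarrow> (\<forall>x y z. P x y z)" for P :: "'a \<Rightarrow> 'a \<Rightarrow> 'a \<Rightarrow> bool"
    by (metis vector_3)
  from this[of "\<lambda>x y z. eval3 F (a * x + b * y + c * z) (d * x + e * y + f * z)
      (g * x + h * y + i * z) = s * eval3 F x y z" for s]
  show ?thesis unfolding semi_invariant_def mat3_mult_vec by simp
qed

lemma poly_eq_0_cofinite:
  fixes f :: "'a::idom poly"
  assumes "infinite (UNIV :: 'a set)" "finite S" "\<And>t. t \<notin> S \<Longrightarrow> poly f t = 0"
  shows "f = 0"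
proof (rule ccontr)
  assume "f \<noteq> 0"
  hence "finite {t. poly f t = 0}" by (rule poly_roots_finite)
  moreover have "UNIV \<subseteq> S \<union> {t. poly f t = 0}" using assms(3) by blast
  ultimately show False using assms(1,2) by (meson finite_UnI finite_subset)
qed

context dgz_field
begin

abbreviation "G3 \<equiv> PGL3 q :: ('k ^ 3 ^ 3) set"

text \<open>Perspectivities with a rational axis, the axis being the image under B of the line Z = 0.\<close>

definition persp :: "('k ^ 3 ^ 3) set" where
  "persp = {A \<in> G3. \<exists>B\<in>G3. \<forall>v. v $ 3 = 0 \<longrightarrow> A *v (B *v v) = B *v v}"

lemma mat3_in_G3:
  "mat3 a b c d e f g h i \<in> G3 \<longleftrightarrow> {a, b, c, d, e, f, g, h, i} \<subseteq> F1 \<and> det3 a b c d e f g h i \<noteq> 0"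
  by (simp add: PGL3_def forall_3) (simp add: mat3_def)

lemma perspI:
  assumes "mat3 a b c d e f g h i \<in> G3" "mat3 a' b' c' d' e' f' g' h' i' \<in> G3"
    and "\<And>x y. let x' = a' * x + b' * y; y' = d' * x + e' * y; z' = g' * x + h' * y in
        a * x' + b * y' + c * z' = x' \<and> d * x' + e * y' + f * z' = y' \<and> g * x' + h * y' + i * z' = z'"
  shows "mat3 a b c d e f g h i \<in> persp"
  unfolding persp_def using assms
  by (auto intro!: bexI[of _ "mat3 a' b' c' d' e' f' g' h' i'"] simp: vec3_eq_iff Let_def)

text \<open>The axes are Z = 0, X = 0, Z = 0, Y = 0 and X = Y. In each case the auxiliary matrix
  carries Z = 0 to the axis.\<close>

lemma persp_examples:
  shows "c \<in> F1 \<Longrightarrow> c \<noteq> 0 \<Longrightarrow> mat3 1 0 0 0 1 0 0 0 c \<in> persp"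
    and "c \<in> F1 \<Longrightarrow> c \<noteq> 0 \<Longrightarrow> mat3 c 0 0 0 1 0 0 0 1 \<in> persp"
    and "mat3 1 0 1 0 1 0 0 0 1 \<in> persp"
    and "b \<in> F1 \<Longrightarrow> mat3 1 b 0 0 1 0 0 0 1 \<in> persp"
    and "mat3 0 1 0 1 0 0 0 0 1 \<in> persp"
proof -
  show "c \<in> F1 \<Longrightarrow> c \<noteq> 0 \<Longrightarrow> mat3 1 0 0 0 1 0 0 0 c \<in> persp"
    by (rule perspI[where a' = 1 and b' = 0 and c' = 0 and d' = 0 and e' = 1 and f' = 0 and g' = 0 and h' = 0 and i' = 1])
       (auto simp: mat3_in_G3 det3_def Let_def)
  show "c \<in> F1 \<Longrightarrow> c \<noteq> 0 \<Longrightarrow> mat3 c 0 0 0 1 0 0 0 1 \<in> persp"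
    by (rule perspI[where a' = 0 and b' = 0 and c' = 1 and d' = 0 and e' = 1 and f' = 0 and g' = 1 and h' = 0 and i' = 0])
       (auto simp: mat3_in_G3 det3_def Let_def)
  show "mat3 1 0 1 0 1 0 0 0 1 \<in> persp"
    by (rule perspI[where a' = 1 and b' = 0 and c' = 0 and d' = 0 and e' = 1 and f' = 0 and g' = 0 and h' = 0 and i' = 1])
       (auto simp: mat3_in_G3 det3_def Let_def)
  show "b \<in> F1 \<Longrightarrow> mat3 1 b 0 0 1 0 0 0 1 \<in> persp"
    by (rule perspI[where a' = 1 and b' = 0 and c' = 0 and d' = 0 and e' = 0 and f' = 1 and g' = 0 and h' = 1 and i' = 0])
       (auto simp: mat3_in_G3 det3_def Let_def)
  show "mat3 0 1 0 1 0 0 0 0 1 \<in> persp"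
    by (rule perspI[where a' = 1 and b' = 0 and c' = 0 and d' = 1 and e' = 0 and f' = 1 and g' = 0 and h' = 1 and i' = 0])
       (auto simp: mat3_in_G3 det3_def Let_def)
qed

text \<open>Only perspectivities are assumed, because the bound is also applied to a single
  irreducible factor of the first invariant, for which invariance under the whole group is not yet
  known.\<close>

lemma persp_invariant_degree:
  fixes F :: "'k poly3"
  assumes "hom3 F d" "d \<ge> 1" "\<exists>x y. eval3 F x y 0 \<noteq> 0" "\<exists>y z. eval3 F 0 y z \<noteq> 0"
    and inv: "\<And>A. A \<in> persp \<Longrightarrow> semi_invariant A F"
  shows "q ^ 3 - q \<le> d \<or> d = q ^ 3 - q\<^sup>2 \<and>
    (\<exists>c. c \<noteq> 0 \<and> (\<forall>x. eval3 F x 1 0 = c * (\<Prod>w\<in>F2 - F1. x - w) ^ q))"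
proof (rule semi_invariant_degree[OF assms(1-4)])
  show "\<exists>\<kappa>. \<forall>x y z. eval3 F x y (c * z) = \<kappa> * eval3 F x y z" if "c \<in> F1" "c \<noteq> 0" for c
    using inv[OF persp_examples(1)[OF that]] unfolding semi_invariant_mat3 by auto
  show "\<exists>\<kappa>. \<forall>x y z. eval3 F (c * x) y z = \<kappa> * eval3 F x y z" if "c \<in> F1" "c \<noteq> 0" for c
    using inv[OF persp_examples(2)[OF that]] unfolding semi_invariant_mat3 by auto
  show "\<exists>\<kappa>. \<forall>x y z. eval3 F (x + z) y z = \<kappa> * eval3 F x y z"
    using inv[OF persp_examples(3)] unfolding semi_invariant_mat3 by auto
  show "\<exists>\<kappa>. \<kappa> \<noteq> 0 \<and> (\<forall>x y z. eval3 F (x + b * y) y z = \<kappa> * eval3 F x y z)" if "b \<in> F1" for b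
    using inv[OF persp_examples(4)[OF that]] unfolding semi_invariant_mat3 by auto
  show "\<exists>\<kappa>. \<kappa> \<noteq> 0 \<and> (\<forall>x y z. eval3 F y x z = \<kappa> * eval3 F x y z)"
    using inv[OF persp_examples(5)] unfolding semi_invariant_mat3 by auto
qed

section \<open>Uniqueness in degree q^3 - q^2\<close>

lemma invariant_fixes:
  assumes "\<And>A. A \<in> G3 \<Longrightarrow> semi_invariant A F" "mat3 a b c d e f g h i \<in> G3"
    and "a * u + b * v + c * w = u" "d * u + e * v + f * w = v" "g * u + h * v + i * w = w"
    and "eval3 F u v w \<noteq> 0"
  shows "eval3 F (a * x + b * y + c * z) (d * x + e * y + f * z) (g * x + h * y + i * z) = eval3 F x y z"
proof -
  obtain s
    where s: "\<forall>x y z. eval3 F (a * x + b * y + c * z) (d * x + e * y + f * z) (g * x + h * y + i * z)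
      = s * eval3 F x y z"
    using assms(1)[OF assms(2)] unfolding semi_invariant_mat3 by blast
  \<comment> \<open>The scalar is read off at the fixed point, which lies off the curve.\<close>
  have "eval3 F u v w = s * eval3 F u v w" using s[rule_format, of u v w] assms(3-5) by simp
  hence "s = 1" using assms(6) by simp
  thus ?thesis using s by simp
qed

lemma degree_bounds:
  "q ^ 3 - q\<^sup>2 = q\<^sup>2 * (q - 1)" "1 \<le> q ^ 3 - q\<^sup>2" "q ^ 3 - q\<^sup>2 < q ^ 3 - q"
proof -
  obtain r where qr: "q = Suc r" "r \<ge> 1" using q_ge2 by (cases q) auto
  show "q ^ 3 - q\<^sup>2 = q\<^sup>2 * (q - 1)"
    by (simp add: power2_eq_square power3_eq_cube algebra_simps)
  thus "1 \<le> q ^ 3 - q\<^sup>2" using qr by simp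
  have "q ^ 3 - q = (q ^ 3 - q\<^sup>2) + q * r"
    by (simp add: qr(1) power2_eq_square power3_eq_cube algebra_simps)
  moreover have "0 < q * r" using q_pos qr(2) by simp
  ultimately show "q ^ 3 - q\<^sup>2 < q ^ 3 - q" by linarith
qed

text \<open>On Z = 0 the curve has no rational point, so a group element that fixes a rational point
  of this line preserves the form itself and not only up to a scalar. This exactness is what makes a
  difference of two such forms invariant.\<close>

lemma invariant_properties:
  fixes H :: "'k poly3"
  defines "d \<equiv> q ^ 3 - q\<^sup>2"
  assumes H: "hom3 H d" "\<exists>x y. eval3 H x y 0 \<noteq> 0" "\<exists>y z. eval3 H 0 y z \<noteq> 0"
      "\<And>A. A \<in> G3 \<Longrightarrow> semi_invariant A H"
  shows "\<exists>c. c \<noteq> 0 \<and> (\<forall>x. eval3 H x 1 0 = c * (\<Prod>w\<in>F2 - F1. x - w) ^ q)"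
    and "eval3 H x 0 0 = eval3 H 0 x 0"
    and "eval3 H x z y = eval3 H x y z"
    and "a \<in> F1 \<Longrightarrow> b \<in> F1 \<Longrightarrow> eval3 H x y (z + a * x + b * y) = eval3 H x y z"
    and "\<exists>G. \<forall>x y z. eval3 H x y z = eval3 H x y 0 + z ^ (q - 1) * eval3 G x y z"
proof -
  define \<delta> where "\<delta> = (\<lambda>x :: 'k. (\<Prod>w\<in>F2 - F1. x - w) ^ q)"
  have d_pos: "d \<ge> 1" and d_lt: "d < q ^ 3 - q" unfolding d_def by (rule degree_bounds)+
  have "\<And>A. A \<in> persp \<Longrightarrow> semi_invariant A H" using H(4) unfolding persp_def
    by blast
  from persp_invariant_degree[OF H(1) d_pos H(2,3) this] d_lt
  obtain c where c: "c \<noteq> 0" "\<And>x. eval3 H x 1 0 = c * \<delta> x" unfolding \<delta>_def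
    by auto
  have \<delta>: "\<delta> x \<noteq> 0" if "x \<in> F1" for x using that card_F2
    by (auto simp: \<delta>_def)
  have sw: "eval3 H (0 * x + 1 * y + 0 * z) (1 * x + 0 * y + 0 * z) (0 * x + 0 * y + 1 * z) = eval3 H x y z" for x y z
    by (rule invariant_fixes[OF H(4), where u = 1 and v = 1 and w = 0])
       (auto simp: mat3_in_G3 det3_def c \<delta>)
  have swap: "eval3 H x 0 0 = eval3 H 0 x 0" for x using sw[of 0 x 0] by simp
  have rat: "eval3 H x y 0 \<noteq> 0" if "x \<in> F1" "y \<in> F1" "x \<noteq> 0 \<or> y \<noteq> 0" for x y
  proof (cases "y = 0")
    case True
    have "eval3 H x 0 0 = x ^ d * eval3 H 0 1 0" using eval3_scale[OF H(1), of x 0 1 0] swap by simp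
    thus ?thesis using True that c \<delta> by simp
  next
    case False
    have "eval3 H x y 0 = y ^ d * eval3 H (x / y) 1 0"
      using eval3_scale[OF H(1), of y "x / y" 1 0] False by simp
    thus ?thesis using False that c \<delta>[of "x / y"] by simp
  qed
  have r100: "eval3 H 1 0 0 \<noteq> 0" by (rule rat) auto
  have "eval3 H (1 * x + 0 * y + 0 * z) (0 * x + 0 * y + 1 * z) (0 * x + 1 * y + 0 * z) = eval3 H x y z" for x y z
    by (rule invariant_fixes[OF H(4) _ _ _ _ r100]) (auto simp: mat3_in_G3 det3_def)
  hence sw23: "eval3 H x z y = eval3 H x y z" for x y z by simp
  have el: "eval3 H x y (z + a * x + b * y) = eval3 H x y z" if ab: "a \<in> F1" "b \<in> F1" for a b x y z
  proof (cases "a = 0 \<and> b = 0")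
    case False
    \<comment> \<open>(b : -a : 0) is fixed by z -> z + ax + by.\<close>
    have nzb: "eval3 H b (- a) 0 \<noteq> 0" by (rule rat) (use False ab in auto)
    have "eval3 H (1 * x + 0 * y + 0 * z) (0 * x + 1 * y + 0 * z) (a * x + b * y + 1 * z) = eval3 H x y z"
      by (rule invariant_fixes[OF H(4) _ _ _ _ nzb]) (use ab in \<open>auto simp: mat3_in_G3 det3_def\<close>)
    thus ?thesis by (simp add: algebra_simps)
  qed simp
  have tor: "eval3 H x y (c * z) = eval3 H x y z" if "c \<in> F1" "c \<noteq> 0" for c x y z
  proof -
    have "eval3 H (1 * x + 0 * y + 0 * z) (0 * x + 1 * y + 0 * z) (0 * x + 0 * y + c * z) = eval3 H x y z"
      by (rule invariant_fixes[OF H(4) _ _ _ _ r100]) (use that in \<open>auto simp: mat3_in_G3 det3_def\<close>)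
    thus ?thesis by simp
  qed
  obtain G where G: "H - comp3 H varX varY 0 = varZ ^ (q - 1) * G"
    by (rule dvdE[OF torus_imp_varZ_dvd[OF tor]])
  have eG: "eval3 H x y z = eval3 H x y 0 + z ^ (q - 1) * eval3 G x y z" for x y z
  proof -
    have "eval3 (H - comp3 H varX varY 0) x y z = eval3 (varZ ^ (q - 1) * G) x y z"
      by (simp only: G)
    thus ?thesis by (simp add: diff_eq_eq add.commute)
  qed
  show "\<exists>c. c \<noteq> 0 \<and> (\<forall>x. eval3 H x 1 0 = c * (\<Prod>w\<in>F2 - F1. x - w) ^ q)"
    using c unfolding \<delta>_def by blast
  show "\<exists>G. \<forall>x y z. eval3 H x y z = eval3 H x y 0 + z ^ (q - 1) * eval3 G x y z"
    by (intro exI[of _ G] allI) (rule eG)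
  show "eval3 H x 0 0 = eval3 H 0 x 0" by (rule swap)
  show "eval3 H x z y = eval3 H x y z" by (rule sw23)
  show "a \<in> F1 \<Longrightarrow> b \<in> F1 \<Longrightarrow> eval3 H x y (z + a * x + b * y) = eval3 H x y z" by (rule el)
qed

text \<open>A line through (0 : 0 : 1) with slope x outside \<open>F1\<close> meets the q^2 rational
  lines z = ax + by in different points, each a zero of \<open>W\<close> of order at least q - 1.
  These orders add up to d and no more, so a contradiction needs a restriction of degree below d;
  the vanishing of \<open>W\<close> at (0 : 0 : 1) provides it.\<close>

lemma invariant_unique:
  fixes F F' :: "'k poly3"
  defines "d \<equiv> q ^ 3 - q\<^sup>2"
  assumes hom: "hom3 F d" "hom3 F' d"
    and nz: "\<exists>x y. eval3 F x y 0 \<noteq> 0" "\<exists>x y. eval3 F' x y 0 \<noteq> 0"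
    and nz': "\<exists>y z. eval3 F 0 y z \<noteq> 0" "\<exists>y z. eval3 F' 0 y z \<noteq> 0"
    and inv: "\<And>A. A \<in> G3 \<Longrightarrow> semi_invariant A F" "\<And>A. A \<in> G3 \<Longrightarrow> semi_invariant A F'"
  shows "\<exists>c. c \<noteq> 0 \<and> F = const3 c * F'"
proof -
  have d_eq: "d = q\<^sup>2 * (q - 1)" unfolding d_def by (rule degree_bounds)
  note P = invariant_properties[OF hom(1)[unfolded d_def] nz(1) nz'(1) inv(1)]
  note P' = invariant_properties[OF hom(2)[unfolded d_def] nz(2) nz'(2) inv(2)]
  obtain a where a: "a \<noteq> 0" "\<And>x. eval3 F x 1 0 = a * (\<Prod>w\<in>F2 - F1. x - w) ^ q"
    using P(1) by blast
  obtain a'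
    where a': "a' \<noteq> 0" "\<And>x. eval3 F' x 1 0 = a' * (\<Prod>w\<in>F2 - F1. x - w) ^ q"
      using P'(1) by blast
  obtain G where G: "\<forall>x y z. eval3 F x y z = eval3 F x y 0 + z ^ (q - 1) * eval3 G x y z"
    using P(5) ..
  obtain G'
    where G': "\<forall>x y z. eval3 F' x y z = eval3 F' x y 0 + z ^ (q - 1) * eval3 G' x y z"
      using P'(5) ..
  define c where "c = a / a'"
  have c: "c \<noteq> 0" using a(1) a'(1) by (simp add: c_def)
  define W where "W = F - const3 c * F'"
  have homW: "hom3 W d" unfolding hom3_def
  proof (intro allI impI)
    fix i j k assume "coeff3 W i j k \<noteq> 0"
    hence "coeff3 F i j k \<noteq> 0 \<or> coeff3 F' i j k \<noteq> 0" by (auto simp: W_def)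
    thus "i + j + k = d" using hom unfolding hom3_def by blast
  qed
  have W1: "eval3 W x 1 0 = 0" for x using a'(1) by (simp add: W_def a(2) a'(2) c_def)
  have W0: "eval3 W x y 0 = 0" for x y
  proof (cases "y = 0")
    case False
    have "eval3 W x y 0 = y ^ d * eval3 W (x / y) 1 0"
      using eval3_scale[OF homW, of y "x / y" 1 0] False by simp
    thus ?thesis by (simp add: W1)
  next
    case True
    have "eval3 W x 0 0 = eval3 W 0 x 0" by (simp add: W_def P(2)[of x] P'(2)[of x])
    also have "\<dots> = x ^ d * eval3 W 0 1 0" using eval3_scale[OF homW, of x 0 1 0] by simp
    finally show ?thesis using True by (simp add: W1)
  qed
  have W001: "eval3 W 0 0 1 = 0"
  proof -
    have "eval3 F 0 0 1 = eval3 F 0 1 0" "eval3 F' 0 0 1 = eval3 F' 0 1 0"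
      using P(3)[where x = 0 and y = 0 and z = 1] P'(3)[where x = 0 and y = 0 and z = 1] by simp_all
    hence "eval3 W 0 0 1 = eval3 W 0 1 0" by (simp add: W_def)
    thus ?thesis by (simp add: W0)
  qed
  have Wel: "eval3 W x y (z + a * x + b * y) = eval3 W x y z" if "a \<in> F1" "b \<in> F1" for a b x y z
    by (simp add: W_def P(4)[OF _ that] P'(4)[OF _ that])
  have WG: "eval3 W x y z = z ^ (q - 1) * eval3 (G - const3 c * G') x y z" for x y z
  proof -
    have "eval3 W x y z = eval3 W x y 0 + z ^ (q - 1) * eval3 (G - const3 c * G') x y z"
      using G[rule_format, of x y z] G'[rule_format, of x y z] by (simp add: W_def algebra_simps)
    thus ?thesis by (simp add: W0)
  qed
  have key: "eval3 W x 1 z = 0" if x: "x \<notin> F1" for x z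
  proof (rule ccontr)
    assume nzW: "eval3 W x 1 z \<noteq> 0"
    define w where "w = curve3 W [:x:] 1 [:0, 1:]"
    have w: "poly w t = eval3 W x 1 t" for t by (simp add: w_def)
    have w0: "w \<noteq> 0" using nzW w by (metis poly_0)
    have "poly (w - monom 1 (q - 1) * curve3 (G - const3 c * G') [:x:] 1 [:0, 1:]) t = 0" for t
      using WG[of x 1 t] by (simp add: w poly_monom)
    hence "w - monom 1 (q - 1) * curve3 (G - const3 c * G') [:x:] 1 [:0, 1:] = 0"
      by (rule poly_eq_0_if_infinite_zeros[OF infinite_UNIV inj_on_id2])
    hence "monom 1 (q - 1) dvd w" by (metis dvd_triv_left right_minus_eq)
    hence o0: "Polynomial.order 0 w \<ge> q - 1" using monom_1_dvd_iff[OF w0] by blast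
    \<comment> \<open>The invariance z -> z + ax + by carries the order at t = 0 to t = ax +
      b.\<close>
    have ow: "Polynomial.order (a * x + b) w \<ge> q - 1" if ab: "a \<in> F1" "b \<in> F1" for a b
    proof -
      have "poly (pcompose w [:a * x + b, 1:] - w) t = 0" for t
        using Wel[OF ab, of x 1 t] by (simp add: poly_pcompose w algebra_simps)
      hence "pcompose w [:a * x + b, 1:] - w = 0"
        by (rule poly_eq_0_if_infinite_zeros[OF infinite_UNIV inj_on_id2])
      hence "pcompose w [:a * x + b, 1:] = w" by simp
      thus ?thesis using order_pcompose_linear[OF w0, of 1 0 "a * x + b"] o0 by simp
    qed
    let ?f = "\<lambda>(a, b). a * x + b" let ?S = "?f ` (F1 \<times> F1)"
    have "inj_on ?f (F1 \<times> F1)" by (rule inj_on_affine[OF x])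
    hence "card ?S = card (F1 \<times> F1)" by (rule card_image)
    hence cardS: "card ?S = q\<^sup>2" using card_F1
      by (simp add: card_cartesian_product power2_eq_square)
    have "d = (\<Sum>y\<in>?S. q - 1)" unfolding d_eq using cardS by simp
    also have "\<dots> \<le> (\<Sum>y\<in>?S. Polynomial.order y w)"
      by (intro sum_mono) (use ow in auto)
    also have "\<dots> \<le> degree w" by (rule sum_order_le_degree[OF w0]) (use card_F1 in auto)
    finally have ge: "d \<le> degree w" .
    \<comment> \<open>The same line seen from t = infinity: w(t) = t^d r(1/t). So r(0) = W(0, 0, 1)
      is the coefficient of t^d in w, and it is zero.\<close>
    define r where "r = curve3 W [:0, x:] [:0, 1:] 1"
    have r: "poly r t = eval3 W (x * t) t 1" for t by (simp add: r_def mult.commute)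
    have rw: "poly w t = t ^ d * poly r (1 / t)" if "t \<noteq> 0" for t
      using eval3_scale[OF homW, of t "x * (1 / t)" "1 / t" 1] that by (simp add: r w)
    have r0: "r \<noteq> 0"
    proof
      assume "r = 0"
      hence "poly (w * [:0, 1:]) t = 0" for t using rw[of t] by (cases "t = 0") auto
      hence "w * [:0, 1:] = 0" by (rule poly_eq_0_if_infinite_zeros[OF infinite_UNIV inj_on_id2])
      thus False using w0 by simp
    qed
    have "poly ((w * monom 1 (degree r) - monom 1 d * reflect_poly r) * [:0, 1:]) t = 0" for t
      using rw[of t] by (cases "t = 0") (simp_all add: poly_monom poly_reflect_poly_nz field_simps)
    hence "(w * monom 1 (degree r) - monom 1 d * reflect_poly r) * [:0, 1:] = 0"
      by (rule poly_eq_0_if_infinite_zeros[OF infinite_UNIV inj_on_id2])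
    hence eq: "w * monom 1 (degree r) = monom 1 d * reflect_poly r" by simp
    have "degree (w * monom 1 (degree r)) = degree w + degree r"
      using w0 by (subst degree_mult_eq) (auto simp: degree_monom_eq)
    moreover have "degree (monom 1 d * reflect_poly r) = d + degree (reflect_poly r)"
      using r0 by (subst degree_mult_eq) (auto simp: degree_monom_eq)
    ultimately have "degree r \<le> degree (reflect_poly r)" using eq ge by simp
    moreover have "degree (reflect_poly r) < degree r"
    proof -
      have pr0: "coeff r 0 = 0" using W001 r[of 0] by (simp add: poly_0_coeff_0)
      have "degree r \<noteq> 0" 
      proof
        assume "degree r = 0"
        then obtain k where "r = [:k:]" by (rule degree_eq_zeroE)
        thus False using pr0 r0 by simp
      qed
      have "degree (reflect_poly r) \<le> degree r" by (rule degree_reflect_poly_le)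
      moreover have "coeff (reflect_poly r) (degree r) = 0" using pr0
        by (simp add: coeff_reflect_poly)
      ultimately show ?thesis using \<open>degree r \<noteq> 0\<close>
        by (metis degree_0 le_neq_implies_less leading_coeff_0_iff gr0I)
    qed
    ultimately show False by simp
  qed
  have all1: "eval3 W x 1 z = 0" for x z
  proof -
    have "curve3 W [:0, 1:] 1 [:z:] = 0"
      by (rule poly_eq_0_cofinite[OF infinite_UNIV card_F1(2)]) (simp add: key)
    hence "poly (curve3 W [:0, 1:] 1 [:z:]) x = 0" by (simp only: poly_0)
    thus ?thesis by simp
  qed
  have ne: "eval3 W x y z = 0" if "y \<noteq> 0" for x y z
    using eval3_scale[OF homW, of y "x / y" 1 "z / y"] that by (simp add: all1)
  have "eval3 W x y z = 0" for x y z
  proof -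
    have "curve3 W [:x:] [:0, 1:] [:z:] = 0"
      by (rule poly_eq_0_cofinite[OF infinite_UNIV, of "{0}"]) (simp_all add: ne)
    hence "poly (curve3 W [:x:] [:0, 1:] [:z:]) y = 0" by (simp only: poly_0)
    thus ?thesis by simp
  qed
  hence "W = 0" by (rule poly3_eq_0I[OF infinite_UNIV])
  thus ?thesis using c unfolding W_def by (intro exI[of _ c]) simp
qed

end

section \<open>The first Dickson invariant\<close>

lemma hom3_var [simp]:
  "hom3 (varX :: 'k::comm_ring_1 poly3) 1" "hom3 (varY :: 'k poly3) 1" "hom3 (varZ :: 'k poly3) 1"
proof -
  have "varX = (mono3 1 1 0 0 :: 'k poly3)" "varY = (mono3 1 0 1 0 :: 'k poly3)" "varZ = (mono3 1 0 0 1 :: 'k poly3)"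
    by (simp_all add: mono3_def varX_def varY_def varZ_def monom_Suc monom_0)
  note v = this
  show "hom3 (varX :: 'k poly3) 1" "hom3 (varY :: 'k poly3) 1" "hom3 (varZ :: 'k poly3) 1"
    unfolding hom3_def v coeff3_mono3 by simp_all
qed

lemma hom3_0 [simp]: "hom3 0 d" by (simp add: hom3_def)

lemma coeff3_const3: "coeff3 (const3 c) i j k = (if i = 0 \<and> j = 0 \<and> k = 0 then c else 0)"
  by (simp add: coeff3_def const3_def coeff_pCons split: nat.splits)

lemma hom3_const3 [simp]: "hom3 (const3 c) 0"
  by (simp add: hom3_def coeff3_const3)

lemma hom3_1: "hom3 (1 :: 'k::comm_ring_1 poly3) 0"
  using hom3_const3[of "1 :: 'k"] by (simp add: const3_def pCons_one)

lemma hom3_add: "hom3 F d \<Longrightarrow> hom3 G d \<Longrightarrow> hom3 (F + G) d" for F G :: "'k::comm_ring_1 poly3"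
  unfolding hom3_def coeff3_add by (metis add.right_neutral)

lemma hom3_diff: "hom3 F d \<Longrightarrow> hom3 G d \<Longrightarrow> hom3 (F - G) d" for F G :: "'k::comm_ring_1 poly3"
  unfolding hom3_def coeff3_diff by (metis diff_zero)

lemma hom3_power: "hom3 F d \<Longrightarrow> hom3 (F ^ m) (m * d)" for F :: "'k::comm_ring_1 poly3"
proof (induction m)
  case 0 show ?case using hom3_1 by simp
next
  case (Suc m) thus ?case using hom3_mult[of F d "F ^ m" "m * d"] by simp
qed

lemma hom3_sum: "(\<And>i. i \<in> A \<Longrightarrow> hom3 (F i) d) \<Longrightarrow> hom3 (sum F A) d"
  for F :: "'i \<Rightarrow> 'k::comm_ring_1 poly3"
  by (induction A rule: infinite_finite_induct) (auto intro: hom3_add)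

lemma hom3_0_imp_const:
  fixes F :: "'k::comm_ring_1 poly3"
  assumes "hom3 F 0"
  obtains c where "F = const3 c"
proof -
  have "F = const3 (coeff3 F 0 0 0)"
  proof (rule poly3_eqI)
    fix i j k
    show "coeff3 F i j k = coeff3 (const3 (coeff3 F 0 0 0)) i j k"
      using assms by (cases "coeff3 F i j k = 0") (auto simp: hom3_def coeff3_const3)
  qed
  thus thesis by (rule that)
qed

lemma hom3_0_unit:
  fixes F :: "'k::field poly3"
  assumes "hom3 F 0" "F \<noteq> 0"
  shows "F dvd 1"
proof -
  obtain c where c: "F = const3 c" using hom3_0_imp_const[OF assms(1)] .
  hence "c \<noteq> 0" using assms(2) by (auto simp: const3_def)
  hence "F * const3 (inverse c) = 1" unfolding c by (simp add: const3_def pCons_one)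
  thus ?thesis by (metis dvd_triv_left)
qed

lemma unit_imp_hom3_0:
  fixes F :: "'k::field poly3"
  assumes "F dvd 1"
  shows "hom3 F 0"
proof -
  obtain G where "1 = F * G" using assms by (rule dvdE)
  then obtain a b where "hom3 F a" "a + b = 0" using hom3_factor[OF hom3_1 one_neq_zero] by metis
  thus ?thesis by simp
qed

context dgz_field
begin

lemma hom3I_eval:
  fixes F :: "'k poly3"
  assumes "\<And>t x y z. eval3 F (t * x) (t * y) (t * z) = t ^ d * eval3 F x y z"
  shows "hom3 F d"
proof -
  have "coeff (grade3 F) m = 0" if "m \<noteq> d" for m
  proof (rule poly3_eq_0I[OF infinite_UNIV])
    fix x y z :: 'k
    let ?P = "map_poly (\<lambda>G. eval3 G x y z) (grade3 F)"
    have "poly (?P - monom (eval3 F x y z) d) t = 0" for t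
    proof -
      let ?\<phi> = "\<lambda>P. poly (map_poly (\<lambda>G. eval3 G x y z) P) t"
      have "comm_ring_hom ?\<phi>" by (intro ev_hom comm_ring_hom_eval3)
      hence "?\<phi> (grade3 F) = eval3 F (?\<phi> (monom varX 1)) (?\<phi> (monom varY 1)) (?\<phi> (monom varZ 1))"
        unfolding grade3_def
        by (rule hom_eq_eval3[OF comm_ring_hom_const3']) (simp add: map_poly_const_poly)
      thus ?thesis using assms[of t x y z] by (simp add: map_poly_monom poly_monom mult.commute)
    qed
    hence "?P - monom (eval3 F x y z) d = 0"
      by (rule poly_eq_0_if_infinite_zeros[OF infinite_UNIV inj_on_id2])
    hence "coeff ?P m = coeff (monom (eval3 F x y z) d) m" by simp
    thus "eval3 (coeff (grade3 F) m) x y z = 0" using that by (simp add: coeff_map_poly)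
  qed
  thus ?thesis unfolding hom3_def by (metis coeff3_0 coeff3_grade3)
qed

lemma hom3_lin3:
  fixes F :: "'k poly3"
  assumes "hom3 F d"
  shows "hom3 (lin3 A F) d"
proof (rule hom3I_eval)
  fix t x y z
  have "evalv F (A *v vector [t * x, t * y, t * z]) = evalv F (t *s (A *v vector [x, y, z]))"
    by (simp add: matrix_vector_mult_def sum_3 algebra_simps)
  also have "\<dots> = t ^ d * evalv F (A *v vector [x, y, z])"
    using eval3_scale[OF assms] by simp
  finally show "eval3 (lin3 A F) (t * x) (t * y) (t * z) = t ^ d * eval3 (lin3 A F) x y z"
    using evalv_lin3[of A F "vector [t * x, t * y, t * z]"] evalv_lin3[of A F "vector [x, y, z]"]
      by simp
qed

lemma form_zero_on_line:
  fixes G :: "'k poly3"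
  assumes "hom3 G a" "a \<ge> 1"
  shows "\<exists>s t. (s \<noteq> 0 \<or> t \<noteq> 0) \<and> eval3 G (s * u1 + t * v1) (s * u2 + t * v2) (s * u3 + t * v3) = 0"
proof (cases "eval3 G u1 u2 u3 = 0")
  case True
  thus ?thesis by (intro exI[of _ 1] exI[of _ 0]) simp
next
  case False
  let ?h = "curve3 G [:v1, u1:] [:v2, u2:] [:v3, u3:]"
  show ?thesis
  proof (cases "degree ?h = 0")
    case False
    then obtain s where "poly ?h s = 0" using alg_closed by blast
    thus ?thesis by (intro exI[of _ s] exI[of _ 1]) (simp add: add.commute)
  next
    case True
    then obtain c where c: "?h = [:c:]" by (rule degree_eq_zeroE)
    \<comment> \<open>If one affine chart of the line shows the constant c, then in the other chart
      the form is c t^a, which vanishes at t = 0, that is at u.\<close>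
    let ?k = "curve3 G [:u1, v1:] [:u2, v2:] [:u3, v3:] - monom c a"
    have "poly (?k * [:0, 1:]) t = 0" for t
    proof (cases "t = 0")
      case False
      have "eval3 G (u1 + t * v1) (u2 + t * v2) (u3 + t * v3)
          = t ^ a * eval3 G (v1 + 1 / t * u1) (v2 + 1 / t * u2) (v3 + 1 / t * u3)"
        using eval3_scale[OF assms(1), of t "v1 + 1 / t * u1" "v2 + 1 / t * u2" "v3 + 1 / t * u3"] False
        by (simp add: algebra_simps)
      also have "eval3 G (v1 + 1 / t * u1) (v2 + 1 / t * u2) (v3 + 1 / t * u3) = poly ?h (1 / t)"
        by simp
      also have "\<dots> = c" unfolding c by simp
      finally show ?thesis by (simp add: poly_monom)
    qed simp
    hence "?k * [:0, 1:] = 0" by (rule poly_eq_0_if_infinite_zeros[OF infinite_UNIV inj_on_id2])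
    hence "?k = 0" by simp
    hence "poly ?k 0 = 0" by (simp only: poly_0)
    hence "eval3 G u1 u2 u3 = 0" using assms(2) by (simp add: poly_monom)
    thus ?thesis using False by simp
  qed
qed

section \<open>The Dickson invariants as forms: degree, special values, invariance\<close>

definition C1 :: "'k poly3" where "C1 = dick1 q varX varY varZ"
definition C2 :: "'k poly3" where "C2 = dick2 q varX varY varZ"

lemma eval3_C1 [simp]: "eval3 C1 x y z = dick1 q x y z"
  and eval3_C2 [simp]: "eval3 C2 x y z = dick2 q x y z"
proof -
  interpret comm_ring_hom "\<lambda>F :: 'k poly3. eval3 F x y z" by (rule comm_ring_hom_eval3)
  show "eval3 C1 x y z = dick1 q x y z" "eval3 C2 x y z = dick2 q x y z"
    unfolding C1_def C2_def hom_dick1 hom_dick2 by simp_all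
qed

lemma hom3_C: "hom3 C1 (q ^ 3 - q\<^sup>2)" "hom3 C2 (q ^ 3 - q)"
proof -
  obtain r where qr: "q = Suc r" using q_ge2 by (cases q) auto
  hence q1: "q - 1 = r" by simp
  have A: "hom3 (dA q varX varY :: 'k poly3) (q * r)" unfolding dA_def
  proof (rule hom3_sum)
    fix i assume "i \<in> {..<Suc q}"
    hence e: "i * (r * 1) + (q - i) * (r * 1) = q * r"
      by (simp only: add_mult_distrib [symmetric] mult_1_right) simp
    have "hom3 ((varX ^ r) ^ i * (varY ^ r) ^ (q - i) :: 'k poly3) (i * (r * 1) + (q - i) * (r * 1))"
      by (intro hom3_mult hom3_power hom3_var)
    thus "hom3 ((varX ^ (q - 1)) ^ i * (varY ^ (q - 1)) ^ (q - i) :: 'k poly3) (q * r)"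
      unfolding e q1 .
  qed
  have L: "hom3 (dL2 q varX varY :: 'k poly3) (q + 1)"
  proof -
    have "hom3 (varX * varY ^ q :: 'k poly3) (1 + q * 1)" "hom3 (varX ^ q * varY :: 'k poly3) (q * 1 + 1)"
      by (intro hom3_mult hom3_power hom3_var)+
    thus ?thesis unfolding dL2_def by (simp add: hom3_diff)
  qed
  have Lr: "hom3 (dL2 q varX varY ^ r :: 'k poly3) (r * (q + 1))" by (intro hom3_power L)
  have N: "hom3 (dN q varX varY varZ :: 'k poly3) (q * q)"
  proof -
    have "hom3 ((varZ ^ q) ^ q :: 'k poly3) (q * (q * 1))" by (intro hom3_power hom3_var)
    moreover have "hom3 (dA q varX varY * varZ ^ q :: 'k poly3) (q * r + q * 1)"
      by (intro hom3_mult hom3_power hom3_var A)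
    moreover have "hom3 (dL2 q varX varY ^ r * varZ :: 'k poly3) (r * (q + 1) + 1)"
      by (intro hom3_mult hom3_var Lr)
    moreover have "q * r + q * 1 = q * q" "r * (q + 1) + 1 = q * q" "q - 1 = r"
      by (simp_all add: qr)
    ultimately show ?thesis unfolding dN_def by (simp add: hom3_add hom3_diff)
  qed
  have Nr: "hom3 (dN q varX varY varZ ^ r :: 'k poly3) (r * (q * q))" by (intro hom3_power N)
  have d1: "q ^ 3 - q\<^sup>2 = q * (q * r)" "r * (q * q) = q * (q * r)"
    by (simp_all add: qr power2_eq_square power3_eq_cube algebra_simps)
  show "hom3 C1 (q ^ 3 - q\<^sup>2)" unfolding C1_def dick1_def d1(1) q1
    by (rule hom3_add[OF hom3_power[OF A] Nr[unfolded d1(2)]])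
  have d2: "q ^ 3 - q = q * (r * (q + 1))" "q * r + r * (q * q) = q * (r * (q + 1))"
    by (simp_all add: qr power2_eq_square power3_eq_cube algebra_simps)
  show "hom3 C2 (q ^ 3 - q)" unfolding C2_def dick2_def d2(1) q1
    by (rule hom3_add[OF hom3_power[OF Lr] hom3_mult[OF A Nr, unfolded d2(2)]])
qed

lemma dA_0_left: "dA q 0 y = (y :: 'k) ^ ((q - 1) * q)"
proof -
  have "dA q 0 y = (\<Sum>i<Suc q. if i = 0 then (y ^ (q - 1)) ^ q else 0)"
    unfolding dA_def using q_ge2 by (intro sum.cong) (auto simp: zero_power power_0_left)
  thus ?thesis by (simp add: power_mult)
qed

lemma dick1_line [simp]: "dick1 q x y 0 = dA q x (y :: 'k) ^ q"
  using q_ge2 by (simp add: dick1_def dN_def zero_power)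

lemma dick1_010: "dick1 q 0 1 0 = (1 :: 'k)"
  by (simp add: dA_0_left)

text \<open>For nonzero w all q + 1 summands are 1, and q + 1 = 1 in characteristic p; for w = 0 a
  single summand survives.\<close>

lemma dA_F1:
  assumes w: "w \<in> F1"
  shows "dA q 1 w = 1"
proof (cases "w = 0")
  case True
  have "dA q 1 w = (\<Sum>i<Suc q. if i = q then 1 else 0)"
    unfolding dA_def using q_ge2 True by (intro sum.cong) (auto simp: zero_power power_0_left)
  thus ?thesis by simp
next
  case False
  have "w ^ (q - 1) * w = w" using power_q_m1[of w] w by (simp add: F1_iff)
  hence "w ^ (q - 1) = 1" using False by simp
  hence "dA q 1 w = of_nat q + 1" unfolding dA_def by simp
  moreover have "of_nat q = (0 :: 'k)"
    unfolding of_nat_eq_0_iff_char_dvd char q using n by simp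
  ultimately show ?thesis by simp
qed

lemma dA_zero:
  assumes "dA q 1 w = (0 :: 'k)"
  shows "w \<in> F2 - F1"
proof -
  have "dA q 1 w * dL2 q 1 w = 1 * (w ^ q) ^ q - (1 ^ q) ^ q * w" by (rule dA_dL2[OF q_ge1])
  hence "w \<in> F2" using assms by (simp add: F2_iff)
  moreover have "w \<notin> F1" using assms dA_F1 by force
  ultimately show ?thesis by simp
qed

text \<open>For x outside \<open>F1\<close> the determinant is the nonzero factor
  \<open>dL2 q x 1\<close> times a polynomial in z with leading term z^(q^2).\<close>

lemma moore_point: "\<exists>x z :: 'k. moore012 q x 1 z \<noteq> 0"
proof (rule ccontr)
  assume *: "\<not> ?thesis"
  have "F1 \<noteq> UNIV" using card_F1(2) infinite_UNIV by metis
  then obtain x where x: "x \<notin> F1" by blast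
  have "dL2 q x 1 \<noteq> 0" using x by (simp add: dL2_def F1_iff)
  moreover have "moore012 q x 1 z = 0" for z using * by blast
  ultimately have "dN q x 1 z = 0" for z unfolding moore012_eq by simp
  hence "poly (monom 1 (q * q) - smult (dA q x 1) (monom 1 q) + smult (dL2 q x 1 ^ (q - 1)) (monom 1 1)) z = 0" for z
    by (simp add: dN_def poly_monom power_mult)
  hence "monom 1 (q * q) - smult (dA q x 1) (monom 1 q) + smult (dL2 q x 1 ^ (q - 1)) (monom 1 1) = 0"
    by (rule poly_eq_0_if_infinite_zeros[OF infinite_UNIV inj_on_id2])
  hence "coeff (monom 1 (q * q) - smult (dA q x 1) (monom 1 q) + smult (dL2 q x 1 ^ (q - 1)) (monom 1 1)) (q * q) = 0"
    by simp
  moreover have "q * q \<noteq> q" "q * q \<noteq> 1" using q_ge2 by auto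
  ultimately show False by simp
qed

lemma eval3_moore012: "eval3 (moore012 q varX varY varZ :: 'k poly3) x y z = moore012 q x y z"
  by (simp add: moore012_def det3_def)

lemma moore_neq_0: "moore012 q varX varY varZ \<noteq> (0 :: 'k poly3)"
proof
  assume "moore012 q varX varY varZ = (0 :: 'k poly3)"
  hence "moore012 q x y z = 0" for x y z :: 'k using eval3_moore012[of x y z] by simp
  thus False using moore_point by blast
qed

text \<open>\<open>dick_linear\<close> is applied in the polynomial ring to the variables, whose
  Moore determinant is nonzero. This also covers the points where the determinant vanishes.\<close>

lemma lin3_C:
  assumes "A \<in> G3"
  shows "lin3 A C1 = C1" "lin3 A C2 = C2"
proof -
  interpret comm_ring_hom "lin3 A" unfolding lin3_def
    by (rule comm_ring_hom_sub3[OF comm_ring_hom_const3])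
  interpret C: comm_ring_hom "const3 :: 'k \<Rightarrow> _" by (rule comm_ring_hom_const3)
  have v: "lin3 A varX = row3 A 1" "lin3 A varY = row3 A 2" "lin3 A varZ = row3 A 3"
    by (simp_all add: lin3_def sub3_var comm_ring_hom_const3)
  have F: "const3 (A $ i $ j) ^ q = const3 (A $ i $ j)" for i j
    using assms by (simp add: PGL3_def F1_iff C.hom_power [symmetric])
  have "det3 (A $ 1 $ 1) (A $ 1 $ 2) (A $ 1 $ 3) (A $ 2 $ 1) (A $ 2 $ 2) (A $ 2 $ 3) (A $ 3 $ 1) (A $ 3 $ 2) (A $ 3 $ 3) \<noteq> 0"
    using assms by (simp add: PGL3_def Determinants.det_3 det3_def algebra_simps)
  moreover have "det3 (const3 a) (const3 b) (const3 c) (const3 d) (const3 e) (const3 f) (const3 g) (const3 h) (const3 i)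
    = const3 (det3 a b c d e f g h i)" for a b c d e f g h i :: 'k
    by (simp add: det3_def C.hom_add C.hom_minus C.hom_mult)
  moreover have "const3 a \<noteq> 0" if "a \<noteq> 0" for a :: 'k using that
    by (simp add: const3_def)
  ultimately have D: "det3 (const3 (A $ 1 $ 1)) (const3 (A $ 1 $ 2)) (const3 (A $ 1 $ 3)) (const3 (A $ 2 $ 1)) (const3 (A $ 2 $ 2)) 
     (const3 (A $ 2 $ 3)) (const3 (A $ 3 $ 1)) (const3 (A $ 3 $ 2)) (const3 (A $ 3 $ 3)) \<noteq> 0" by simp
  show "lin3 A C1 = C1" "lin3 A C2 = C2"
    unfolding C1_def C2_def hom_dick1 hom_dick2 v row3_def
    by (rule P3.dick_linear[OF F F F F F F F F F D moore_neq_0])+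
qed

lemma invariant_C: "A \<in> G3 \<Longrightarrow> semi_invariant A C1" "A \<in> G3 \<Longrightarrow> semi_invariant A C2"
proof -
  assume A: "A \<in> G3"
  have "evalv C1 (A *v v) = 1 * evalv C1 v" "evalv C2 (A *v v) = 1 * evalv C2 v" for v
    using evalv_lin3[of A C1 v] evalv_lin3[of A C2 v] lin3_C[OF A] by simp_all
  thus "semi_invariant A C1" "semi_invariant A C2" unfolding semi_invariant_def
    using zero_neq_one by metis+
qed

end

section \<open>Local factorisation and irreducibility of the first invariant\<close>

lemma split_order_0:
  fixes f :: "'a::idom poly"
  assumes "f \<noteq> 0"
  obtains m g where "f = monom 1 m * g" "coeff g 0 = coeff f m" "coeff g 0 \<noteq> 0"
proof -
  let ?m = "Polynomial.order 0 f"
  obtain g where g: "f = monom 1 ?m * g" using monom_1_dvd_iff[OF assms] by (meson dvdE order_refl)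
  have "coeff f ?m = coeff g 0" by (subst g) (simp add: coeff_monom_mult)
  moreover have "coeff f ?m \<noteq> 0" by (rule coeff_order_0_neq_0[OF assms])
  ultimately show thesis using that[OF g] by simp
qed

lemma comm_ring_hom_const2: "comm_ring_hom (\<lambda>k::'k::comm_ring_1. [:[:k:]:])"
  by unfold_locales (auto simp: pCons_one)

context dgz_field
begin

text \<open>At a point of the form (1 : w : 0), put y = w + t and z = l t. The lowest order in t of the
  first Dickson invariant is q - 1, with coefficient a multiple of l ^ (q - 1); on the line z = 0
  the order is q. If two factors of orders a and b vanished there, their lowest coefficients would
  be multiples of l ^ a and l ^ b, so both would gain order on z = 0, giving at least q + 1.\<close>

lemma C1_factors_local:
  fixes G H :: "'k poly3"
  assumes GH: "C1 = G * H" and w: "w \<in> F2 - F1" and zG: "eval3 G 1 w 0 = 0" and zH: "eval3 H 1 w 0 = 0"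
  shows False
proof -
  \<comment> \<open>The outer variable is t, the inner one l.\<close>
  define Y :: "'k poly poly" where "Y = [:[:w:], 1:]"
  define Z :: "'k poly poly" where "Z = [:0, [:0, 1:]:]"
  define \<psi> where "\<psi> = sub3 (\<lambda>k::'k. [:[:k:]:]) 1 Y Z"
  interpret \<psi>: comm_ring_hom \<psi> unfolding \<psi>_def
    by (rule comm_ring_hom_sub3[OF comm_ring_hom_const2])
  have v: "\<psi> varX = 1" "\<psi> varY = Y" "\<psi> varZ = Z" "\<psi> (const3 k) = [:[:k:]:]" for k
    unfolding \<psi>_def by (simp_all add: sub3_var comm_ring_hom_const2)
  \<comment> \<open>Every l comes with a t.\<close>
  have deg: "degree (coeff (\<psi> F) m) \<le> m" for F m
  proof (induction F arbitrary: m rule: poly3_induct)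
    case (add F G)
    thus ?case unfolding \<psi>.hom_add coeff_add by (intro degree_add_le)
  next
    case (mult F G)
    show ?case unfolding \<psi>.hom_mult coeff_mult
    proof (rule degree_sum_le)
      fix i assume "i \<in> {..m}"
      hence "degree (coeff (\<psi> F) i) + degree (coeff (\<psi> G) (m - i)) \<le> m"
        using add_mono[OF mult(1)[of i] mult(2)[of "m - i"]] by simp
      thus "degree (coeff (\<psi> F) i * coeff (\<psi> G) (m - i)) \<le> m"
        using degree_mult_le le_trans by blast
    qed simp
  qed (simp_all add: v Y_def Z_def coeff_pCons split: nat.split)
  have ev: "poly (coeff (\<psi> F) 0) l = eval3 F 1 w 0" for F l
  proof -
    let ?\<phi> = "\<lambda>P :: 'k poly poly. poly (coeff P 0) l"
    have "comm_ring_hom ?\<phi>" by unfold_locales (simp_all add: coeff_mult_0)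
    hence "?\<phi> (\<psi> F) = eval3 F (?\<phi> 1) (?\<phi> Y) (?\<phi> Z)" unfolding \<psi>_def
      by (rule hom_eq_eval3[OF comm_ring_hom_const2]) simp
    thus ?thesis by (simp add: Y_def Z_def)
  qed
  have q1: "q - 1 > 0" using q_ge2 by simp
  define a where "a = dA q (1 :: 'k poly poly) Y"
  define L where "L = dL2 q (1 :: 'k poly poly) Y"
  define M where "M = Z ^ (q * q - 1) - a * Z ^ (q - 1) + L ^ (q - 1)"
  define \<Lambda> :: "'k poly poly" where "\<Lambda> = [:[:0, 1:]:]"
  have Z: "Z = monom 1 1 * \<Lambda>" by (simp add: Z_def \<Lambda>_def monom_Suc monom_0)
  interpret c0: comm_ring_hom "\<lambda>P :: 'k poly poly. coeff P 0"
    by unfold_locales (simp_all add: coeff_mult_0)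
  have w2: "(w ^ q) ^ q = w" "w ^ q \<noteq> w" using w by (auto simp: F1_iff F2_iff)
  have L0: "coeff L 0 = [:w ^ q - w:]"
    unfolding L_def c0.hom_dL2 by (simp add: Y_def dL2_def poly_const_pow)
  \<comment> \<open>Because w^(q^2) = w, the product is t^(q^2) - t. As L has the nonzero constant
    term w^q - w, the factor a has a simple zero at t = 0.\<close>
  have aL: "a * L = monom 1 1 * (monom 1 (q * q - 1) - 1)"
  proof -
    have "a * L = 1 * (Y ^ q) ^ q - (1 ^ q) ^ q * Y" unfolding a_def L_def
      by (rule dA_dL2[OF q_ge1])
    also have "Y = [:[:w:]:] + monom 1 1" by (simp add: Y_def monom_Suc monom_0)
    also have "(([:[:w:]:] + monom 1 1 :: 'k poly poly) ^ q) ^ q = [:[:w:]:] + monom 1 (q * q)"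
    proof -
      interpret c2: comm_ring_hom "\<lambda>k::'k. [:[:k:]:]" by (rule comm_ring_hom_const2)
      have "([:[:w:]:] ^ q) ^ q = ([:[:(w ^ q) ^ q:]:] :: 'k poly poly)"
        by (simp only: c2.hom_power)
      thus ?thesis by (simp add: w2 monom_power)
    qed
    also have "monom 1 (q * q) = monom 1 1 * (monom 1 (q * q - 1) :: 'k poly poly)"
      using q_ge2 by (simp add: mult_monom)
    finally show ?thesis by (simp add: algebra_simps)
  qed
  have "coeff (a * L) 0 = 0" unfolding aL by (simp add: coeff_mult_0)
  hence "coeff a 0 = 0" using L0 w2 by (simp add: coeff_mult_0)
  hence "monom 1 1 dvd a" by (simp add: monom_1_dvd_iff')
  then obtain a' where a': "a = monom 1 1 * a'" by (rule dvdE)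
  have "monom 1 1 * (a' * L) = monom 1 1 * (monom 1 (q * q - 1) - 1)" using aL unfolding a'
    by (simp only: mult.assoc)
  hence "a' * L = monom 1 (q * q - 1) - 1" by simp
  hence "coeff (a' * L) 0 = coeff (monom 1 (q * q - 1) - 1) 0" by (rule arg_cong)
  moreover have "q * q - 1 \<noteq> 0" using q_ge2 by (cases q) auto
  ultimately have "coeff a' 0 * coeff L 0 = - 1" by (simp add: coeff_mult_0)
  hence a'0: "poly (coeff a' 0) 0 \<noteq> 0"
    by (metis poly_mult poly_1 poly_minus mult_zero_left neg_equal_0_iff_equal zero_neq_one)
  have N: "dN q 1 Y Z = Z * M"
  proof -
    have "Z * M = Z ^ (q * q - 1) * Z - a * (Z ^ (q - 1) * Z) + L ^ (q - 1) * Z"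
      by (simp add: M_def algebra_simps)
    also have "Z ^ (q * q - 1) * Z = (Z ^ q) ^ q"
      using q_ge2 by (simp flip: power_mult power_Suc2)
    also have "Z ^ (q - 1) * Z = Z ^ q" by (rule P2.power_q_m1)
    finally show ?thesis unfolding dN_def a_def L_def by simp
  qed
  define Q where "Q = monom 1 1 * a' ^ q + \<Lambda> ^ (q - 1) * M ^ (q - 1)"
  have \<psi>C: "\<psi> C1 = monom 1 (q - 1) * Q"
  proof -
    have "\<psi> C1 = a ^ q + (Z * M) ^ (q - 1)"
      unfolding C1_def \<psi>.hom_dick1 v unfolding dick1_def N a_def [symmetric] ..
    also have "a ^ q = monom 1 (q - 1) * (monom 1 1 * a' ^ q)"
      unfolding a' power_mult_distrib monom_power using q_ge2
        by (simp add: mult_monom flip: mult.assoc)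
    also have "(Z * M) ^ (q - 1) = monom 1 (q - 1) * (\<Lambda> ^ (q - 1) * M ^ (q - 1))"
      unfolding Z power_mult_distrib monom_power by (simp add: mult.assoc)
    finally show ?thesis unfolding Q_def by (simp only: distrib_left)
  qed
  have M0: "coeff M 0 = [:w ^ q - w:] ^ (q - 1)"
    unfolding M_def c0.hom_add c0.hom_minus c0.hom_mult c0.hom_power L0
    using q1 \<open>q * q - 1 \<noteq> 0\<close> by (simp add: Z_def zero_power)
  define u0 where "u0 = ((w ^ q - w) ^ (q - 1)) ^ (q - 1)"
  have u0: "u0 \<noteq> 0" using w2 by (simp add: u0_def)
  have Q0: "coeff Q 0 = monom u0 (q - 1)"
    unfolding Q_def c0.hom_add c0.hom_mult c0.hom_power M0
    by (simp add: \<Lambda>_def u0_def poly_const_pow monom_altdef)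
  \<comment> \<open>For l = 0, that is on the line z = 0, only t a'^q is left, so the order there is
    exactly q.\<close>
  have Q1: "poly (coeff Q 1) 0 \<noteq> 0"
  proof -
    have \<Lambda>: "\<Lambda> ^ (q - 1) = [:[:0, 1:] ^ (q - 1):]"
      by (simp add: \<Lambda>_def poly_const_pow)
    have "coeff Q 1 = coeff (a' ^ q) 0 + [:0, 1:] ^ (q - 1) * coeff (M ^ (q - 1)) 1"
      unfolding Q_def \<Lambda> by (simp add: coeff_monom_mult)
    also have "coeff (a' ^ q) 0 = coeff a' 0 ^ q" by (rule c0.hom_power)
    finally show ?thesis using a'0 q1 by (simp add: poly_power zero_power)
  qed
  have "Q \<noteq> 0" using Q0 u0 by auto
  hence "\<psi> C1 \<noteq> 0" unfolding \<psi>C by simp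
  hence nz: "\<psi> G \<noteq> 0" "\<psi> H \<noteq> 0" unfolding GH \<psi>.hom_mult by auto
  obtain i \<gamma>
    where G: "\<psi> G = monom 1 i * \<gamma>" "coeff \<gamma> 0 = coeff (\<psi> G) i" "coeff \<gamma> 0 \<noteq> 0"
    using split_order_0[OF nz(1)] .
  obtain j \<eta>
    where H: "\<psi> H = monom 1 j * \<eta>" "coeff \<eta> 0 = coeff (\<psi> H) j" "coeff \<eta> 0 \<noteq> 0"
    using split_order_0[OF nz(2)] .
  have pos: "i > 0" "j > 0"
  proof -
    have "coeff (\<psi> G) 0 = 0" "coeff (\<psi> H) 0 = 0"
      using ev[of G] ev[of H] zG zH
      by (auto intro!: poly_eq_0_if_infinite_zeros[OF infinite_UNIV inj_on_id2])
    thus "i > 0" "j > 0" using G H by (auto intro!: gr0I)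
  qed
  have eq: "monom 1 (i + j) * (\<gamma> * \<eta>) = monom 1 (q - 1) * Q"
  proof -
    have "monom 1 (i + j) = monom 1 i * (monom 1 j :: 'k poly poly)" by (simp add: mult_monom)
    thus ?thesis using \<psi>C unfolding GH \<psi>.hom_mult G(1) H(1) by (simp only: mult_ac)
  qed
  have c0ge: "coeff (\<gamma> * \<eta>) 0 \<noteq> 0" "coeff Q 0 \<noteq> 0" using G(3) H(3) Q0 u0
    by (simp_all add: coeff_mult_0)
  have ij: "i + j = q - 1"
  proof -
    have o: "Polynomial.order 0 (monom 1 m * P) = m" if "coeff P 0 \<noteq> 0" for m and P :: "'k poly poly"
    proof -
      have "poly P 0 \<noteq> 0" using that by (simp add: poly_0_coeff_0)
      moreover from this have "P \<noteq> 0" by auto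
      ultimately show ?thesis by (subst order_mult) (auto simp: order_0I)
    qed
    show ?thesis using arg_cong[OF eq, of "Polynomial.order 0"]
      unfolding o[OF c0ge(1)] o[OF c0ge(2)] .
  qed
  hence \<gamma>\<eta>: "\<gamma> * \<eta> = Q" using eq by simp
  have prod: "coeff \<gamma> 0 * coeff \<eta> 0 = monom u0 (q - 1)"
    using arg_cong[OF \<gamma>\<eta>, of "\<lambda>P. coeff P 0"] Q0 by (simp add: coeff_mult_0)
  obtain c e where ce: "coeff \<gamma> 0 = monom c e" using mult_eq_monomD[OF prod u0] by blast
  obtain c' e' where ce': "coeff \<eta> 0 = monom c' e'"
    using mult_eq_monomD[of "coeff \<eta> 0" "coeff \<gamma> 0", OF _ u0] prod
      by (metis mult.commute)
  have cc: "c \<noteq> 0" "c' \<noteq> 0" using G(3) H(3) ce ce' by auto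
  have "monom (c * c') (e + e') = monom u0 (q - 1)" using prod unfolding ce ce'
    by (simp add: mult_monom)
  hence "e + e' = q - 1" using cc by (metis degree_monom_eq u0 mult_eq_0_iff)
  moreover have "e \<le> i" using deg[of G i] cc unfolding G(2) [symmetric] ce
    by (simp add: degree_monom_eq)
  moreover have "e' \<le> j" using deg[of H j] cc unfolding H(2) [symmetric] ce'
    by (simp add: degree_monom_eq)
  \<comment> \<open>From e + e' = i + j with e <= i and e' <= j follow e = i and e' = j.\<close>
  ultimately have "e > 0" "e' > 0" using ij pos by linarith+
  hence "poly (coeff \<gamma> 0) 0 = 0" "poly (coeff \<eta> 0) 0 = 0" unfolding ce ce'
    by (simp_all add: poly_monom)
  moreover have "coeff Q 1 = coeff \<gamma> 0 * coeff \<eta> 1 + coeff \<gamma> 1 * coeff \<eta> 0"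
    unfolding \<gamma>\<eta> [symmetric] by (simp add: coeff_mult)
  ultimately show False using Q1 by simp
qed

lemma C1_neq_0: "C1 \<noteq> 0"
proof
  assume "C1 = 0"
  hence "eval3 C1 0 1 0 = eval3 (0 :: 'k poly3) 0 1 0" by simp
  thus False using dick1_010 by (simp del: dick1_line)
qed

lemma C1_factors_disjoint_on_line:
  fixes G H :: "'k poly3"
  assumes GH: "C1 = G * H" and zG: "eval3 G x y 0 = 0" and zH: "eval3 H x y 0 = 0"
    and xy: "x \<noteq> 0 \<or> y \<noteq> 0"
  shows False
proof -
  obtain a b where hom: "hom3 G a" "hom3 H b" using hom3_factor[OF hom3_C(1) C1_neq_0 GH] .
  have "eval3 C1 x y 0 = 0" unfolding GH using zG by simp
  hence A: "dA q x y = 0" by simp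
  have x: "x \<noteq> 0" using A xy by (auto simp: dA_0_left)
  define w where "w = y / x"
  have "eval3 G 1 w 0 = 0" "eval3 H 1 w 0 = 0"
    using eval3_scale[OF hom(1), of x 1 w 0] eval3_scale[OF hom(2), of x 1 w 0] zG zH x
    by (simp_all add: w_def)
  moreover from this(1) have "eval3 C1 1 w 0 = 0" unfolding GH by simp
  hence "dA q 1 w = 0" by simp
  ultimately show False using C1_factors_local[OF GH dA_zero] by blast
qed

text \<open>If \<open>A\<close> does not fix \<open>G\<close>, then \<open>G\<close> divides the
  image of \<open>H\<close>, and \<open>C1\<close> splits into \<open>G\<close> and a cofactor that
  contains the image of \<open>G\<close>. At a zero of \<open>G\<close> on the axis of
  \<open>A\<close> both vanish, since \<open>A\<close> fixes the point. \<open>B\<close> moves this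
  axis to Z = 0, where \<open>C1_factors_disjoint_on_line\<close> applies.\<close>

lemma C1_factor_semi_invariant:
  fixes G H :: "'k poly3"
  assumes irr: "irreducible G" and GH: "C1 = G * H" and A: "A \<in> persp"
  shows "semi_invariant A G"
proof -
  obtain B
    where AG: "A \<in> G3" and B: "B \<in> G3" "\<And>v. v $ 3 = 0 \<Longrightarrow> A *v (B *v v) = B *v v"
    using A unfolding persp_def by blast
  obtain a b where hom: "hom3 G a" "hom3 H b" using hom3_factor[OF hom3_C(1) C1_neq_0 GH] .
  have G0: "G \<noteq> 0" using C1_neq_0 GH by auto
  have a: "a \<ge> 1"
  proof (rule ccontr)
    assume "\<not> a \<ge> 1"
    hence "a = 0" by simp
    hence "G dvd 1" using hom(1) G0 by (intro hom3_0_unit) simp_all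
    thus False using irr by (simp add: irreducible_def)
  qed
  interpret lA: comm_ring_hom "lin3 A" unfolding lin3_def
    by (rule comm_ring_hom_sub3[OF comm_ring_hom_const3])
  interpret lB: comm_ring_hom "lin3 B" unfolding lin3_def
    by (rule comm_ring_hom_sub3[OF comm_ring_hom_const3])
  have CA: "C1 = lin3 A G * lin3 A H" using lin3_C(1)[OF AG] unfolding GH lA.hom_mult by simp
  have pr: "prime_elem G" using irr by simp
  have "G dvd lin3 A G * lin3 A H" unfolding CA [symmetric] unfolding GH by (rule dvd_triv_left)
  from prime_elem_dvd_multD[OF pr this] consider "G dvd lin3 A G" | "G dvd lin3 A H" by blast
  thus ?thesis
  proof cases
    case 1
    then obtain K where K: "lin3 A G = G * K" by (rule dvdE)
    have l0: "lin3 A G \<noteq> 0" using C1_neq_0 CA by auto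
    obtain a' b' where ab: "hom3 G a'" "hom3 K b'" "a' + b' = a"
      using hom3_factor[OF hom3_lin3[OF hom(1)] l0 K] .
    have "a' = a" using hom3_unique[OF ab(1) hom(1) G0] .
    hence "hom3 K 0" using ab by simp
    then obtain k where k: "K = const3 k" by (rule hom3_0_imp_const)
    have "k \<noteq> 0" using l0 K k by (auto simp: const3_def)
    moreover have "evalv G (A *v v) = k * evalv G v" for v
      using evalv_lin3[of A G v] unfolding K k by (simp add: mult.commute)
    ultimately show ?thesis unfolding semi_invariant_def by blast
  next
    case 2
    then obtain K where K: "lin3 A H = G * K" by (rule dvdE)
    have "C1 = lin3 B (G * (lin3 A G * K))" 
      using lin3_C(1)[OF B(1)] CA K by (simp add: mult_ac)
    hence C: "C1 = lin3 B G * lin3 B (lin3 A G * K)" by (simp only: lB.hom_mult)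
    obtain x y where xy: "x \<noteq> 0 \<or> y \<noteq> 0" "eval3 (lin3 B G) x y 0 = 0"
      using form_zero_on_line[OF hom3_lin3[OF hom(1), of B] a,
          where ?u1.0 = 1 and ?v1.0 = 0 and ?u2.0 = 0 and ?v2.0 = 1 and ?u3.0 = 0 and ?v3.0 = 0]
      by auto
    let ?v = "vector [x, y, 0] :: 'k ^ 3"
    have z: "evalv G (B *v ?v) = 0" using xy(2) evalv_lin3[of B G ?v] by simp
    have "evalv (lin3 B (lin3 A G * K)) ?v = evalv G (A *v (B *v ?v)) * evalv K (B *v ?v)"
      unfolding evalv_lin3 eval3_simps ..
    also have "A *v (B *v ?v) = B *v ?v" by (rule B(2)) simp
    finally have "eval3 (lin3 B (lin3 A G * K)) x y 0 = 0" using z by simp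
    moreover have "eval3 (lin3 B G) x y 0 = 0" using xy(2) by simp
    ultimately show ?thesis using C1_factors_disjoint_on_line[OF C _ _ xy(1)] by blast
  qed
qed

lemma irreducible_C1: "irreducible C1"
proof -
  have "\<not> C1 dvd 1"
  proof
    assume "C1 dvd 1"
    hence "hom3 C1 0" by (rule unit_imp_hom3_0)
    thus False using hom3_unique[OF _ hom3_C(1) C1_neq_0] degree_bounds(2) by fastforce
  qed
  then obtain S where S: "mset_factors S C1" using mset_factors_exist[OF C1_neq_0] by blast
  then obtain G where G: "irreducible G" "G dvd C1"
    using mset_factorsD(1,2)[OF S] mset_factors_imp_dvd[OF S] by (metis multiset_nonemptyE)
  from G(2) obtain H where GH: "C1 = G * H" by (rule dvdE)
  obtain a b where hom: "hom3 G a" "hom3 H b" "a + b = q ^ 3 - q\<^sup>2"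
    using hom3_factor[OF hom3_C(1) C1_neq_0 GH] .
  have nz: "G \<noteq> 0" "H \<noteq> 0" using C1_neq_0 GH by auto
  have a: "a \<ge> 1"
  proof (rule ccontr)
    assume "\<not> a \<ge> 1"
    hence "a = 0" by simp
    hence "G dvd 1" using hom(1) nz(1) by (intro hom3_0_unit) simp_all
    thus False using G(1) by (simp add: irreducible_def)
  qed
  \<comment> \<open>(0 : 1 : 0) lies on both X = 0 and Z = 0, so this value supplies both
    nonvanishing conditions for every factor.\<close>
  have "eval3 C1 0 1 0 \<noteq> 0" by (simp add: dick1_010 del: dick1_line)
  hence "eval3 G 0 1 0 \<noteq> 0" unfolding GH by simp
  hence "q ^ 3 - q \<le> a \<or> a = q ^ 3 - q\<^sup>2"
    using persp_invariant_degree[OF hom(1) a _ _ C1_factor_semi_invariant[OF G(1) GH]] by blast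
  hence "b = 0" using hom(3) degree_bounds(3) by linarith
  hence "H dvd 1" using hom(2) nz(2) hom3_0_unit by simp
  thus ?thesis using G(1) irreducible_mult_unit_left[of H G] unfolding GH
    by (simp add: mult.commute)
qed

end

section \<open>The second Dickson invariant\<close>

context dgz_field
begin

text \<open>If \<open>dL2\<close> were nonzero, then \<open>dN\<close> = 0 and the second invariant
  reduces to a power of \<open>dL2\<close>. So (x : y) is rational or x = y = 0. In the first case
  \<open>dA\<close> is nonzero, hence \<open>dN\<close> = 0, which becomes a Frobenius equation for
  z divided by the common scale of x and y.\<close>

lemma C2_zero_rational:
  fixes x y z :: 'k
  assumes C2: "dick2 q x y z = 0" and L: "moore012 q x y z = 0"
  shows "\<exists>\<mu> a b c. a \<in> F1 \<and> b \<in> F1 \<and> c \<in> F1 \<and> x = \<mu> * a \<and> y = \<mu> * b \<and> z = \<mu> * c"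
proof -
  have q1: "q - 1 > 0" using q_ge2 by simp
  have dL: "dL2 q x y = 0"
  proof (rule ccontr)
    assume nz: "dL2 q x y \<noteq> 0"
    hence "dN q x y z = 0" using L by (simp add: moore012_eq)
    hence "dick2 q x y z = (dL2 q x y ^ (q - 1)) ^ q" using q1 by (simp add: dick2_def zero_power)
    thus False using nz C2 by simp
  qed
  have main: "\<exists>c. c \<in> F1 \<and> z = \<mu> * c" if "\<mu> \<noteq> 0" "dA q x y = \<mu> ^ ((q - 1) * q)" for \<mu>
  proof -
    have "dA q x y \<noteq> 0" using that by simp
    hence "dN q x y z = 0" using C2 dL q1 q_pos by (simp add: dick2_def zero_power)
    hence "(z ^ q) ^ q = (\<mu> ^ (q - 1) * z) ^ q" using dL q1 that(2)
      by (simp add: dN_def zero_power power_mult power_mult_distrib)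
    hence "z ^ q = \<mu> ^ (q - 1) * z" by simp
    hence "z ^ q * \<mu> = (\<mu> ^ (q - 1) * \<mu>) * z" by (simp add: algebra_simps)
    hence "z ^ q * \<mu> = \<mu> ^ q * z" by (simp only: power_q_m1)
    hence "z / \<mu> \<in> F1" using that(1) by (simp add: F1_iff power_divide field_simps)
    thus ?thesis using that(1) by (intro exI[of _ "z / \<mu>"]) simp
  qed
  show ?thesis
  proof (cases "x = 0")
    case x: True
    show ?thesis
    proof (cases "y = 0")
      case True
      thus ?thesis using x by (intro exI[of _ z] exI[of _ 0] exI[of _ 1]) auto
    next
      case False
      from main[OF False] obtain c where "c \<in> F1" "z = y * c" using x by (auto simp: dA_0_left)
      thus ?thesis using x by (intro exI[of _ y] exI[of _ 0] exI[of _ 1] exI[of _ c]) auto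
    qed
  next
    case False
    define w where "w = y / x"
    have y: "y = x * w" using False by (simp add: w_def)
    have wF: "w \<in> F1" using dL False
      by (simp add: dL2_def F1_iff w_def power_divide field_simps)
    have "dA q x y = x ^ ((q - 1) * q) * dA q 1 w"
    proof -
      have "(x ^ (q - 1)) ^ i * ((x * w) ^ (q - 1)) ^ (q - i)
          = x ^ ((q - 1) * q) * ((1 ^ (q - 1)) ^ i * (w ^ (q - 1)) ^ (q - i))" if "i < Suc q" for i
      proof -
        have "x ^ ((q - 1) * q) = (x ^ (q - 1)) ^ (i + (q - i))" using that
          by (simp add: power_mult)
        thus ?thesis unfolding power_add power_mult_distrib by simp
      qed
      thus ?thesis unfolding dA_def y sum_distrib_left by (intro sum.cong) auto
    qed
    hence "dA q x y = x ^ ((q - 1) * q)" by (simp add: dA_F1[OF wF])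
    from main[OF False this] obtain c where "c \<in> F1" "z = x * c" by blast
    thus ?thesis using wF y by (intro exI[of _ x] exI[of _ 1] exI[of _ w] exI[of _ c]) auto
  qed
qed

text \<open>The line X + \<theta> Y + \<theta>^2 Z = 0 with \<theta> outside \<open>F2\<close> has
  no rational point, because a quadratic relation over \<open>F1\<close> would put \<theta> into
  \<open>F2\<close>. A zero of \<open>G\<close> on it is a zero of \<open>C2\<close> that is not
  rational, so it lies on no rational line.\<close>

lemma form_zero_off_rational_lines:
  fixes G H :: "'k poly3"
  assumes "hom3 G a" "a \<ge> 1" and GH: "C2 = G * H"
  shows "\<exists>x y z. eval3 G x y z = 0 \<and> moore012 q x y z \<noteq> 0"
proof -
  have "F2 \<noteq> UNIV" using card_F2(2) infinite_UNIV by metis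
  then obtain \<theta> where \<theta>: "\<theta> \<notin> F2" by blast
  have indep: "a = 0 \<and> b = 0 \<and> c = 0" if "a \<in> F1" "b \<in> F1" "c \<in> F1" "a + \<theta> * b + \<theta>\<^sup>2 * c = 0" for a b c
  proof -
    have e: "c * \<theta>\<^sup>2 + b * \<theta> + a = 0" using that(4) by (simp add: algebra_simps)
    have c: "c = 0"
    proof (rule ccontr)
      assume "c \<noteq> 0"
      from quadratic_in_F2[OF that(3,2,1) this e] show False using \<theta> by simp
    qed
    have b: "b = 0"
    proof (rule ccontr)
      assume "b \<noteq> 0"
      hence "\<theta> = - a / b" using e c by (simp add: field_simps add_eq_0_iff)
      moreover have "- a / b \<in> F1" by (intro F1_closed that)
      ultimately show False using \<theta> F1_F2 by simp
    qed
    show ?thesis using e b c by simp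
  qed
  obtain s t
    where st: "s \<noteq> 0 \<or> t \<noteq> 0" "eval3 G (s * (- \<theta>) + t * (- \<theta>\<^sup>2)) (s * 1 + t * 0) (s * 0 + t * 1) = 0"
    using form_zero_on_line[OF assms(1,2), where ?u1.0 = "- \<theta>" and ?v1.0 = "- \<theta>\<^sup>2" and ?u2.0 = 1 and ?v2.0 = 0
       and ?u3.0 = 0 and ?v3.0 = 1] by metis
  let ?x = "s * (- \<theta>) + t * (- \<theta>\<^sup>2)"
  have z: "eval3 G ?x s t = 0" using st(2) by simp
  have "moore012 q ?x s t \<noteq> 0"
  proof
    assume L: "moore012 q ?x s t = 0"
    have "eval3 C2 ?x s t = 0" unfolding GH eval3_simps z by simp
    hence "dick2 q ?x s t = 0" unfolding eval3_C2 .
    from C2_zero_rational[OF this L] obtain \<mu> a b c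
      where *: "a \<in> F1" "b \<in> F1" "c \<in> F1"
      "?x = \<mu> * a" "s = \<mu> * b" "t = \<mu> * c" by blast
    have "\<mu> * (a + \<theta> * b + \<theta>\<^sup>2 * c) = ?x + \<theta> * s + \<theta>\<^sup>2 * t"
      unfolding *(4) unfolding *(5,6) by (simp add: algebra_simps)
    also have "\<dots> = 0" by (simp add: algebra_simps)
    finally have "\<mu> = 0 \<or> a + \<theta> * b + \<theta>\<^sup>2 * c = 0" by simp
    hence "s = 0 \<and> t = 0" using indep[OF *(1-3)] *(5,6) by auto
    thus False using st(1) by simp
  qed
  thus ?thesis using z by blast
qed

section \<open>Pulling back along v -> v x v^q\<close>

definition dual3 :: "'k poly3 \<Rightarrow> 'k poly3" where
  "dual3 = sub3 const3 (varY * varZ ^ q - varZ * varY ^ q) (varZ * varX ^ q - varX * varZ ^ q)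
     (varX * varY ^ q - varY * varX ^ q)"

lemma eval3_dual3: "eval3 (dual3 F) x y z
    = eval3 F (y * z ^ q - z * y ^ q) (z * x ^ q - x * z ^ q) (x * y ^ q - y * x ^ q)"
  by (simp add: dual3_def)

lemma comm_ring_hom_dual3: "comm_ring_hom dual3"
  unfolding dual3_def by (rule comm_ring_hom_sub3[OF comm_ring_hom_const3])

lemma dual3_C2: "dual3 C2 = moore012 q varX varY varZ ^ (q\<^sup>2 - q) * C1"
proof -
  interpret d: comm_ring_hom dual3 by (rule comm_ring_hom_dual3)
  have v: "dual3 varX = varY * varZ ^ q - varZ * varY ^ q" "dual3 varY = varZ * varX ^ q - varX * varZ ^ q"
    "dual3 varZ = varX * varY ^ q - varY * varX ^ q"
    unfolding dual3_def by (simp_all add: sub3_var comm_ring_hom_const3)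
  show ?thesis unfolding C2_def C1_def d.hom_dick2 v by (rule P3.dick2_dual(2)[OF moore_neq_0])
qed

text \<open>Under the divisibility, the pullback of \<open>G\<close> divides a power of the Moore
  determinant. This is refuted by a point that the map sends, up to a scalar, to a zero of
  \<open>G\<close> off the rational lines.\<close>

lemma C2_factor_dual:
  fixes G H :: "'k poly3"
  assumes "hom3 G a" "a \<ge> 1" and GH: "C2 = G * H" and dv: "C1 dvd dual3 H"
  shows False
proof -
  interpret d: comm_ring_hom dual3 by (rule comm_ring_hom_dual3)
  let ?L = "moore012 q varX varY varZ :: 'k poly3"
  note dual3_C2
  moreover obtain K where K: "dual3 H = C1 * K" using dv by (rule dvdE)
  ultimately have "C1 * (dual3 G * K) = C1 * ?L ^ (q\<^sup>2 - q)"
    unfolding GH d.hom_mult K by (simp only: mult_ac)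
  hence eq: "dual3 G * K = ?L ^ (q\<^sup>2 - q)" using C1_neq_0 by simp
  obtain a1 a2 a3 where A: "eval3 G a1 a2 a3 = 0" "moore012 q a1 a2 a3 \<noteq> 0"
    using form_zero_off_rational_lines[OF assms(1-3)] by blast
  let ?M = "moore012 q a1 a2 a3"
  define u where "u = a2 * a3 ^ q - a3 * a2 ^ q"
  define v where "v = a3 * a1 ^ q - a1 * a3 ^ q"
  define w where "w = a1 * a2 ^ q - a2 * a1 ^ q"
  \<comment> \<open>For u = a x a^q one has u x u^q = M a^q, where M is the Moore determinant at a.
    Taking q-th roots of all entries gives a preimage of a up to the scalar \<mu>.\<close>
  obtain x y z \<mu> where r: "x ^ q = u" "y ^ q = v" "z ^ q = w" "\<mu> ^ q = ?M"
    using root_exists[OF q_pos] by metis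
  have cr: "v * w ^ q - w * v ^ q = ?M * a1 ^ q" "w * u ^ q - u * w ^ q = ?M * a2 ^ q"
     "u * v ^ q - v * u ^ q = ?M * a3 ^ q"
    unfolding u_def v_def w_def moore012_def det3_def
      by (simp_all add: power_mult_distrib algebra_simps)
  have "(y * z ^ q - z * y ^ q) ^ q = (\<mu> * a1) ^ q" "(z * x ^ q - x * z ^ q) ^ q = (\<mu> * a2) ^ q"
    "(x * y ^ q - y * x ^ q) ^ q = (\<mu> * a3) ^ q"
    using cr by (simp_all add: power_mult_distrib r)
  hence "y * z ^ q - z * y ^ q = \<mu> * a1" "z * x ^ q - x * z ^ q = \<mu> * a2" "x * y ^ q - y * x ^ q = \<mu> * a3"
    unfolding q_eq_iff by blast+
  hence "eval3 (dual3 G) x y z = \<mu> ^ a * eval3 G a1 a2 a3"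
    unfolding eval3_dual3 by (simp only: eval3_scale[OF assms(1)])
  hence "eval3 (?L ^ (q\<^sup>2 - q)) x y z = 0" unfolding eq [symmetric] using A(1) by simp
  hence "moore012 q x y z = 0" by (simp add: eval3_moore012)
  hence "moore012 q x y z ^ q = 0" using q_pos by (simp add: zero_power)
  moreover have "moore012 q x y z ^ q = moore012 q u v w"
    by (simp add: moore012_def det3_def power_mult_distrib r)
  moreover have "moore012 q u v w = ?M ^ (q + 1)"
    unfolding u_def v_def w_def by (rule dick2_dual(1)[OF A(2)])
  ultimately show False using A(2) by simp
qed

lemma C2_neq_0: "C2 \<noteq> 0"
proof
  assume "C2 = 0"
  have "F1 \<noteq> UNIV" using card_F1(2) infinite_UNIV by metis
  then obtain x where x: "x \<notin> F1" by blast
  have "eval3 C2 x 1 0 = 0" using \<open>C2 = 0\<close> by simp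
  moreover have "dL2 q x 1 \<noteq> 0" using x by (simp add: dL2_def F1_iff)
  ultimately show False using q_ge2 by (simp add: dick2_def dN_def zero_power)
qed

lemma irreducible_C2: "irreducible C2"
proof (rule irreducibleI[OF C2_neq_0])
  show "\<not> C2 dvd 1"
  proof
    assume "C2 dvd 1"
    hence "hom3 C2 0" by (rule unit_imp_hom3_0)
    thus False using hom3_unique[OF _ hom3_C(2) C2_neq_0] degree_bounds(2,3) by fastforce
  qed
next
  fix G H assume GH: "C2 = G * H"
  obtain a b where hom: "hom3 G a" "hom3 H b" using hom3_factor[OF hom3_C(2) C2_neq_0 GH] .
  have nz: "G \<noteq> 0" "H \<noteq> 0" using C2_neq_0 GH by auto
  show "G dvd 1 \<or> H dvd 1"
  proof (cases "a = 0 \<or> b = 0")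
    case True
    thus ?thesis using hom nz hom3_0_unit by metis
  next
    case False
    interpret d: comm_ring_hom dual3 by (rule comm_ring_hom_dual3)
    have "C1 dvd dual3 G * dual3 H" unfolding d.hom_mult [symmetric] GH [symmetric] dual3_C2
      by (rule dvd_triv_right)
    moreover have "prime_elem C1" using irreducible_C1 by simp
    ultimately have "C1 dvd dual3 G \<or> C1 dvd dual3 H" by (rule prime_elem_dvd_multD[rotated])
    moreover have "C2 = H * G" using GH by (simp only: mult.commute)
    ultimately show ?thesis
      using C2_factor_dual[OF hom(1) _ GH] C2_factor_dual[OF hom(2) _ \<open>C2 = H * G\<close>] False
      by (metis One_nat_def Suc_leI gr0I)
  qed
qed

end

section \<open>The DGZ curve\<close>

definition dehom3 :: "'k::comm_ring_1 poly3 \<Rightarrow> 'k poly poly" where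
  "dehom3 = sub3 (\<lambda>k. [:[:k:]:]) Xa Ya 1"

lemma comm_ring_hom_dehom3: "comm_ring_hom (dehom3 :: 'k::comm_ring_1 poly3 \<Rightarrow> _)"
  unfolding dehom3_def by (rule comm_ring_hom_sub3[OF comm_ring_hom_const2])

lemma dehom3_mono3: "dehom3 (mono3 c i j k) = monom (monom c j) i"
proof -
  interpret comm_ring_hom dehom3 by (rule comm_ring_hom_dehom3)
  have X: "(Xa :: 'a poly poly) ^ i = monom 1 i" by (simp add: Xa_def monom_power)
  have Y: "(Ya :: 'a poly poly) ^ j = monom (monom 1 j) 0"
    by (simp add: Ya_def poly_const_pow monom_power monom_0)
  have "dehom3 (mono3 c i j k) = [:[:c:]:] * Xa ^ i * Ya ^ j"
    unfolding mono3_altdef hom_mult hom_power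
    by (simp add: dehom3_def sub3_var comm_ring_hom_const2)
  also have "\<dots> = monom (monom c j) i"
    unfolding X Y monom_0 [symmetric] by (simp add: mult_monom)
  finally show ?thesis .
qed

lemma coeff_dehom3: "coeff (coeff (dehom3 F) i) j = poly (coeff (coeff F i) j) 1"
proof -
  interpret comm_ring_hom dehom3 by (rule comm_ring_hom_dehom3)
  show ?thesis
    by (induction F rule: poly3_mono_induct)
       (simp_all add: hom_add dehom3_mono3, simp add: mono3_def poly_monom)
qed

lemma coeff_dehom3_hom3:
  fixes F :: "'k::comm_ring_1 poly3"
  assumes "hom3 F d"
  shows "coeff (coeff (dehom3 F) i) j = (if i + j \<le> d then coeff3 F i j (d - i - j) else 0)"
proof -
  have "coeff (coeff F i) j = (if i + j \<le> d then monom (coeff3 F i j (d - i - j)) (d - i - j) else 0)"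
  proof (rule poly_eqI)
    fix k
    show "coeff (coeff (coeff F i) j) k =
        coeff (if i + j \<le> d then monom (coeff3 F i j (d - i - j)) (d - i - j) else 0) k"
    proof (cases "coeff3 F i j k = 0")
      case True
      thus ?thesis by (auto simp: coeff3_def)
    next
      case False
      hence "i + j + k = d" using assms unfolding hom3_def by blast
      hence "i + j \<le> d" "d - i - j = k" by auto
      thus ?thesis by (simp add: coeff3_def)
    qed
  qed
  thus ?thesis unfolding coeff_dehom3 by (simp add: poly_monom)
qed

lemma dehom3_inject:
  fixes F G :: "'k::comm_ring_1 poly3"
  assumes "hom3 F d" "hom3 G d" "dehom3 F = dehom3 G"
  shows "F = G"
proof (rule poly3_eqI)
  fix i j k
  show "coeff3 F i j k = coeff3 G i j k"
  proof (cases "i + j + k = d")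
    case True
    hence "i + j \<le> d" "d - i - j = k" by auto
    thus ?thesis
      using coeff_dehom3_hom3[OF assms(1), of i j] coeff_dehom3_hom3[OF assms(2), of i j] assms(3)
        by simp
  next
    case False
    thus ?thesis using assms(1,2) unfolding hom3_def by metis
  qed
qed

lemma tdeg_dehom3:
  fixes F :: "'k::comm_ring_1 poly3"
  assumes "hom3 F d" "coeff3 F i j 0 \<noteq> 0"
  shows "tdeg (dehom3 F) = d"
  unfolding tdeg_def
proof (rule Max_eqI)
  have le: "i + j \<le> d" if "coeff (coeff (dehom3 F) i) j \<noteq> 0" for i j
    using that coeff_dehom3_hom3[OF assms(1), of i j] by (auto split: if_splits)
  have sub: "{i + j |i j. coeff (coeff (dehom3 F) i) j \<noteq> 0} \<subseteq> {..d}"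
  proof
    fix m assume "m \<in> {i + j |i j. coeff (coeff (dehom3 F) i) j \<noteq> 0}"
    then obtain i j where "m = i + j" "coeff (coeff (dehom3 F) i) j \<noteq> 0" by blast
    thus "m \<in> {..d}" using le[of i j] by simp
  qed
  thus "finite {i + j |i j. coeff (coeff (dehom3 F) i) j \<noteq> 0}" by (rule finite_subset) simp
  show "m \<le> d" if "m \<in> {i + j |i j. coeff (coeff (dehom3 F) i) j \<noteq> 0}" for m
    using subsetD[OF sub that] by simp
  have "i + j + 0 = d" using assms unfolding hom3_def by blast
  hence ij: "i + j = d" by simp
  hence "coeff (coeff (dehom3 F) i) j \<noteq> 0"
    using assms(2) coeff_dehom3_hom3[OF assms(1), of i j] by auto
  thus "d \<in> {i + j |i j. coeff (coeff (dehom3 F) i) j \<noteq> 0}" using ij by blast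
qed

text \<open>A monomial free of Z keeps the total degree d when Z becomes 1; otherwise homogenising
  would return F with a power of Z missing.\<close>

lemma homogenize_dehom3:
  fixes F :: "'k::comm_ring_1 poly3"
  assumes "hom3 F d" "coeff3 F i j 0 \<noteq> 0"
  shows "homogenize (dehom3 F) = F"
proof (rule dehom3_inject[of _ d])
  interpret comm_ring_hom "dehom3 :: 'k poly3 \<Rightarrow> _" by (rule comm_ring_hom_dehom3)
  let ?f = "dehom3 F"
  have h: "homogenize ?f = (\<Sum>i\<le>degree ?f. \<Sum>j\<le>degree (coeff ?f i). mono3 (coeff (coeff ?f i) j) i j (d - i - j))"
    unfolding homogenize_def tdeg_dehom3[OF assms] mono3_def ..
  show "hom3 (homogenize ?f) d" unfolding h
  proof (intro hom3_sum)
    fix i j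
    show "hom3 (mono3 (coeff (coeff ?f i) j) i j (d - i - j)) d"
      using coeff_dehom3_hom3[OF assms(1), of i j] by (auto simp: hom3_def coeff3_mono3)
  qed
  have "dehom3 (homogenize ?f) = (\<Sum>i\<le>degree ?f. \<Sum>j\<le>degree (coeff ?f i). monom (monom (coeff (coeff ?f i) j) j) i)"
    unfolding h hom_sum dehom3_mono3 ..
  also have "\<dots> = (\<Sum>i\<le>degree ?f. monom (\<Sum>j\<le>degree (coeff ?f i). monom (coeff (coeff ?f i) j) j) i)"
    by (simp add: monom_hom.hom_sum)
  also have "\<dots> = ?f" by (simp add: poly_as_sum_of_monoms)
  finally show "dehom3 (homogenize ?f) = ?f" .
qed fact

context dgz_field
begin

lemma coeff3_Z0_neq_0:
  fixes F :: "'k poly3"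
  assumes "eval3 F x y 0 \<noteq> 0"
  shows "\<exists>i j. coeff3 F i j 0 \<noteq> 0"
proof (rule ccontr)
  assume *: "\<not> ?thesis"
  have "varZ ^ 1 dvd F" by (rule varZ_power_dvd) (use * in auto)
  then obtain G where "F = varZ * G" by (metis dvdE power_one_right)
  hence "eval3 F x y 0 = 0" by simp
  thus False using assms by simp
qed

text \<open>At Z = 1 the Moore determinants have a column of ones, and clearing it leaves the 2-by-2
  expressions of the affine equation. Numerator and denominator acquire the same sign.\<close>

lemma dgz_aff_eq: "(dgz_aff q :: 'k poly poly) = dehom3 C1"
proof -
  interpret d: comm_ring_hom "dehom3 :: 'k poly3 \<Rightarrow> _" by (rule comm_ring_hom_dehom3)
  let ?X = "Xa :: 'k poly poly" and ?Y = "Ya :: 'k poly poly"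
  have v: "dehom3 varX = ?X" "dehom3 varY = ?Y" "dehom3 varZ = 1"
    unfolding dehom3_def by (simp_all add: sub3_var comm_ring_hom_const2)
  have C: "dehom3 C1 = dick1 q ?X ?Y 1" unfolding C1_def d.hom_dick1 v ..
  have nz: "moore012 q ?X ?Y 1 \<noteq> 0"
  proof
    assume 0: "moore012 q ?X ?Y 1 = 0"
    obtain x z :: 'k where xz: "moore012 q x 1 z \<noteq> 0" using moore_point by blast
    have "poly (poly (moore012 q ?X ?Y 1) [:x:]) z = moore012 q x z 1"
      by (simp add: moore012_def det3_def Xa_def Ya_def poly_monom poly_power)
    hence "moore012 q x z 1 = 0" unfolding 0 by simp
    moreover have "moore012 q x z 1 = - moore012 q x 1 z"
      by (simp add: moore012_def det3_def algebra_simps)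
    ultimately show False using xz by simp
  qed
  hence L: "dL2 q ?X ?Y \<noteq> 0" unfolding P2.moore012_eq by auto
  have e: "x ^ (q ^ 2) = (x ^ q) ^ q" "x ^ (q ^ 3) = ((x ^ q) ^ q) ^ q" for x :: "'k poly poly"
    by (simp_all add: power2_eq_square power3_eq_cube power_mult)
  have "(?X ^ (q^3) - ?X) * (?Y ^ q - ?Y) - (?Y ^ (q^3) - ?Y) * (?X ^ q - ?X) = - moore013 q ?X ?Y 1"
    unfolding e moore013_def det3_def by (simp add: algebra_simps)
  also have "\<dots> = - moore012 q ?X ?Y 1 * dick1 q ?X ?Y 1"
    unfolding P2.moore013_eq[OF L] by simp
  finally have num: "(?X ^ (q^3) - ?X) * (?Y ^ q - ?Y) - (?Y ^ (q^3) - ?Y) * (?X ^ q - ?X)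
     = - moore012 q ?X ?Y 1 * dick1 q ?X ?Y 1" .
  have den: "(?X ^ (q^2) - ?X) * (?Y ^ q - ?Y) - (?Y ^ (q^2) - ?Y) * (?X ^ q - ?X) = - moore012 q ?X ?Y 1"
    unfolding e moore012_def det3_def by (simp add: algebra_simps)
  show ?thesis unfolding dgz_aff_def num den C using nz by (intro nonzero_mult_div_cancel_left) simp
qed

lemma dgz_curve_eq: "(dgz_curve q :: 'k poly3) = C1"
proof -
  have "eval3 C1 0 1 0 \<noteq> 0" using dick1_010 by (simp del: dick1_line)
  then obtain i j where "coeff3 C1 i j 0 \<noteq> 0" using coeff3_Z0_neq_0 by blast
  thus ?thesis unfolding dgz_curve_def dgz_aff_eq by (rule homogenize_dehom3[OF hom3_C(1)])
qed

section \<open>The two smallest degrees and the final uniqueness\<close>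

lemma inv_irr_C1: "inv_irr_curve G3 C1 (q ^ 3 - q\<^sup>2)"
  unfolding inv_irr_curve_def plane_curve_deg_def invariant_curve_iff
  using hom3_C(1) C1_neq_0 irreducible_C1 invariant_C(1) degree_bounds(2) unfolding hom3_def
    by blast

lemma inv_irr_C2: "inv_irr_curve G3 C2 (q ^ 3 - q)"
  unfolding inv_irr_curve_def plane_curve_deg_def invariant_curve_iff
  using hom3_C(2) C2_neq_0 irreducible_C2 invariant_C(2) degree_bounds(2,3) unfolding hom3_def
  by (meson le_trans less_imp_le)

text \<open>Vanishing on Z = 0 would make Z a factor, and an irreducible form with this factor has
  degree 1. The line X = 0 is reached by the group element that exchanges X and Z.\<close>

lemma inv_irr_not_on_line:
  assumes F: "inv_irr_curve G3 F d" and d: "d \<ge> 2"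
  shows "\<exists>x y. eval3 F x y 0 \<noteq> 0" "\<exists>y z. eval3 F 0 y z \<noteq> 0"
proof -
  have F': "hom3 F d" "F \<noteq> 0" "irreducible F" and inv: "\<And>A. A \<in> G3 \<Longrightarrow> semi_invariant A F"
    using F unfolding inv_irr_curve_def plane_curve_deg_def invariant_curve_iff hom3_def by auto
  show nz: "\<exists>x y. eval3 F x y 0 \<noteq> 0"
  proof (rule ccontr)
    assume *: "\<not> ?thesis"
    have 0: "const3 0 = (0 :: 'k poly3)" by (simp add: const3_def)
    have "comp3 F varX varY 0 = 0" by (rule poly3_eq_0I[OF infinite_UNIV]) (use * in simp)
    hence "coeff3 F i j 0 = 0" for i j using coeff3_scale_Z[of 0 F i j 0] by (simp add: 0)
    hence "varZ ^ 1 dvd F" by (intro varZ_power_dvd) simp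
    then obtain G where G: "F = varZ * G" by (metis dvdE power_one_right)
    obtain a b where hom: "hom3 (varZ :: 'k poly3) a" "hom3 G b" "a + b = d"
      using hom3_factor[OF F'(1,2) G] .
    have vz: "varZ \<noteq> (0 :: 'k poly3)" using F'(2) G by auto
    have a: "a = 1" using hom3_unique[OF hom(1) hom3_var(3) vz] .
    have "varZ dvd (1 :: 'k poly3) \<or> G dvd 1" using F'(3) G by (rule irreducibleD)
    thus False
    proof
      assume "varZ dvd (1 :: 'k poly3)"
      hence "hom3 (varZ :: 'k poly3) 0" by (rule unit_imp_hom3_0)
      thus False using hom3_unique[OF _ hom3_var(3) vz] by fastforce
    next
      assume "G dvd 1"
      hence "hom3 G 0" by (rule unit_imp_hom3_0)
      moreover have "G \<noteq> 0" using F'(2) G by auto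
      ultimately have "b = 0" using hom3_unique[OF _ hom(2)] by simp
      thus False using a hom(3) d by simp
    qed
  qed
  have "mat3 0 0 1 0 1 0 1 0 0 \<in> G3" by (auto simp: mat3_in_G3 det3_def)
  from inv[OF this] obtain s
    where s: "\<forall>x y z. eval3 F (0 * x + 0 * y + 1 * z) (0 * x + 1 * y + 0 * z)
      (1 * x + 0 * y + 0 * z) = s * eval3 F x y z"
    unfolding semi_invariant_mat3 by blast
  obtain x y where xy: "eval3 F x y 0 \<noteq> 0" using nz by blast
  have "eval3 F x y 0 = s * eval3 F 0 y x" using s[rule_format, of 0 y x] by simp
  hence "eval3 F 0 y x \<noteq> 0" using xy by auto
  thus "\<exists>y z. eval3 F 0 y z \<noteq> 0" by blast
qed

lemma inv_irr_degree:
  assumes "inv_irr_curve G3 F d" "d \<ge> 2"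
  shows "d = q ^ 3 - q\<^sup>2 \<or> q ^ 3 - q \<le> d"
proof -
  have F: "hom3 F d" "\<And>A. A \<in> persp \<Longrightarrow> semi_invariant A F"
    using assms(1)
      unfolding inv_irr_curve_def plane_curve_deg_def invariant_curve_iff hom3_def persp_def by auto
  show ?thesis
    using persp_invariant_degree[OF F(1) _ inv_irr_not_on_line[OF assms] F(2)] assms(2) by fastforce
qed

lemma degree_ge2: "2 \<le> q ^ 3 - q\<^sup>2"
proof -
  have "2 * 2 \<le> q * q" using q_ge2 by (intro mult_le_mono)
  moreover have "q * q * 1 \<le> q * q * (q - 1)" using q_ge2 by (intro mult_le_mono2) simp
  ultimately show ?thesis unfolding degree_bounds(1) unfolding power2_eq_square by linarith
qed

lemma dG_eq: "dG G3 = q ^ 3 - q\<^sup>2"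
  unfolding dG_def
proof (rule Least_equality)
  show "2 \<le> q ^ 3 - q\<^sup>2 \<and> (\<exists>F. inv_irr_curve G3 F (q ^ 3 - q\<^sup>2))"
    using inv_irr_C1 degree_ge2 by blast
  show "q ^ 3 - q\<^sup>2 \<le> d" if "2 \<le> d \<and> (\<exists>F. inv_irr_curve G3 F d)" for d
    using that inv_irr_degree degree_bounds(3) by fastforce
qed

lemma d'G_eq: "d'G G3 = q ^ 3 - q"
  unfolding d'G_def dG_eq
proof (rule Least_equality)
  show "q ^ 3 - q\<^sup>2 < q ^ 3 - q \<and> (\<exists>F. inv_irr_curve G3 F (q ^ 3 - q))"
    using inv_irr_C2 degree_bounds(3) by blast
  show "q ^ 3 - q \<le> d" if "q ^ 3 - q\<^sup>2 < d \<and> (\<exists>F. inv_irr_curve G3 F d)" for d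
    using that inv_irr_degree[of _ d] degree_ge2 by fastforce
qed

lemma epsG_eq: "epsG G3 = q\<^sup>2 - q"
proof -
  have "q\<^sup>2 \<le> q ^ 3" "q \<le> q\<^sup>2" using q_ge2
    by (simp_all add: power2_eq_square power3_eq_cube)
  thus ?thesis unfolding epsG_def d'G_eq dG_eq by simp
qed

lemma inv_irr_unique:
  assumes "inv_irr_curve G3 F (q ^ 3 - q\<^sup>2)"
  shows "\<exists>c. c \<noteq> 0 \<and> F = const3 c * C1"
proof (rule invariant_unique)
  show "hom3 F (q ^ 3 - q\<^sup>2)"
    using assms unfolding inv_irr_curve_def plane_curve_deg_def hom3_def by blast
  show "semi_invariant A F" if "A \<in> G3" for A
    using assms that unfolding inv_irr_curve_def invariant_curve_iff by blast
qed (use hom3_C(1) invariant_C(1) inv_irr_not_on_line[OF assms degree_ge2]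
    inv_irr_not_on_line[OF inv_irr_C1 degree_ge2] in blast)+

end

theorem mainTheorem7:
  fixes p n q :: nat
  assumes "prime p" and "n \<ge> 1" and "q = p ^ n"
    and "CHAR('k::field) = p"
    and "\<forall>f :: 'k poly. degree f > 0 \<longrightarrow> (\<exists>x. poly f x = 0)"
    and "\<forall>x :: 'k. \<exists>m \<ge> 1. x ^ (p ^ m) = x"
  shows "dG (PGL3 q :: ('k ^ 3 ^ 3) set) = q^3 - q^2
    \<and> epsG (PGL3 q :: ('k ^ 3 ^ 3) set) = q^2 - q
    \<and> inv_irr_curve (PGL3 q :: ('k ^ 3 ^ 3) set) (dgz_curve q) (q^3 - q^2)
    \<and> (\<forall>F. inv_irr_curve (PGL3 q :: ('k ^ 3 ^ 3) set) F (q^3 - q^2)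
           \<longrightarrow> (\<exists>c::'k. c \<noteq> 0 \<and> F = const3 c * dgz_curve q))"
proof -
  interpret dgz_field p n q "TYPE('k)"
    by unfold_locales (use assms in auto)
  show ?thesis
    unfolding dgz_curve_eq using dG_eq epsG_eq inv_irr_C1 inv_irr_unique by blast
qed

end
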